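(* For $B\in\mathrm{SL}(2,\mathbb Z)$ with $\operatorname{tr}B>2$, let $\lambda(B)$ be any of the two eigenvalues of $B$. The map $$\mathcal G\longrightarrow\mathcal K,\qquad\mathrm{Osc}^r(B,l)\longmapsto\mathbb Q(\lambda(B))$$ from the set $\mathcal G$ of isomorphism classes of discrete split oscillator groups to the set $\mathcal K$ of real quadratic fields induces a bijection from the set of abstract commensurability classes of discrete split oscillator groups to $\mathcal K$.
   Context: Two groups $G_1,G_2$ are abstractly commensurable if there are finite-index subgroups $H_1\subset G_1$ and $H_2\subset G_2$ with $H_1\cong H_2$. Real quadratic fields are regarded as subfields of $\mathbb R$. $H^r(\mathbb Z)=\langle\alpha,\beta,\gamma\mid\alpha\beta\alpha^{-1}\beta^{-1}=\gamma^r,\alpha\gamma=\gamma\alpha,\beta\gamma=\gamma\beta\rangle$ for $r\ge1$. For $B=\begin{pmatrix}a&b\\c&d\end{pmatrix}\in\mathrm{SL}(2,\mathbb Z)$ with $\operatorname{tr}B>2$ and $l=(l_1,l_2)\in(\mathbb Z/r\mathbb Z)^2$ (represented by an integer vector; up to isomorphism the choice does not matter), $\mathrm{Osc}^r(B,l):=H^r(\mathbb Z)\rtimes_\phi\mathbb Z\cdot\delta$ with $\phi(\delta)(\alpha)=\alpha^a\beta^c\gamma^{-l_2}$, $\phi(\delta)(\beta)=\alpha^b\beta^d\gamma^{l_1}$, $\phi(\delta)(\gamma)=\gamma$. A discrete split oscillator group is a semidirect product $H_d\rtimes_\phi\mathbb Z\delta$, with $H_d\cong H^r(\mathbb Z)$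 for some $r\ge1$, for which the automorphism induced by $\phi(\delta)$ on $H_d/Z(H_d)\cong\mathbb Z^2$ lies in $\{B\in\mathrm{SL}(2,\mathbb Z)\mid\operatorname{tr}B>2\}$; each is isomorphic to some $\mathrm{Osc}^r(B,l)$. *)

theory Defs
  imports "HOL-Algebra.Algebra" "HOL-Algebra.Algebraic_Closure_Type" "HOL-Analysis.Analysis"
begin

section \<open>Groups given by generators and relations\<close>

text \<open>The letter \<open>(x, True)\<close> stands for the generator \<open>x\<close> and \<open>(x, False)\<close> for its inverse.
  A relation \<open>u = v\<close> is the pair of words \<open>(u, v)\<close>.\<close>

type_synonym 'g word = "('g \<times> bool) list"

inductive word_eq :: "('g word \<times> 'g word) set \<Rightarrow> 'g word \<Rightarrow> 'g word \<Rightarrow> bool"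
  for R :: "('g word \<times> 'g word) set" where
  refl: "word_eq R u u"
| sym: "word_eq R u v \<Longrightarrow> word_eq R v u"
| trans: "word_eq R u v \<Longrightarrow> word_eq R v w \<Longrightarrow> word_eq R u w"
| append: "word_eq R u u' \<Longrightarrow> word_eq R v v' \<Longrightarrow> word_eq R (u @ v) (u' @ v')"
| cancel: "word_eq R [(x, b), (x, \<not> b)] []"
| relation: "(u, v) \<in> R \<Longrightarrow> word_eq R u v"

definition word_class :: "('g word \<times> 'g word) set \<Rightarrow> 'g word \<Rightarrow> 'g word set" where
  "word_class R u = {v. word_eq R u v}"

definition presented_group :: "('g word \<times> 'g word) set \<Rightarrow> 'g word set monoid" where
  "presented_group R =
     \<lparr>carrier = range (word_class R),
      monoid.mult = (\<lambda>U V. \<Union>u\<in>U. \<Union>v\<in>V. word_class R (u @ v)),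
      one = word_class R []\<rparr>"

section \<open>The discrete Heisenberg groups\<close>

datatype heis_gen = Gen_alpha | Gen_beta | Gen_gamma

definition heis_relations :: "nat \<Rightarrow> (heis_gen word \<times> heis_gen word) set" where
  "heis_relations r =
     {([(Gen_alpha, True), (Gen_beta, True), (Gen_alpha, False), (Gen_beta, False)], replicate r (Gen_gamma, True)),
      ([(Gen_alpha, True), (Gen_gamma, True)], [(Gen_gamma, True), (Gen_alpha, True)]),
      ([(Gen_beta, True), (Gen_gamma, True)], [(Gen_gamma, True), (Gen_beta, True)])}"

definition heisenberg_group :: "nat \<Rightarrow> heis_gen word set monoid" where
  "heisenberg_group r = presented_group (heis_relations r)"

definition heis_elem :: "nat \<Rightarrow> heis_gen \<Rightarrow> heis_gen word set" where
  "heis_elem r x = word_class (heis_relations r) [(x, True)]"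

section \<open>Semidirect products and discrete split oscillator groups\<close>

definition semidirect_product ::
  "'a monoid \<Rightarrow> 'b monoid \<Rightarrow> ('b \<Rightarrow> 'a \<Rightarrow> 'a) \<Rightarrow> ('a \<times> 'b) monoid" where
  "semidirect_product H K \<phi> =
     \<lparr>carrier = carrier H \<times> carrier K,
      monoid.mult = (\<lambda>(h, k) (h', k'). (h \<otimes>\<^bsub>H\<^esub> \<phi> k h', k \<otimes>\<^bsub>K\<^esub> k')),
      one = (\<one>\<^bsub>H\<^esub>, \<one>\<^bsub>K\<^esub>)\<rparr>"

definition center :: "'a monoid \<Rightarrow> 'a set" where
  "center G = {z \<in> carrier G. \<forall>x\<in>carrier G. z \<otimes>\<^bsub>G\<^esub> x = x \<otimes>\<^bsub>G\<^esub> z}"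

definition int_vec_group :: "(int ^ 2) monoid" where
  "int_vec_group = \<lparr>carrier = UNIV, monoid.mult = (+), one = 0\<rparr>"

definition hyperbolic_SL2Z :: "(int ^ 2 ^ 2) set" where
  "hyperbolic_SL2Z = {B. det B = 1 \<and> trace B > 2}"

text \<open>The automorphism induced by \<open>f\<close> on \<open>H / Z(H)\<close> sends a coset \<open>C\<close> to \<open>f ` C\<close>; \<open>\<psi>\<close> is an
  identification of \<open>H / Z(H)\<close> with \<open>\<int>\<^sup>2\<close>. Changing \<open>\<psi>\<close> conjugates \<open>B\<close> by an element of
  \<open>GL(2, \<int>)\<close>, which affects neither determinant nor trace.\<close>

definition induces_hyperbolic :: "'a monoid \<Rightarrow> ('a \<Rightarrow> 'a) \<Rightarrow> bool" where
  "induces_hyperbolic H f \<longleftrightarrow>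
     (\<exists>\<psi>\<in>iso (H Mod center H) int_vec_group. \<exists>B\<in>hyperbolic_SL2Z.
        \<forall>C\<in>carrier (H Mod center H). \<psi> (f ` C) = B *v \<psi> C)"

definition discrete_split_oscillator_group :: "'a monoid \<Rightarrow> bool" where
  "discrete_split_oscillator_group G \<longleftrightarrow> group G \<and>
     (\<exists>(H :: 'a monoid) r \<phi>. group H \<and> r \<ge> 1 \<and> H \<cong> heisenberg_group r \<and>
        \<phi> \<in> hom integer_group (AutoGroup H) \<and> induces_hyperbolic H (\<phi> 1) \<and>
        G \<cong> semidirect_product H integer_group \<phi>)"

text \<open>The automorphism \<open>\<phi>(\<delta>)\<close> of the Heisenberg group is determined by its values on the
  generators; \<open>ex1_osc_aut\<close> below shows that it exists.\<close>

definition is_osc_aut :: "nat \<Rightarrow> int ^ 2 ^ 2 \<Rightarrow> int ^ 2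
    \<Rightarrow> (heis_gen word set \<Rightarrow> heis_gen word set) \<Rightarrow> bool" where
  "is_osc_aut r B l f \<longleftrightarrow>
     (let H = heisenberg_group r;
          \<alpha> = heis_elem r Gen_alpha; \<beta> = heis_elem r Gen_beta; \<gamma> = heis_elem r Gen_gamma
      in f \<in> auto H \<and>
         f \<alpha> = \<alpha> [^]\<^bsub>H\<^esub> (B$1$1) \<otimes>\<^bsub>H\<^esub> \<beta> [^]\<^bsub>H\<^esub> (B$2$1) \<otimes>\<^bsub>H\<^esub> \<gamma> [^]\<^bsub>H\<^esub> (- (l$2)) \<and>
         f \<beta> = \<alpha> [^]\<^bsub>H\<^esub> (B$1$2) \<otimes>\<^bsub>H\<^esub> \<beta> [^]\<^bsub>H\<^esub> (B$2$2) \<otimes>\<^bsub>H\<^esub> \<gamma> [^]\<^bsub>H\<^esub> (l$1) \<and>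
         f \<gamma> = \<gamma>)"

definition osc_aut :: "nat \<Rightarrow> int ^ 2 ^ 2 \<Rightarrow> int ^ 2
    \<Rightarrow> heis_gen word set \<Rightarrow> heis_gen word set" where
  "osc_aut r B l = (THE f. is_osc_aut r B l f)"

definition Osc :: "nat \<Rightarrow> int ^ 2 ^ 2 \<Rightarrow> int ^ 2 \<Rightarrow> (heis_gen word set \<times> int) monoid" where
  "Osc r B l = semidirect_product (heisenberg_group r) integer_group
     (\<lambda>n::int. osc_aut r B l [^]\<^bsub>AutoGroup (heisenberg_group r)\<^esub> n)"

section \<open>Isomorphism and commensurability classes\<close>

definition abstractly_commensurable :: "'a monoid \<Rightarrow> 'b monoid \<Rightarrow> bool" where
  "abstractly_commensurable G\<^sub>1 G\<^sub>2 \<longleftrightarrow>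
     (\<exists>H\<^sub>1 H\<^sub>2. subgroup H\<^sub>1 G\<^sub>1 \<and> finite (rcosets\<^bsub>G\<^sub>1\<^esub> H\<^sub>1) \<and>
              subgroup H\<^sub>2 G\<^sub>2 \<and> finite (rcosets\<^bsub>G\<^sub>2\<^esub> H\<^sub>2) \<and>
              G\<^sub>1\<lparr>carrier := H\<^sub>1\<rparr> \<cong> G\<^sub>2\<lparr>carrier := H\<^sub>2\<rparr>)"

text \<open>The groups under consideration have their elements in a fixed type \<open>'a\<close>. They are
  countable, so every isomorphism class is represented as soon as \<open>'a\<close> is infinite.\<close>

definition osc_groups :: "'a monoid set" where
  "osc_groups = {G. discrete_split_oscillator_group G}"

definition osc_iso_classes :: "'a monoid set set" where
  "osc_iso_classes = osc_groups // {(G, G'). G \<in> osc_groups \<and> G' \<in> osc_groups \<and> G \<cong> G'}"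

definition osc_comm_classes :: "'a monoid set set" where
  "osc_comm_classes =
     osc_groups // {(G, G'). G \<in> osc_groups \<and> G' \<in> osc_groups \<and> abstractly_commensurable G G'}"

text \<open>In the next definition \<open>G\<close> may live on another type, as \<open>Osc r B l\<close> does.\<close>

definition osc_iso_class :: "'b monoid \<Rightarrow> 'a monoid set" where
  "osc_iso_class G = {G' \<in> osc_groups. G \<cong> G'}"

definition osc_comm_class :: "'a monoid \<Rightarrow> 'a monoid set" where
  "osc_comm_class G = {G' \<in> osc_groups. abstractly_commensurable G G'}"

section \<open>Eigenvalues and real quadratic fields\<close>

definition real_eigenvalue :: "int ^ 2 ^ 2 \<Rightarrow> real \<Rightarrow> bool" where
  "real_eigenvalue B \<mu> \<longleftrightarrow> (\<exists>v. v \<noteq> 0 \<and> map_matrix real_of_int B *v v = \<mu> *s v)"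

definition Q_adjoin :: "real \<Rightarrow> real set" where
  "Q_adjoin \<mu> = generate_field ring_of_type_algebra (\<rat> \<union> {\<mu>})"

definition real_quadratic_fields :: "real set set" where
  "real_quadratic_fields =
     {K. subfield K ring_of_type_algebra \<and> ring.dimension ring_of_type_algebra 2 \<rat> K}"

definition is_osc_field_map :: "('a monoid set \<Rightarrow> real set) \<Rightarrow> bool" where
  "is_osc_field_map F \<longleftrightarrow>
     F \<in> osc_iso_classes \<rightarrow>\<^sub>E real_quadratic_fields \<and>
     (\<forall>r\<ge>1. \<forall>B\<in>hyperbolic_SL2Z. \<forall>l \<mu>. real_eigenvalue B \<mu> \<longrightarrow>
        F (osc_iso_class (Osc r B l)) = Q_adjoin \<mu>)"

section \<open>Existence and uniqueness of the automorphism\<close>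

text \<open>Every element of the Heisenberg group has the form \<open>\<alpha>\<^sup>m \<beta>\<^sup>n \<gamma>\<^sup>k\<close>, written
  \<open>E m n k\<close> below. This is only used to show that \<^const>\<open>osc_aut\<close> is well defined for
  \<open>det B = 1\<close>.\<close>

lemma word_class_eq_iff: "word_class R u = word_class R v \<longleftrightarrow> word_eq R u v"
  unfolding word_class_def set_eq_iff mem_Collect_eq
  by (meson word_eq.refl word_eq.sym word_eq.trans)

lemma presented_carrier: "word_class R u \<in> carrier (presented_group R)"
  by (simp add: presented_group_def)

lemma presented_one: "\<one>\<^bsub>presented_group R\<^esub> = word_class R []"
  by (simp add: presented_group_def)

lemma presented_mult:
  "word_class R u \<otimes>\<^bsub>presented_group R\<^esub> word_class R v = word_class R (u @ v)"
proof -
  have "(\<Union>u'\<in>word_class R u. \<Union>v'\<in>word_class R v. word_class R (u' @ v')) =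
    (\<Union>u'\<in>word_class R u. \<Union>v'\<in>word_class R v. word_class R (u @ v))"
    by (intro SUP_cong HOL.refl)
      (simp add: word_class_eq_iff, simp add: word_class_def word_eq.append word_eq.sym)
  moreover have "u \<in> word_class R u" "v \<in> word_class R v"
    by (simp_all add: word_class_def word_eq.refl)
  ultimately show ?thesis
    by (force simp: presented_group_def)
qed

lemma presented_cases:
  assumes "U \<in> carrier (presented_group R)"
  obtains u where "U = word_class R u"
  using assms by (auto simp: presented_group_def)

lemma word_eq_letters: "word_eq R ((x, b) # (x, \<not> b) # u) u"
  using word_eq.append[OF word_eq.cancel[of R x b] word_eq.refl[of R u]] by simp

lemma group_presented: "group (presented_group R)"
proof (rule groupI)
  fix U assume U: "U \<in> carrier (presented_group R)"
  then obtain u where u: "U = word_class R u" by (rule presented_cases)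
  have "word_eq R (map (\<lambda>(x, b). (x, \<not> b)) (rev u) @ u) []"
  proof (induction u)
    case Nil then show ?case by (simp add: word_eq.refl)
  next
    case (Cons a u)
    obtain x b where a: "a = (x, b)" by force
    let ?i = "\<lambda>u. map (\<lambda>(x, b). (x, \<not> b)) (rev u)"
    have "word_eq R (?i u @ ((x, \<not> b) # (x, b) # u)) (?i u @ u)"
      using word_eq_letters[of R x "\<not> b" u] by (auto intro: word_eq.append word_eq.refl)
    then have "word_eq R (?i u @ ((x, \<not> b) # (x, b) # u)) []"
      using Cons by (rule word_eq.trans)
    then show ?case by (simp add: a)
  qed
  then show "\<exists>V\<in>carrier (presented_group R). V \<otimes>\<^bsub>presented_group R\<^esub> U = \<one>\<^bsub>presented_group R\<^esub>"
    unfolding u by (metis presented_carrier presented_mult presented_one word_class_eq_iff)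
next
  fix U V W
  assume "U \<in> carrier (presented_group R)" "V \<in> carrier (presented_group R)"
    "W \<in> carrier (presented_group R)"
  then obtain u v w where "U = word_class R u" "V = word_class R v" "W = word_class R w"
    by (meson presented_cases)
  then show "U \<otimes>\<^bsub>presented_group R\<^esub> V \<otimes>\<^bsub>presented_group R\<^esub> W =
      U \<otimes>\<^bsub>presented_group R\<^esub> (V \<otimes>\<^bsub>presented_group R\<^esub> W)"
    by (simp add: presented_mult)
next
  fix U V assume "U \<in> carrier (presented_group R)" "V \<in> carrier (presented_group R)"
  then obtain u v where "U = word_class R u" "V = word_class R v"
    by (meson presented_cases)
  then show "U \<otimes>\<^bsub>presented_group R\<^esub> V \<in> carrier (presented_group R)"
    by (simp add: presented_mult presented_carrier)
next
  fix U assume "U \<in> carrier (presented_group R)"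
  then obtain u where "U = word_class R u" by (rule presented_cases)
  then show "\<one>\<^bsub>presented_group R\<^esub> \<otimes>\<^bsub>presented_group R\<^esub> U = U"
    by (simp add: presented_mult presented_one)
qed (simp add: presented_carrier presented_one)

definition (in group) word_eval :: "('g \<Rightarrow> 'a) \<Rightarrow> 'g word \<Rightarrow> 'a" where
  "word_eval g u = foldr (\<lambda>(x, b) z. (if b then g x else inv (g x)) \<otimes> z) u \<one>"

context group
begin

lemma word_eval_simps:
  "word_eval g [] = \<one>"
  "word_eval g ((x, b) # u) = (if b then g x else inv (g x)) \<otimes> word_eval g u"
  by (simp_all add: word_eval_def)

context
  fixes g :: "'g \<Rightarrow> 'a"
  assumes g: "\<And>x. g x \<in> carrier G"
begin

lemma word_eval_closed [simp]: "word_eval g u \<in> carrier G"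
  by (induction u) (auto simp: word_eval_simps g)

lemma word_eval_append: "word_eval g (u @ v) = word_eval g u \<otimes> word_eval g v"
  by (induction u) (auto simp: word_eval_simps g m_assoc)

lemma word_eval_cong:
  assumes R: "\<And>u v. (u, v) \<in> R \<Longrightarrow> word_eval g u = word_eval g v"
  assumes "word_eq R u v"
  shows "word_eval g u = word_eval g v"
  using assms(2)
proof (induction rule: word_eq.induct)
  case (cancel x b)
  show ?case by (cases b) (simp_all add: word_eval_simps g)
next
  case (append u u' v v')
  show ?case unfolding word_eval_append append.IH by (rule HOL.refl)
next
  case (relation u v)
  then show ?case by (rule R)
next
  case (sym u v)
  show ?case by (rule sym.IH[symmetric])
next
  case (trans u v w)
  show ?case using trans.IH by (rule HOL.trans)
qed (rule HOL.refl)

lemma presented_hom_ex: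
  assumes R: "\<And>u v. (u, v) \<in> R \<Longrightarrow> word_eval g u = word_eval g v"
  obtains f where "f \<in> hom (presented_group R) G" "f \<in> extensional (carrier (presented_group R))"
    "\<And>x. f (word_class R [(x, True)]) = g x"
proof
  let ?f = "restrict (\<lambda>U. word_eval g (SOME u. u \<in> U)) (carrier (presented_group R))"
  have f: "?f (word_class R u) = word_eval g u" for u
  proof -
    have "(SOME v. v \<in> word_class R u) \<in> word_class R u"
      by (rule someI[of _ u]) (simp add: word_class_def word_eq.refl)
    then have "word_eq R u (SOME v. v \<in> word_class R u)"
      by (simp add: word_class_def)
    then have "word_eval g u = word_eval g (SOME v. v \<in> word_class R u)"
      by (rule word_eval_cong[rotated]) (rule R)
    then show ?thesis by (simp add: presented_carrier)
  qed
  show "?f \<in> hom (presented_group R) G"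
  proof (rule homI)
    fix U V assume "U \<in> carrier (presented_group R)" "V \<in> carrier (presented_group R)"
    then obtain u v where uv: "U = word_class R u" "V = word_class R v"
      by (meson presented_cases)
    show "?f (U \<otimes>\<^bsub>presented_group R\<^esub> V) = ?f U \<otimes> ?f V"
      unfolding uv presented_mult f by (rule word_eval_append)
  next
    fix U assume "U \<in> carrier (presented_group R)"
    then obtain u where u: "U = word_class R u" by (meson presented_cases)
    show "?f U \<in> carrier G" unfolding u f by simp
  qed
  show "?f (word_class R [(x, True)]) = g x" for x
    unfolding f by (simp add: word_eval_simps g)
  show "?f \<in> extensional (carrier (presented_group R))" by simp
qed

end
end

lemma presented_gen_induct:
  assumes "U \<in> carrier (presented_group R)"
  assumes "subgroup S (presented_group R)" "\<And>x. word_class R [(x, True)] \<in> S"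
  shows "U \<in> S"
proof -
  interpret group "presented_group R" by (rule group_presented)
  interpret S: subgroup S "presented_group R" by fact
  obtain u where u: "U = word_class R u" using assms(1) by (rule presented_cases)
  have inv: "word_class R [(x, False)] = inv\<^bsub>presented_group R\<^esub> word_class R [(x, True)]" for x
    by (rule inv_equality[symmetric])
      (auto simp: presented_mult presented_one presented_carrier word_class_eq_iff
        intro: word_eq.cancel[of R x False, simplified])
  have L: "word_class R [(x, b)] \<in> S" for x b
    using assms(3)[of x] S.m_inv_closed[OF assms(3)[of x]] by (cases b) (auto simp: inv)
  show ?thesis unfolding u
  proof (induction u)
    case Nil show ?case using S.one_closed by (simp add: presented_one)
  next
    case (Cons a u)
    then have "word_class R [a] \<otimes>\<^bsub>presented_group R\<^esub> word_class R u \<in> S"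
      using L by (cases a) (auto intro: S.m_closed)
    then show ?case by (simp add: presented_mult)
  qed
qed

lemma presented_hom_unique:
  assumes "group G" "f \<in> hom (presented_group R) G" "h \<in> hom (presented_group R) G"
    and eq: "\<And>x. f (word_class R [(x, True)]) = h (word_class R [(x, True)])"
    and U: "U \<in> carrier (presented_group R)"
  shows "f U = h U"
proof -
  interpret group "presented_group R" by (rule group_presented)
  interpret f: group_hom "presented_group R" G f
    by (simp add: group_hom_def group_hom_axioms_def assms is_group)
  interpret h: group_hom "presented_group R" G h
    by (simp add: group_hom_def group_hom_axioms_def assms is_group)
  have "subgroup {U \<in> carrier (presented_group R). f U = h U} (presented_group R)"
    by (rule subgroupI) (auto intro!: one_closed)
  from presented_gen_induct[OF U this] eq presented_carrier show ?thesis by blast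
qed

context group
begin

lemma commutator_int_pow:
  assumes "x \<in> carrier G" "y \<in> carrier G" "z \<in> carrier G"
    and "z \<otimes> x = x \<otimes> z" and xy: "x \<otimes> y = z \<otimes> (y \<otimes> x)"
  shows "x [^] (m::int) \<otimes> y = z [^] m \<otimes> (y \<otimes> x [^] m)"
proof -
  note [simp] = assms(1-3)
  have [simp]: "inv y \<otimes> (y \<otimes> w) = w" if "w \<in> carrier G" for w
    using that by (simp flip: m_assoc)
  have hom: "(\<lambda>x. y \<otimes> x \<otimes> inv y) \<in> hom G G"
    by (rule homI) (simp_all add: m_assoc)
  interpret f: group_hom G G "\<lambda>x. y \<otimes> x \<otimes> inv y"
    by (simp add: group_hom_def group_hom_axioms_def hom is_group)
  have "x = z \<otimes> (y \<otimes> x \<otimes> inv y)"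
    by (metis assms(1-3) inv_solve_right m_assoc m_closed inv_closed xy)
  then have e: "y \<otimes> x \<otimes> inv y = inv z \<otimes> x"
    by (metis assms(1-3) inv_solve_left m_closed inv_closed)
  have c: "inv z \<otimes> x = x \<otimes> inv z"
    by (metis assms(1-4) inv_solve_left inv_solve_right m_assoc m_closed inv_closed)
  have "y \<otimes> x [^] m \<otimes> inv y = (inv z \<otimes> x) [^] m"
    using f.hom_int_pow[of x m] e by simp
  also have "\<dots> = inv z [^] m \<otimes> x [^] m"
    by (rule int_pow_mult_distrib[OF c]) auto
  also have "\<dots> = inv (z [^] m) \<otimes> x [^] m"
    by (simp add: int_pow_inv)
  finally have "x [^] m = z [^] m \<otimes> (y \<otimes> x [^] m \<otimes> inv y)"
    by (metis assms(1-3) inv_solve_left int_pow_closed m_closed inv_closed)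
  then show ?thesis
    by (metis assms(1-3) inv_solve_right int_pow_closed m_assoc m_closed inv_closed)
qed

end

locale heis_triple = group +
  fixes a b c :: 'a and r :: int
  assumes closed [simp]: "a \<in> carrier G" "b \<in> carrier G" "c \<in> carrier G"
    and ac: "a \<otimes> c = c \<otimes> a" and bc: "b \<otimes> c = c \<otimes> b"
    and ab: "a \<otimes> b = c [^] r \<otimes> (b \<otimes> a)"
begin

definition E :: "int \<Rightarrow> int \<Rightarrow> int \<Rightarrow> 'a" where
  "E m n k = a [^] m \<otimes> b [^] n \<otimes> c [^] k"

lemma E_closed [simp]: "E m n k \<in> carrier G" by (simp add: E_def)

lemma pow_commute:
  assumes "x \<in> carrier G" "y \<in> carrier G" "x \<otimes> y = y \<otimes> x"
  shows "x [^] (m::int) \<otimes> y [^] (n::int) = y [^] n \<otimes> x [^] m"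
proof -
  have 1: "u [^] (m::int) \<otimes> v = v \<otimes> u [^] m" if "u \<in> carrier G" "v \<in> carrier G" "u \<otimes> v = v \<otimes> u" for u v m
    using commutator_int_pow[of u v \<one> m] that by simp
  show ?thesis using 1[of x y m] 1[of y "x [^] m" n] assms by simp
qed

lemma ba_pow: "b [^] (n::int) \<otimes> a [^] (m::int) = a [^] m \<otimes> b [^] n \<otimes> c [^] (- r * m * n)"
proof -
  have "a [^] m \<otimes> b = c [^] (r * m) \<otimes> (b \<otimes> a [^] m)"
    using commutator_int_pow[of a b "c [^] r" m] pow_commute[of c a r 1] ab ac
    by (simp add: int_pow_pow)
  then have "b \<otimes> a [^] m = c [^] (- (r * m)) \<otimes> (a [^] m \<otimes> b)"
    by (metis closed int_pow_closed int_pow_neg inv_solve_left m_closed)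
  then have ba: "b [^] n \<otimes> a [^] m = c [^] (- (r * m) * n) \<otimes> (a [^] m \<otimes> b [^] n)"
    using commutator_int_pow[of b "a [^] m" "c [^] (- (r * m))" n] pow_commute[of c b _ 1] bc
    by (simp add: int_pow_pow)
  have "c [^] e \<otimes> (a [^] m \<otimes> b [^] n) = a [^] m \<otimes> b [^] n \<otimes> c [^] e" for e :: int
  proof -
    have c: "c [^] e \<otimes> a [^] m = a [^] m \<otimes> c [^] e" "c [^] e \<otimes> b [^] n = b [^] n \<otimes> c [^] e"
      using pow_commute ac bc by simp_all
    have "c [^] e \<otimes> (a [^] m \<otimes> b [^] n) = a [^] m \<otimes> (c [^] e \<otimes> b [^] n)"
      by (simp add: c(1) flip: m_assoc)
    also have "\<dots> = a [^] m \<otimes> b [^] n \<otimes> c [^] e"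
      by (simp add: c(2) m_assoc)
    finally show ?thesis .
  qed
  then show ?thesis unfolding ba by simp
qed

lemma E_mult: "E m n k \<otimes> E m' n' k' = E (m + m') (n + n') (k + k' - r * m' * n)"
proof -
  have ca: "c [^] k \<otimes> a [^] m = a [^] m \<otimes> c [^] k" and cb: "c [^] k \<otimes> b [^] m = b [^] m \<otimes> c [^] k"
    for k m :: int using pow_commute ac bc by simp_all
  have cb2: "c [^] k \<otimes> (b [^] m \<otimes> x) = b [^] m \<otimes> (c [^] k \<otimes> x)"
    if "x \<in> carrier G" for k m :: int and x
    using that cb[of k m] by (simp flip: m_assoc)
  have "E m n k \<otimes> E m' n' k' = a [^] m \<otimes> b [^] n \<otimes> (c [^] k \<otimes> a [^] m') \<otimes> b [^] n' \<otimes> c [^] k'"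
    by (simp add: E_def m_assoc)
  also have "\<dots> = a [^] m \<otimes> (b [^] n \<otimes> a [^] m') \<otimes> (c [^] k \<otimes> b [^] n') \<otimes> c [^] k'"
    by (simp add: ca m_assoc)
  also have "\<dots> = a [^] m \<otimes> a [^] m' \<otimes> b [^] n \<otimes> (c [^] (- r * m' * n) \<otimes> b [^] n') \<otimes> c [^] k \<otimes> c [^] k'"
    by (simp add: cb cb2 ba_pow m_assoc)
  also have "\<dots> = (a [^] m \<otimes> a [^] m') \<otimes> (b [^] n \<otimes> b [^] n') \<otimes> (c [^] (- r * m' * n) \<otimes> c [^] k \<otimes> c [^] k')"
    by (simp add: cb2 m_assoc)
  also have "\<dots> = E (m + m') (n + n') (k + k' - r * m' * n)"
    by (simp add: E_def flip: int_pow_mult) (simp add: algebra_simps)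
  finally show ?thesis .
qed

lemma E_gens: "E 1 0 0 = a" "E 0 1 0 = b" "E 0 0 1 = c" "E 0 0 0 = \<one>" "E 0 0 k = c [^] k"
  by (simp_all add: E_def)

lemma E_inv: "inv (E m n k) = E (-m) (-n) (- k - r * m * n)"
proof (rule inv_equality)
  show "E (-m) (-n) (- k - r * m * n) \<otimes> E m n k = \<one>"
  proof -
    have "E (-m) (-n) (- k - r * m * n) \<otimes> E m n k = E 0 0 0"
      by (simp add: E_mult)
    then show ?thesis by (simp only: E_gens(4))
  qed
qed simp_all

lemma E_pow: "\<exists>k'. E m n k [^] (p::int) = E (p * m) (p * n) k'"
proof -
  have nat: "\<exists>k'. E m n k [^] (q::nat) = E (int q * m) (int q * n) k'" for q
  proof (induction q)
    case 0 show ?case by (rule exI[of _ 0]) (simp add: E_gens)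
  next
    case (Suc q)
    then obtain k' where "E m n k [^] (q::nat) = E (int q * m) (int q * n) k'" by blast
    then have "E m n k [^] Suc q = E (int q * m + m) (int q * n + n) (k' + k - r * m * (int q * n))"
      by (simp add: E_mult)
    then show ?case by (auto simp: algebra_simps)
  qed
  show ?thesis
  proof (cases "p \<ge> 0")
    case True
    then show ?thesis using nat[of "nat p"] by (simp flip: int_pow_int)
  next
    case False
    then have p: "p = - int (nat (- p))" by arith
    then obtain q where p: "p = - int q" by (rule that)
    obtain k' where "E m n k [^] q = E (int q * m) (int q * n) k'" using nat by blast
    then have "E m n k [^] p = E (- (int q * m)) (- (int q * n)) (- k' - r * (int q * m) * (int q * n))"
      unfolding p by (simp add: int_pow_neg int_pow_int E_inv)
    then show ?thesis by (auto simp: p)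
  qed
qed

end

lemma presented_replicate:
  "word_class R (replicate n (x, True)) = word_class R [(x, True)] [^]\<^bsub>presented_group R\<^esub> n"
proof (induction n)
  case 0 show ?case by (simp add: nat_pow_def presented_one)
next
  case (Suc n)
  have "replicate (Suc n) (x, True) = replicate n (x, True) @ [(x, True)]"
    by (simp add: replicate_append_same)
  then show ?case
    by (simp only: presented_mult[symmetric] Suc) (simp add: nat_pow_def)
qed

lemma presented_inv:
  "word_class R [(x, False)] = inv\<^bsub>presented_group R\<^esub> word_class R [(x, True)]"
proof -
  interpret group "presented_group R" by (rule group_presented)
  show ?thesis
    by (rule inv_equality[symmetric])
      (auto simp: presented_mult presented_one presented_carrier word_class_eq_iff
        intro: word_eq.cancel[of R x False, simplified])
qed

lemma heis_triple_heisenberg: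
  "heis_triple (heisenberg_group r) (heis_elem r Gen_alpha) (heis_elem r Gen_beta) (heis_elem r Gen_gamma) (int r)"
proof -
  let ?R = "heis_relations r" and ?H = "heisenberg_group r"
  interpret group ?H unfolding heisenberg_group_def by (rule group_presented)
  have cl [simp]: "heis_elem r x \<in> carrier ?H" for x
    by (simp add: heis_elem_def heisenberg_group_def presented_carrier)
  have rel: "word_class ?R u = word_class ?R v" if "(u, v) \<in> ?R" for u v
    using that by (simp add: word_class_eq_iff word_eq.relation)
  let ?a = "heis_elem r Gen_alpha" and ?b = "heis_elem r Gen_beta" and ?c = "heis_elem r Gen_gamma"
  have "word_class ?R [(Gen_alpha, True)] \<otimes>\<^bsub>?H\<^esub> (word_class ?R [(Gen_beta, True)] \<otimes>\<^bsub>?H\<^esub>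
      (word_class ?R [(Gen_alpha, False)] \<otimes>\<^bsub>?H\<^esub> word_class ?R [(Gen_beta, False)]))
    = word_class ?R (replicate r (Gen_gamma, True))"
    unfolding heisenberg_group_def presented_mult
    by (rule rel) (simp add: heis_relations_def)
  then have "?a \<otimes>\<^bsub>?H\<^esub> (?b \<otimes>\<^bsub>?H\<^esub> (inv\<^bsub>?H\<^esub> ?a \<otimes>\<^bsub>?H\<^esub> inv\<^bsub>?H\<^esub> ?b)) = ?c [^]\<^bsub>?H\<^esub> r"
    unfolding presented_inv presented_replicate heis_elem_def heisenberg_group_def .
  moreover have "(?a \<otimes>\<^bsub>?H\<^esub> (?b \<otimes>\<^bsub>?H\<^esub> (inv\<^bsub>?H\<^esub> ?a \<otimes>\<^bsub>?H\<^esub> inv\<^bsub>?H\<^esub> ?b))) \<otimes>\<^bsub>?H\<^esub> (?b \<otimes>\<^bsub>?H\<^esub> ?a) = ?a \<otimes>\<^bsub>?H\<^esub> ?b"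
  proof -
    have [simp]: "inv\<^bsub>?H\<^esub> heis_elem r x \<otimes>\<^bsub>?H\<^esub> (heis_elem r x \<otimes>\<^bsub>?H\<^esub> w) = w" if "w \<in> carrier ?H" for x w
      using that by (simp flip: m_assoc)
    show ?thesis by (simp add: m_assoc)
  qed
  ultimately have "?a \<otimes>\<^bsub>?H\<^esub> ?b = ?c [^]\<^bsub>?H\<^esub> int r \<otimes>\<^bsub>?H\<^esub> (?b \<otimes>\<^bsub>?H\<^esub> ?a)"
    by (simp add: int_pow_int)
  moreover have "?a \<otimes>\<^bsub>?H\<^esub> ?c = ?c \<otimes>\<^bsub>?H\<^esub> ?a" "?b \<otimes>\<^bsub>?H\<^esub> ?c = ?c \<otimes>\<^bsub>?H\<^esub> ?b"
    unfolding heis_elem_def heisenberg_group_def presented_mult append.simps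
    by (rule rel, simp add: heis_relations_def)+
  ultimately show ?thesis
    by unfold_locales auto
qed

context
  fixes r :: nat
begin

interpretation H: heis_triple "heisenberg_group r"
  "heis_elem r Gen_alpha" "heis_elem r Gen_beta" "heis_elem r Gen_gamma" "int r"
  by (rule heis_triple_heisenberg)

private abbreviation (input) "HH \<equiv> heisenberg_group r"
private abbreviation (input) "ga \<equiv> heis_elem r Gen_alpha"
private abbreviation (input) "gb \<equiv> heis_elem r Gen_beta"
private abbreviation (input) "gc \<equiv> heis_elem r Gen_gamma"

lemma heis_hom_eq:
  assumes "f \<in> hom HH HH" "h \<in> hom HH HH" "f ga = h ga" "f gb = h gb" "f gc = h gc" "x \<in> carrier HH"
  shows "f x = h x"
proof (rule presented_hom_unique[of HH f "heis_relations r" h, folded heisenberg_group_def heis_elem_def])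
  show "f (heis_elem r y) = h (heis_elem r y)" for y
    using assms by (cases y) auto
qed (use assms H.is_group in auto)

lemma heis_hom_E:
  assumes f: "f \<in> hom HH HH" and fc: "f gc = gc"
  shows "f (H.E m n k) = f ga [^]\<^bsub>HH\<^esub> m \<otimes>\<^bsub>HH\<^esub> f gb [^]\<^bsub>HH\<^esub> n \<otimes>\<^bsub>HH\<^esub> gc [^]\<^bsub>HH\<^esub> k"
proof -
  interpret f: group_hom HH HH f
    by (simp add: group_hom_def group_hom_axioms_def f H.is_group)
  show ?thesis unfolding H.E_def by (simp add: f.hom_int_pow fc)
qed

lemma heis_hom_ex:
  assumes "m * n' - m' * n = 1"
  obtains f where "f \<in> hom HH HH" "f \<in> extensional (carrier HH)"
    "f ga = H.E m n k" "f gb = H.E m' n' k'" "f gc = gc"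
    "\<And>p q s. \<exists>s'. f (H.E p q s) = H.E (p * m + q * m') (p * n + q * n') s'"
proof -
  define g where "g = (\<lambda>x. case x of Gen_alpha \<Rightarrow> H.E m n k | Gen_beta \<Rightarrow> H.E m' n' k' | Gen_gamma \<Rightarrow> H.E 0 0 1)"
  have gcl: "g x \<in> carrier HH" for x by (cases x) (simp_all add: g_def)
  have rep: "H.word_eval g (replicate q (Gen_gamma, True)) = H.E 0 0 (int q)" for q
    by (induction q) (simp_all add: H.word_eval_simps g_def H.E_mult H.E_gens(4))
  have one: "x \<otimes>\<^bsub>HH\<^esub> \<one>\<^bsub>HH\<^esub> = x \<otimes>\<^bsub>HH\<^esub> H.E 0 0 0" for x by (simp only: H.E_gens(4))
  have rel: "H.word_eval g u = H.word_eval g v" if "(u, v) \<in> heis_relations r" for u v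
  proof -
    have "H.word_eval g [(Gen_alpha, True), (Gen_beta, True), (Gen_alpha, False), (Gen_beta, False)] =
      H.E 0 0 (int r * (m * n' - m' * n))"
      by (simp add: H.word_eval_simps g_def H.E_inv one H.E_mult del: H.r_one)
        (simp add: algebra_simps)
    then have comm: "H.word_eval g [(Gen_alpha, True), (Gen_beta, True), (Gen_alpha, False), (Gen_beta, False)] =
      H.word_eval g (replicate r (Gen_gamma, True))"
      unfolding rep assms by simp
    have central: "H.word_eval g [(x, True), (Gen_gamma, True)] = H.word_eval g [(Gen_gamma, True), (x, True)]" for x
      by (cases x) (simp_all add: H.word_eval_simps g_def one H.E_mult add.commute del: H.r_one)
    show ?thesis
      using that unfolding heis_relations_def insert_iff empty_iff prod.inject
      using comm central by (elim disjE conjE FalseE) (simp_all only:)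
  qed
  obtain f where f: "f \<in> hom HH HH" "f \<in> extensional (carrier HH)" "\<And>x. f (heis_elem r x) = g x"
    by (rule H.presented_hom_ex[where R = "heis_relations r" and g = g,
          folded heisenberg_group_def heis_elem_def]) (rule gcl | erule rel | blast)+
  have f': "f ga = H.E m n k" "f gb = H.E m' n' k'" "f gc = gc"
    using f(3) by (simp_all add: g_def H.E_gens)
  show thesis
  proof (rule that[OF f(1,2) f'])
    fix p q s
    obtain s1 where "H.E m n k [^]\<^bsub>HH\<^esub> p = H.E (p * m) (p * n) s1"
      using H.E_pow[of m n k p] by (rule exE)
    moreover obtain s2 where "H.E m' n' k' [^]\<^bsub>HH\<^esub> q = H.E (q * m') (q * n') s2"
      using H.E_pow[of m' n' k' q] by (rule exE)
    ultimately show "\<exists>s'. f (H.E p q s) = H.E (p * m + q * m') (p * n + q * n') s'"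
      using heis_hom_E[OF f(1) f'(3), of p q s]
      by (simp add: f' H.E_mult flip: H.E_gens(5)) blast
  qed
qed

lemma heis_near_id:
  assumes e: "e \<in> hom HH HH" "e ga = H.E 1 0 s" "e gb = H.E 0 1 t" "e gc = gc"
  obtains h where "\<And>x. x \<in> carrier HH \<Longrightarrow> h x \<in> carrier HH"
    "\<And>x. x \<in> carrier HH \<Longrightarrow> h (e x) = x" "\<And>x. x \<in> carrier HH \<Longrightarrow> e (h x) = x"
proof -
  obtain h where h: "h \<in> hom HH HH" "h ga = H.E 1 0 (-s)" "h gb = H.E 0 1 (-t)" "h gc = gc"
    by (rule heis_hom_ex[of 1 1 0 0 "-s" "-t"]) auto
  have gen: "u (v ga) = ga \<and> u (v gb) = gb \<and> u (v gc) = gc"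
    if "u \<in> hom HH HH" "u ga = H.E 1 0 s" "u gb = H.E 0 1 t" "u gc = gc"
       "v ga = H.E 1 0 (-s)" "v gb = H.E 0 1 (-t)" "v gc = gc" for u v s t
    using that heis_hom_E[OF that(1,4)]
    by (simp add: H.E_mult flip: H.E_gens(5)) (simp add: H.E_gens)
  have id: "u (v x) = x"
    if "u \<in> hom HH HH" "v \<in> hom HH HH" "u (v ga) = ga \<and> u (v gb) = gb \<and> u (v gc) = gc" "x \<in> carrier HH" for u v x
    using heis_hom_eq[of "u \<circ> v" "\<lambda>x. x" x] that hom_compose[OF that(2,1)]
    by (auto simp: hom_def)
  show thesis
  proof (rule that[of h])
    show "h x \<in> carrier HH" if "x \<in> carrier HH" for x using h(1) that by (auto simp: hom_def)
    show "e (h x) = x" if "x \<in> carrier HH" for x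
      by (rule id[OF e(1) h(1) gen[OF e h(2-4)] that])
    show "h (e x) = x" if "x \<in> carrier HH" for x
      by (rule id[OF h(1) e(1) gen[OF h] that]) (simp_all add: e)
  qed
qed

lemma ex1_osc_aut:
  assumes "det B = 1"
  shows "\<exists>!f. is_osc_aut r B l f"
proof (rule ex_ex1I)
  have det: "B$1$1 * B$2$2 - B$1$2 * B$2$1 = 1"
    using assms by (simp add: det_2)
  obtain f where f: "f \<in> hom HH HH" "f \<in> extensional (carrier HH)"
    "f ga = H.E (B$1$1) (B$2$1) (- (l$2))" "f gb = H.E (B$1$2) (B$2$2) (l$1)" "f gc = gc"
    "\<And>p q s. \<exists>s'. f (H.E p q s) = H.E (p * B$1$1 + q * B$1$2) (p * B$2$1 + q * B$2$2) s'"
    using heis_hom_ex[OF det, of "- (l$2)" "l$1"] by metis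
  have "B$2$2 * B$1$1 - (- B$1$2) * (- B$2$1) = 1"
    using det by (simp add: algebra_simps)
  then obtain g where g: "g \<in> hom HH HH"
    "g ga = H.E (B$2$2) (- B$2$1) 0" "g gb = H.E (- B$1$2) (B$1$1) 0" "g gc = gc"
    "\<And>p q s. \<exists>s'. g (H.E p q s) = H.E (p * B$2$2 + q * (- B$1$2)) (p * (- B$2$1) + q * B$1$1) s'"
    using heis_hom_ex[of "B$2$2" "B$1$1" "- B$1$2" "- B$2$1" 0 0] by metis
  have fg: "\<exists>s. f (g ga) = H.E 1 0 s" "\<exists>s. f (g gb) = H.E 0 1 s"
    using f(6)[of "B$2$2" "- B$2$1" 0] f(6)[of "- B$1$2" "B$1$1" 0] det
    by (simp_all add: g(2,3) algebra_simps)
  have gf: "\<exists>s. g (f ga) = H.E 1 0 s" "\<exists>s. g (f gb) = H.E 0 1 s"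
    using g(5)[of "B$1$1" "B$2$1" "- (l$2)"] g(5)[of "B$1$2" "B$2$2" "l$1"] det
    by (simp_all add: f(3,4) algebra_simps)
  have hom: "f \<circ> g \<in> hom HH HH" "g \<circ> f \<in> hom HH HH"
    using hom_compose f(1) g(1) by blast+
  have c: "(f \<circ> g) gc = gc" "(g \<circ> f) gc = gc" by (simp_all add: f g)
  obtain s t where fg': "(f \<circ> g) ga = H.E 1 0 s" "(f \<circ> g) gb = H.E 0 1 t"
    using fg by (auto simp only: o_apply)
  obtain s' t' where gf': "(g \<circ> f) ga = H.E 1 0 s'" "(g \<circ> f) gb = H.E 0 1 t'"
    using gf by (auto simp only: o_apply)
  obtain h1 where h1: "\<And>x. x \<in> carrier HH \<Longrightarrow> h1 x \<in> carrier HH"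
    "\<And>x. x \<in> carrier HH \<Longrightarrow> f (g (h1 x)) = x"
    by (rule heis_near_id[OF hom(1) fg' c(1), unfolded o_apply]) blast
  obtain h2 where h2: "\<And>x. x \<in> carrier HH \<Longrightarrow> h2 (g (f x)) = x"
    by (rule heis_near_id[OF hom(2) gf' c(2), unfolded o_apply]) blast
  have "bij_betw f (carrier HH) (carrier HH)"
    unfolding bij_betw_def
  proof
    show "inj_on f (carrier HH)" by (rule inj_onI) (metis h2)
    have cl: "g x \<in> carrier HH" "f x \<in> carrier HH" if "x \<in> carrier HH" for x
      using f(1) g(1) that by (auto simp: hom_def)
    show "f ` carrier HH = carrier HH"
    proof (intro equalityI subsetI)
      fix y assume "y \<in> carrier HH"
      then show "y \<in> f ` carrier HH"
        by (intro image_eqI[of _ _ "g (h1 y)"] cl(1) h1(1)) (simp_all add: h1(2))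
    qed (auto intro: cl(2))
  qed
  then have "f \<in> auto HH" using f(1,2) by (simp add: auto_def Bij_def)
  then show "\<exists>f. is_osc_aut r B l f"
    using f(3-5) unfolding is_osc_aut_def Let_def H.E_def by blast
next
  fix f h assume "is_osc_aut r B l f" "is_osc_aut r B l h"
  then have "f \<in> auto HH" "h \<in> auto HH" and eq: "f ga = h ga" "f gb = h gb" "f gc = h gc"
    by (simp_all add: is_osc_aut_def Let_def)
  then have fh: "f \<in> hom HH HH" "f \<in> extensional (carrier HH)" "h \<in> hom HH HH" "h \<in> extensional (carrier HH)"
    by (simp_all add: auto_def Bij_def)
  show "f = h"
    by (rule extensionalityI[OF fh(2,4)]) (rule heis_hom_eq[OF fh(1,3) eq])
qed

end

end

theory Submission
  imports Defs
begin

text \<open>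
  The eigenvalues of a hyperbolic matrix \<open>B\<close> of trace \<open>t\<close> are the roots of \<open>x\<^sup>2 - t x + 1\<close>, so the
  field of \<open>Osc\<^sup>r(B, l)\<close> is \<open>\<rat> + \<rat> \<surd>(t\<^sup>2 - 4)\<close>, called \<open>trace_field t\<close> below. What has to be shown is
  that this field does not change under commensurability, that it determines the commensurability
  class, and that every real quadratic field occurs.

  All groups are compared with one integral model. Let \<open>heis_model\<close> be \<open>\<int>\<^sup>2 \<times> \<int>\<close> with
  \<open>(v, z) (w, y) = (v + w, z + y + det (v, w))\<close>. A matrix \<open>B\<close> of determinant \<open>1\<close> acts on it by
  \<open>(v, z) \<mapsto> (B v, z)\<close>; let \<open>osc_model B\<close> be the resulting semidirect product with \<open>\<int>\<close>. Over the rationals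
  the parameters \<open>r\<close> and \<open>l\<close> can be removed: \<open>r\<close> by rescaling the centre, and \<open>l\<close> by an inner
  automorphism, because \<open>B - 1\<close> is invertible. Clearing denominators gives an embedding of
  \<open>Osc\<^sup>r(B, l)\<close> into \<open>osc_model B\<close> whose image contains a dilated copy of the whole model
  (\<open>Osc_embedding\<close>). Hence \<open>osc_model B\<close> is also isomorphic to a subgroup of finite index in
  \<open>Osc\<^sup>r(B, l)\<close>.

  Equal fields imply commensurability. If the fields of \<open>B\<close> and \<open>B'\<close> agree, then the eigenvalues
  \<open>\<lambda>, \<lambda>' > 1\<close> are units of norm one in orders of one real quadratic field. These form a discrete group of rank one, so
  \<open>\<lambda>\<^sup>n = \<lambda>'\<^sup>m\<close> for some positive \<open>n\<close> and \<open>m\<close>; the proof is a pigeonhole argument on traces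
  (\<open>quadratic_units_common_power\<close>). Then \<open>B\<^sup>n\<close> and \<open>B'\<^sup>m\<close> have the same trace, hence both are
  rationally conjugate to the same companion matrix \<open>C\<close>, and \<open>osc_model C\<close> embeds with finite index
  into both models (\<open>common_virtual_model\<close>).

  Commensurability implies equal fields. If \<open>d\<close> acts on the Heisenberg part by
  \<open>M = B\<^sup>m\<close> and \<open>a\<close> lies in this part, then the theorem of Cayley and Hamilton makes \<open>(d\<^sup>2 a d\<^sup>-\<^sup>2) (d a d\<^sup>-\<^sup>1)\<^sup>-\<^sup>t a\<close> central for \<open>t = tr M\<close>. The set \<open>twist_traces\<close> of all integers \<open>t > 2\<close>
  for which a noncentral \<open>a\<close> and some \<open>d\<close> make this element central is visibly an isomorphism
  invariant of a group. For a subgroup of finite index in \<open>Osc\<^sup>r(B, l)\<close> it is nonempty and consists of traces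
  of powers \<open>B\<^sup>m\<close> with \<open>m \<noteq> 0\<close> (\<open>twist_traces_model\<close>), and all these have the field of \<open>B\<close>
  (\<open>trace_field_pow\<close>).

  Every real quadratic field has the form \<open>\<rat> + \<rat> \<surd>D\<close>, and a solution of the Pell equation
  \<open>x\<^sup>2 - D y\<^sup>2 = 1\<close> shows that it is \<open>trace_field (2 x)\<close>.

  To pass from abstract discrete split oscillator groups to the groups \<open>Osc\<^sup>r(B, l)\<close>, lift a basis of \<open>H / Z(H)\<close>
  to \<open>H\<close>. The lifts and a generator of the centre satisfy the Heisenberg relations again, up to
  inverting the central generator (\<open>adapted_coords\<close>). Conversely, \<open>Osc\<^sup>r(B, l)\<close> is countable and hence has a
  copy on every infinite type (\<open>Osc_copy\<close>).
\<close>

no_notation fps_nth (infixl \<open>$\<close> 75)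

section \<open>Real quadratic fields\<close>

lemma sqrt_int_irrational:
  fixes D :: int
  assumes "D \<ge> 0" "\<nexists>k. D = k^2"
  shows "sqrt (real_of_int D) \<notin> \<rat>"
proof
  assume "sqrt (real_of_int D) \<in> \<rat>"
  then obtain p q :: int where q: "q > 0" "coprime p q" and "sqrt (real_of_int D) = p / q"
    by (rule Rats_cases')
  then have "sqrt (real_of_int D) * q = p" by simp
  then have "(sqrt (real_of_int D) * q)^2 = (real_of_int p)^2" by simp
  then have "real_of_int (D * q^2) = real_of_int (p^2)"
    using assms(1) by (simp add: power_mult_distrib)
  then have eq: "D * q^2 = p^2" by linarith
  have "coprime (p^2) (q^2)" using q(2) by simp
  moreover have "q^2 dvd p^2" by (metis eq dvd_triv_right)
  ultimately have "is_unit (q^2)"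
    by (meson coprime_common_divisor dvd_refl)
  then have "q = 1" using q(1) by (simp add: abs_square_eq_1)
  then show False using eq assms(2) by auto
qed

lemma norm_one_trace_not_square:
  fixes t :: int
  assumes "t > 2"
  shows "\<nexists>k. t^2 - 4 = k^2"
proof
  assume "\<exists>k. t^2 - 4 = k^2"
  then obtain k0 where "t^2 - 4 = k0^2" by blast
  then obtain k where k: "t^2 - 4 = k^2" "k \<ge> 0"
    by (metis abs_ge_zero power2_abs)
  have "k < t" by (rule power_less_imp_less_base[of _ 2]) (use k assms in auto)
  then have "k^2 \<le> (t-1)^2" using k(2) by (intro power_mono) auto
  then show False using k assms by (simp add: power2_eq_square algebra_simps)
qed

text \<open>For an irrational \<open>w\<close> whose square is rational this is the field \<open>\<rat>(w)\<close>.\<close>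

definition rat_span :: "real \<Rightarrow> real set" where
  "rat_span w = {p + q * w | p q. p \<in> \<rat> \<and> q \<in> \<rat>}"

lemma rat_spanI: "p \<in> \<rat> \<Longrightarrow> q \<in> \<rat> \<Longrightarrow> p + q * w \<in> rat_span w"
  by (auto simp: rat_span_def)

lemma rat_span_affine:
  assumes "p \<in> \<rat>" "q \<in> \<rat>" "q \<noteq> 0"
  shows "rat_span (p + q * w) = rat_span w"
proof (intro equalityI subsetI)
  fix x assume "x \<in> rat_span (p + q * w)"
  then obtain a b where ab: "a \<in> \<rat>" "b \<in> \<rat>" "x = a + b * (p + q * w)" by (auto simp: rat_span_def)
  then have "x = (a + b * p) + (b * q) * w" by (simp add: algebra_simps)
  then show "x \<in> rat_span w" using ab assms by (metis Rats_add Rats_mult rat_spanI)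
next
  fix x assume "x \<in> rat_span w"
  then obtain a b where ab: "a \<in> \<rat>" "b \<in> \<rat>" "x = a + b * w" by (auto simp: rat_span_def)
  then have "x = (a - b * p / q) + (b / q) * (p + q * w)" using assms by (simp add: field_simps)
  moreover have "a - b * p / q \<in> \<rat>" "b / q \<in> \<rat>" using ab assms by auto
  ultimately show "x \<in> rat_span (p + q * w)" by (metis rat_spanI)
qed

lemma rat_span_eq_0_iff:
  assumes "w \<notin> \<rat>" "p \<in> \<rat>" "q \<in> \<rat>"
  shows "p + q * w = 0 \<longleftrightarrow> p = 0 \<and> q = 0"
proof
  assume *: "p + q * w = 0"
  have "q = 0"
  proof (rule ccontr)
    assume "q \<noteq> 0"
    moreover have "q * w = - p" using * by (simp add: add_eq_0_iff)
    ultimately have "w = - p / q" by (metis nonzero_mult_div_cancel_left)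
    then show False using assms by auto
  qed
  then show "p = 0 \<and> q = 0" using * by simp
qed auto

abbreviation real_field :: "real ring" where "real_field \<equiv> ring_of_type_algebra"

lemma real_field_simps:
  "carrier real_field = UNIV" "x \<otimes>\<^bsub>real_field\<^esub> y = x * y" "x \<oplus>\<^bsub>real_field\<^esub> y = x + y"
  "\<one>\<^bsub>real_field\<^esub> = 1" "\<zero>\<^bsub>real_field\<^esub> = 0"
  by (simp_all add: ring_of_type_algebra_def)

lemma real_field_inverses:
  shows "\<ominus>\<^bsub>real_field\<^esub> x = - x" and "x \<noteq> 0 \<Longrightarrow> inv\<^bsub>real_field\<^esub> x = inverse x"
proof -
  interpret field real_field by (rule field_from_type_algebra)
  show "\<ominus>\<^bsub>real_field\<^esub> x = - x"
    using minus_equality[of "- x" x] by (simp add: real_field_simps)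
  show "inv\<^bsub>real_field\<^esub> x = inverse x" if "x \<noteq> 0"
    by (rule comm_inv_char) (use that in \<open>simp_all add: real_field_simps\<close>)
qed

lemma subfield_rat_span:
  assumes w: "w \<notin> \<rat>" "w^2 \<in> \<rat>"
  shows "subfield (rat_span w) real_field"
proof -
  interpret field real_field by (rule field_from_type_algebra)
  show ?thesis
  proof (rule subfieldI')
    show "subring (rat_span w) real_field"
    proof (rule subringI)
      show "\<one>\<^bsub>real_field\<^esub> \<in> rat_span w"
        using rat_spanI[of 1 0 w] by (simp add: real_field_simps)
      fix x assume "x \<in> rat_span w"
      then obtain a b where x: "a \<in> \<rat>" "b \<in> \<rat>" "x = a + b * w" by (auto simp: rat_span_def)
      show "\<ominus>\<^bsub>real_field\<^esub> x \<in> rat_span w"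
        using rat_spanI[of "-a" "-b" w] x by (simp add: real_field_inverses)
      fix y assume "y \<in> rat_span w"
      then obtain c d where y: "c \<in> \<rat>" "d \<in> \<rat>" "y = c + d * w" by (auto simp: rat_span_def)
      show "x \<oplus>\<^bsub>real_field\<^esub> y \<in> rat_span w"
        using rat_spanI[of "a + c" "b + d" w] x y by (simp add: real_field_simps algebra_simps)
      have "x * y = (a * c + b * d * w^2) + (a * d + b * c) * w"
        by (simp add: x y power2_eq_square algebra_simps)
      moreover have "\<dots> \<in> rat_span w" using x y w by (intro rat_spanI) auto
      ultimately show "x \<otimes>\<^bsub>real_field\<^esub> y \<in> rat_span w" by (simp add: real_field_simps)
    qed (simp add: real_field_simps)
    fix x assume "x \<in> rat_span w - {\<zero>\<^bsub>real_field\<^esub>}"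
    then obtain a b where x: "a \<in> \<rat>" "b \<in> \<rat>" "x = a + b * w" "x \<noteq> 0"
      by (auto simp: rat_span_def real_field_simps)
    define N where "N = a^2 - b^2 * w^2"
    have N: "N = x * (a - b * w)" by (simp add: N_def x power2_eq_square algebra_simps)
    have "a - b * w \<noteq> 0" using rat_span_eq_0_iff[of w a "-b"] x w by auto
    then have "N \<noteq> 0" using x(4) N by simp
    have "x * ((a / N) + (- b / N) * w) = 1"
    proof -
      have "x * ((a / N) + (- b / N) * w) = x * (a - b * w) / N" by (simp add: diff_divide_distrib right_diff_distrib)
      then show ?thesis using N \<open>N \<noteq> 0\<close> by simp
    qed
    then have "inverse x = (a / N) + (- b / N) * w"
      by (rule inverse_unique)
    moreover have "N \<in> \<rat>" using x w by (simp add: N_def)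
    ultimately have "inverse x \<in> rat_span w" using x(1,2) by (metis Rats_divide Rats_minus_iff rat_spanI)
    then show "inv\<^bsub>real_field\<^esub> x \<in> rat_span w" by (simp add: real_field_inverses x(4))
  qed
qed

text \<open>This makes the inductively defined dimension explicit: a two-dimensional subspace is spanned by two
  independent vectors.\<close>

lemma dimension_2_real_field_iff:
  "ring.dimension real_field 2 \<rat> K \<longleftrightarrow>
    (\<exists>u v. u \<noteq> 0 \<and> v \<notin> range (\<lambda>q. of_rat q * u) \<and> K = {p * v + q * u | p q. p \<in> \<rat> \<and> q \<in> \<rat>})"
proof -
  interpret field real_field by (rule field_from_type_algebra)
  have line: "line_extension \<rat> v E = {p * v + e | p e. p \<in> \<rat> \<and> e \<in> E}" for v E
    unfolding set_eq_iff line_extension_mem_iff real_field_simps by blast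
  have d0: "dimension 0 \<rat> K \<longleftrightarrow> K = {0}" for K
    by (subst dimension.simps) (auto simp: real_field_simps)
  have d1: "dimension (Suc 0) \<rat> K \<longleftrightarrow> (\<exists>u. u \<noteq> 0 \<and> K = {q * u | q. q \<in> \<rat>})" for K
    by (subst dimension.simps) (auto simp: d0 line real_field_simps)
  have r: "range (\<lambda>q. of_rat q * u) = {q * u | q. q \<in> \<rat>}" for u :: real
    by (auto simp: Rats_def)
  have d2: "dimension (Suc (Suc 0)) \<rat> K \<longleftrightarrow>
      (\<exists>v E. v \<notin> E \<and> dimension (Suc 0) \<rat> E \<and> K = line_extension \<rat> v E)" for K
    by (subst dimension.simps) (auto simp: real_field_simps)
  \<comment> \<open>Both layers of the inductive definition in one formula.\<close>
  have l2: "line_extension \<rat> v {q * u | q. q \<in> \<rat>} = {p * v + q * u | p q. p \<in> \<rat> \<and> q \<in> \<rat>}" for u v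
    unfolding line by blast
  have "dimension (Suc (Suc 0)) \<rat> K \<longleftrightarrow>
    (\<exists>u v. u \<noteq> 0 \<and> v \<notin> range (\<lambda>q. of_rat q * u) \<and> K = {p * v + q * u | p q. p \<in> \<rat> \<and> q \<in> \<rat>})"
    (is "?l = ?r")
  proof
    assume ?l
    then obtain v E where v: "v \<notin> E" "dimension (Suc 0) \<rat> E" "K = line_extension \<rat> v E"
      unfolding d2 by (elim exE conjE)
    then obtain u where u: "u \<noteq> 0" "E = {q * u | q. q \<in> \<rat>}" unfolding d1 by (elim exE conjE)
    show ?r
      by (rule exI[of _ u], rule exI[of _ v]) (use u v l2[of v u] r[of u] in simp)
  next
    assume ?r
    then obtain u v where u: "u \<noteq> 0" "v \<notin> range (\<lambda>q. of_rat q * u)"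
      "K = {p * v + q * u | p q. p \<in> \<rat> \<and> q \<in> \<rat>}" by (elim exE conjE)
    have "dimension (Suc 0) \<rat> {q * u | q. q \<in> \<rat>}" unfolding d1 by (rule exI[of _ u]) (simp add: u(1))
    moreover have "v \<notin> {q * u | q. q \<in> \<rat>}" using u(2) unfolding r .
    moreover have "K = line_extension \<rat> v {q * u | q. q \<in> \<rat>}" unfolding l2 u(3) ..
    ultimately show ?l unfolding d2 by (intro exI conjI)
  qed
  then show ?thesis by (simp add: numeral_2_eq_2)
qed

lemma rat_span_real_quadratic:
  assumes w: "w \<notin> \<rat>" "w^2 \<in> \<rat>"
  shows "rat_span w \<in> real_quadratic_fields"
proof -
  have "ring.dimension real_field 2 \<rat> (rat_span w)"
    unfolding dimension_2_real_field_iff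
    by (rule exI[of _ 1], rule exI[of _ w]) (use w in \<open>auto simp: rat_span_def add.commute\<close>)
  then show ?thesis by (simp add: real_quadratic_fields_def subfield_rat_span w)
qed

lemma Q_adjoin_eq_rat_span:
  assumes "w \<notin> \<rat>" "w^2 \<in> \<rat>" "p \<in> \<rat>" "q \<in> \<rat>" "q \<noteq> 0"
  shows "Q_adjoin (p + q * w) = rat_span w"
proof -
  have f: "field real_field" by (rule field_from_type_algebra)
  show ?thesis
  proof
    have "\<rat> \<subseteq> rat_span w"
    proof
      show "x \<in> rat_span w" if "x \<in> \<rat>" for x using rat_spanI[OF that Rats_0, of w] by simp
    qed
    moreover have "p + q * w \<in> rat_span w" using assms by (intro rat_spanI)
    ultimately show "Q_adjoin (p + q * w) \<subseteq> rat_span w"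
      unfolding Q_adjoin_def
      by (intro field.generate_field_min_subfield1[OF f] subfield_rat_span assms)
        (simp_all add: real_field_simps)
    show "rat_span w \<subseteq> Q_adjoin (p + q * w)"
    proof
      fix x assume "x \<in> rat_span w"
      then have "x \<in> rat_span (p + q * w)" using rat_span_affine assms by blast
      then obtain a b where x: "a \<in> \<rat>" "b \<in> \<rat>" "x = a + b * (p + q * w)" by (auto simp: rat_span_def)
      have i: "y \<in> Q_adjoin (p + q * w)" if "y \<in> \<rat> \<or> y = p + q * w" for y
        unfolding Q_adjoin_def by (rule generate_field.incl) (use that in auto)
      have "a \<oplus>\<^bsub>real_field\<^esub> (b \<otimes>\<^bsub>real_field\<^esub> (p + q * w)) \<in> Q_adjoin (p + q * w)"
        using i[of a] i[of b] i[of "p + q * w"] x unfolding Q_adjoin_def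
        by (intro generate_field.eng_add generate_field.eng_mult) auto
      then show "x \<in> Q_adjoin (p + q * w)" by (simp add: real_field_simps x)
    qed
  qed
qed

text \<open>Any irrational element \<open>x\<close> of the field spans it together with \<open>1\<close>. As \<open>x\<^sup>2\<close> is again in the field,
  completing the square and clearing denominators replaces \<open>x\<close> by the square root of an integer.\<close>

lemma real_quadratic_fieldE:
  assumes "K \<in> real_quadratic_fields"
  obtains D :: int where "D > 0" "\<nexists>k. D = k^2" "K = rat_span (sqrt (real_of_int D))"
proof -
  interpret field real_field by (rule field_from_type_algebra)
  have K: "subfield K real_field" "ring.dimension real_field 2 \<rat> K"
    using assms by (auto simp: real_quadratic_fields_def)
  interpret K: subfield K real_field by (rule K(1))
  have [simp]: "1 \<in> K" using K.one_closed by (simp add: real_field_simps)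
  have Kmult: "x * y \<in> K" if "x \<in> K" "y \<in> K" for x y
    using K.m_closed that by (simp add: real_field_simps)
  obtain u v where u: "u \<noteq> 0" and v: "v \<notin> range (\<lambda>q. of_rat q * u)"
    and Keq: "K = {p * v + q * u | p q. p \<in> \<rat> \<and> q \<in> \<rat>}"
    using K(2) unfolding dimension_2_real_field_iff by blast
  have uK: "u \<in> K" and vK: "v \<in> K"
    unfolding Keq by (force intro: exI[of _ 0] exI[of _ 1])+
  have vu: "v / u \<notin> \<rat>"
  proof
    assume "v / u \<in> \<rat>"
    then obtain q where "v / u = of_rat q" by (auto simp: Rats_def)
    then have "v = of_rat q * u" using u by (simp add: field_simps)
    then show False using v by blast
  qed
  \<comment> \<open>Dividing by \<open>u\<close> turns the basis \<open>u, v\<close> into \<open>1, x\<close>.\<close>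
  define x where "x = v / u"
  have x: "x \<notin> \<rat>" using vu by (simp add: x_def)
  have "inv\<^bsub>real_field\<^esub> u \<in> K"
    using subfield_m_inv(1)[OF K(1), of u] uK u by (simp add: real_field_simps)
  then have iu: "inverse u \<in> K" by (simp add: real_field_inverses u)
  then have xK: "x \<in> K" unfolding x_def divide_inverse by (intro Kmult vK)
  have Kspan: "K = rat_span x"
  proof -
    have "y * u \<in> K \<and> y * inverse u \<in> K" if "y \<in> K" for y using that uK iu Kmult by blast
    moreover have "y * u * inverse u = y" for y using u by simp
    ultimately have "y \<in> K \<longleftrightarrow> y * u \<in> K" for y by metis
    moreover have "y * u \<in> K \<longleftrightarrow> y \<in> rat_span x" for y
    proof -
      have "y * u = p * v + q * u \<longleftrightarrow> y = q + p * x" for p q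
      proof -
        have "p * v + q * u = (q + p * x) * u" using u by (simp add: x_def distrib_right)
        then show ?thesis using u by simp
      qed
      moreover have "y * u \<in> K \<longleftrightarrow> (\<exists>p\<in>\<rat>. \<exists>q\<in>\<rat>. y * u = p * v + q * u)"
        unfolding Keq by auto
      moreover have "y \<in> rat_span x \<longleftrightarrow> (\<exists>q\<in>\<rat>. \<exists>p\<in>\<rat>. y = q + p * x)"
        by (auto simp: rat_span_def)
      ultimately show ?thesis by auto
    qed
    ultimately show ?thesis by blast
  qed
  have "x^2 \<in> rat_span x" using Kmult[OF xK xK] Kspan by (simp add: power2_eq_square)
  then obtain p q where pq: "p \<in> \<rat>" "q \<in> \<rat>" "x^2 = p + q * x" by (auto simp: rat_span_def)
  define y where "y = x - q / 2"
  define e where "e = p + q^2 / 4"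
  have "y^2 = x^2 - q * x + q^2 / 4" by (simp add: y_def power2_eq_square algebra_simps)
  then have y2: "y^2 = e" using pq(3) by (simp add: e_def)
  have eQ: "e \<in> \<rat>" using pq by (auto simp: e_def)
  have yQ: "y \<notin> \<rat>"
  proof
    assume "y \<in> \<rat>"
    then have "y + q / 2 \<in> \<rat>" using pq by auto
    then show False using x by (simp add: y_def)
  qed
  obtain m n :: int where mn: "n > 0" "e = m / n" using Rats_cases'[OF eQ] by metis
  have "y \<noteq> 0" using yQ by auto
  then have "e > 0" using y2 by (metis zero_less_power2)
  then have m: "m > 0" using mn by (simp add: zero_less_divide_iff)
  \<comment> \<open>\<open>(n y)\<^sup>2 = n\<^sup>2 m / n = m n\<close>, so multiplying \<open>y\<close> by its denominator makes its square an integer.\<close>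
  define D where "D = m * n"
  have "(n * y)^2 = real_of_int D" using mn y2 by (simp add: D_def power_mult_distrib) (simp add: power2_eq_square)
  then have sq: "sqrt (real_of_int D) = \<bar>n * y\<bar>" by (metis real_sqrt_abs)
  have span: "K = rat_span (sqrt (real_of_int D))"
  proof -
    obtain s :: real where s: "s \<in> \<rat>" "s \<noteq> 0" "sqrt (real_of_int D) = s * y"
    proof (cases "n * y \<ge> 0")
      case True then show thesis using that[of n] mn sq by auto
    next
      case False then show thesis using that[of "- n"] mn sq by auto
    qed
    have "sqrt (real_of_int D) = (- s * q / 2) + s * x" using s by (simp add: y_def algebra_simps)
    moreover have "- s * q / 2 \<in> \<rat>" using s pq by auto
    ultimately show ?thesis using rat_span_affine[of "- s * q / 2" s x] s Kspan by simp
  qed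
  have "\<nexists>k. D = k^2"
  proof
    assume "\<exists>k. D = k^2"
    then obtain k :: int where k: "D = k^2" by blast
    have "sqrt (real_of_int D) = \<bar>real_of_int k\<bar>" unfolding k by simp
    then have "\<bar>real_of_int n * y\<bar> = \<bar>real_of_int k\<bar>" using sq by simp
    then have "y = k / n \<or> y = - k / n" using mn(1) by (auto simp: abs_if field_simps split: if_splits)
    then show False using yQ by auto
  qed
  moreover have "D > 0" using m mn by (simp add: D_def)
  ultimately show thesis using that span by blast
qed

section \<open>The Pell equation\<close>

text \<open>The surd \<open>\<surd>D\<close> has infinitely many Dirichlet approximations \<open>h / k\<close>, and all norms \<open>h\<^sup>2 - D k\<^sup>2\<close> lie in
  a bounded range. Two approximations with the same norm and congruent modulo it have an integral
  quotient in \<open>\<int>[\<surd>D]\<close>, which has norm one.\<close>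

lemma Pell_solution:
  fixes D :: int
  assumes D: "D > 0" "\<nexists>k. D = k^2"
  obtains x y :: int where "x > 1" "y > 0" "x^2 - D * y^2 = 1"
proof -
  let ?s = "sqrt (real_of_int D)"
  have s: "?s \<notin> \<rat>" using D by (intro sqrt_int_irrational) auto
  have s0: "?s > 0" using D by simp
  let ?A = "approx_set ?s"
  define nm where "nm = (\<lambda>(h, k). h^2 - D * k^2 :: int)"
  have bound: "\<bar>real_of_int (nm p)\<bar> \<le> 1 + 2 * ?s" if p: "p \<in> ?A" for p
  proof -
    obtain h k where hk: "p = (h, k)" "k > 0" "\<bar>?s - h / k\<bar> < 1 / k^2"
      using p by (auto simp: approx_set_def)
    define e where "e = h - k * ?s"
    have k1: "1 \<le> real_of_int k" using hk(2) by simp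
    have "\<bar>?s - h / k\<bar> = \<bar>e\<bar> / k" using k1 by (simp add: e_def field_simps abs_divide[symmetric])
    then have "\<bar>e\<bar> * k < 1" using hk(3) k1 by (simp add: field_simps power2_eq_square)
    then have e1: "\<bar>e\<bar> * k \<le> 1" by simp
    have "\<bar>e\<bar> * 1 \<le> \<bar>e\<bar> * k" using k1 by (intro mult_left_mono) auto
    then have e2: "\<bar>e\<bar> \<le> 1" using e1 by linarith
    have "real_of_int (nm p) = (k * ?s + e)^2 - D * k^2" by (simp add: nm_def hk e_def)
    also have "\<dots> = e^2 + 2 * ?s * (e * k) + k^2 * (?s^2 - D)"
      by (simp add: power2_eq_square algebra_simps)
    also have "?s^2 = D" using D by simp
    finally have "real_of_int (nm p) = e^2 + 2 * ?s * (e * k)" by simp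
    also have "\<bar>\<dots>\<bar> \<le> \<bar>e^2\<bar> + \<bar>2 * ?s * (e * k)\<bar>" by (rule abs_triangle_ineq)
    also have "\<dots> = \<bar>e\<bar>^2 + 2 * ?s * (\<bar>e\<bar> * k)" using s0 k1 by (simp add: abs_mult)
    also have "\<dots> \<le> 1 + 2 * ?s * 1"
      using e1 e2 s0 power_le_one[of "\<bar>e\<bar>" 2] by (intro add_mono mult_left_mono) simp_all
    finally show ?thesis by simp
  qed
  define L where "L = \<lceil>1 + 2 * ?s\<rceil>"
  have nmL: "nm p \<in> {-L..L}" if "p \<in> ?A" for p
    using bound[OF that] unfolding L_def by (auto simp: abs_le_iff) linarith+
  define g where "g = (\<lambda>p. (nm p, fst p mod nm p, snd p mod nm p))"
  have inf: "infinite ?A" using rational_iff_finite_approx_set s by blast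
  have nm0: "nm p \<noteq> 0" if "p \<in> ?A" for p
  proof
    assume "nm p = 0"
    then obtain h k where hk: "k > 0" "h^2 = D * k^2"
      using \<open>p \<in> ?A\<close> by (auto simp: approx_set_def nm_def)
    then have "real_of_int (h^2) = real_of_int (D * k^2)" by simp
    then have "?s = sqrt ((h / k)^2)" using hk(1) by (simp add: field_simps)
    then have "?s = \<bar>real_of_int h / k\<bar>" by simp
    then show False using s by (metis Rats_abs_iff Rats_divide Rats_of_int)
  qed
  have "g ` ?A \<subseteq> {-L..L} \<times> {-L..L} \<times> {-L..L}"
  proof
    fix z assume "z \<in> g ` ?A"
    then obtain p where p: "p \<in> ?A" "z = g p" by blast
    have "\<bar>a mod nm p\<bar> \<le> \<bar>nm p\<bar>" for a using abs_mod_less[OF nm0[OF p(1)], of a] by linarith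
    then have "\<bar>a mod nm p\<bar> \<le> L" for a using nmL[OF p(1)] by (smt (verit) atLeastAtMost_iff)
    then show "z \<in> {-L..L} \<times> {-L..L} \<times> {-L..L}" using nmL[OF p(1)] p(2)
      by (auto simp: g_def abs_le_iff) (smt (verit) minus_le_iff)+
  qed
  then have "finite (g ` ?A)" by (rule finite_subset) auto
  from pigeonhole_infinite[OF inf this] obtain p0 where p0: "p0 \<in> ?A" "infinite {p \<in> ?A. g p = g p0}" by blast
  then have "infinite ({p \<in> ?A. g p = g p0} - {p0})" by simp
  then obtain p1 where p1: "p1 \<in> ?A" "g p1 = g p0" "p1 \<noteq> p0"
    by (metis (mono_tags, lifting) DiffD1 DiffD2 all_not_in_conv infinite_imp_nonempty mem_Collect_eq singletonI)
  obtain a b where ab: "p0 = (a, b)" "b > 0" using p0 by (auto simp: approx_set_def)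
  obtain c d where cd: "p1 = (c, d)" "d > 0" using p1 by (auto simp: approx_set_def)
  define k where "k = nm p0"
  have k0: "k \<noteq> 0" using nm0 p0 by (simp add: k_def)
  have n0: "a^2 - D * b^2 = k" and n1: "c^2 - D * d^2 = k"
    using p1(2) by (auto simp: g_def k_def nm_def ab cd)
  have "c mod k = a mod k" "d mod k = b mod k"
    using p1(2) by (auto simp: g_def k_def ab cd)
  then have kd: "k dvd c - a" "k dvd d - b" by (auto simp: mod_eq_dvd_iff)
  have "k dvd a * c - D * b * d"
  proof -
    have "a * c - D * b * d = k + a * (c - a) - D * b * (d - b)"
      unfolding n0[symmetric] by (simp add: power2_eq_square algebra_simps)
    then show ?thesis using kd by simp
  qed
  \<comment> \<open>\<open>(a + b \<surd>D) / (c + d \<surd>D) = x' - y' \<surd>D\<close>\<close>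
  then obtain x' where x': "a * c - D * b * d = k * x'" by blast
  have "k dvd a * d - b * c"
  proof -
    have "a * d - b * c = a * (d - b) - b * (c - a)" by (simp add: algebra_simps)
    then show ?thesis using kd by simp
  qed
  then obtain y' where y': "a * d - b * c = k * y'" by blast
  have "k^2 * (x'^2 - D * y'^2) = (a * c - D * b * d)^2 - D * (a * d - b * c)^2"
    unfolding x' y' by (simp add: power2_eq_square algebra_simps)
  also have "\<dots> = (a^2 - D * b^2) * (c^2 - D * d^2)" by (simp add: power2_eq_square algebra_simps)
  also have "\<dots> = k^2 * 1" unfolding n0 n1 by (simp add: power2_eq_square)
  finally have xy: "x'^2 - D * y'^2 = 1" using k0 by simp
  have y0: "y' \<noteq> 0"
  proof
    assume "y' = 0"
    then have e: "a * d = b * c" using y' by simp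
    have "k * d^2 = (a * d)^2 - D * b^2 * d^2" unfolding n0[symmetric] by (simp add: power2_eq_square algebra_simps)
    also have "\<dots> = b^2 * (c^2 - D * d^2)" unfolding e by (simp add: power2_eq_square algebra_simps)
    also have "\<dots> = k * b^2" unfolding n1 by simp
    finally have "d^2 = b^2" using k0 by simp
    then have "d = b" using ab cd by (simp add: power2_eq_iff_nonneg)
    then show False using e ab cd p1(3) by auto
  qed
  have "\<bar>y'\<bar>^2 \<ge> 1" using y0 by (simp add: int_one_le_iff_zero_less)
  then have "D * y'^2 \<ge> 1" using D(1) by (simp add: int_one_le_iff_zero_less)
  then have "x'^2 > 1^2" using xy by simp
  then have "\<bar>x'\<bar> > 1" by (metis abs_1 power2_abs power_less_imp_less_base abs_ge_zero)
  then show thesis using that[of "\<bar>x'\<bar>" "\<bar>y'\<bar>"] xy y0 by auto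
qed

section \<open>The field of a trace\<close>

definition trace_field :: "int \<Rightarrow> real set" where
  "trace_field t = rat_span (sqrt (real_of_int (t^2 - 4)))"

lemma norm_one_disc_pos: "(t::int) > 2 \<Longrightarrow> t^2 - 4 > 0"
  using power_strict_mono[of 2 t 2] by simp

lemma sqrt_disc_irrational: "t > 2 \<Longrightarrow> sqrt (real_of_int (t^2 - 4)) \<notin> \<rat>"
  using norm_one_disc_pos[of t] norm_one_trace_not_square by (intro sqrt_int_irrational) auto

lemma sqrt_disc_sq: "t > 2 \<Longrightarrow> (sqrt (real_of_int (t^2 - 4)))^2 = real_of_int (t^2 - 4)"
  using norm_one_disc_pos[of t] by (intro real_sqrt_pow2) linarith

lemma trace_field_real_quadratic:
  assumes "t > 2"
  shows "trace_field t \<in> real_quadratic_fields"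
  unfolding trace_field_def
  by (rule rat_span_real_quadratic[OF sqrt_disc_irrational[OF assms]]) (simp add: sqrt_disc_sq[OF assms] del: of_int_diff of_int_power)

lemma rat_span_sqrt_square_mult:
  assumes "u \<noteq> 0"
  shows "rat_span (sqrt (real_of_int (u^2 * D))) = rat_span (sqrt (real_of_int D))"
proof -
  have "sqrt (real_of_int (u^2 * D)) = 0 + \<bar>real_of_int u\<bar> * sqrt (real_of_int D)"
    by (simp add: real_sqrt_mult)
  then show ?thesis using rat_span_affine[of 0 "\<bar>real_of_int u\<bar>"] assms by (simp only:) auto
qed

text \<open>Both roots of the characteristic polynomial generate the same field.\<close>

lemma Q_adjoin_norm_one_root:
  assumes t: "t > 2" and \<mu>: "\<mu>^2 - real_of_int t * \<mu> + 1 = 0"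
  shows "Q_adjoin \<mu> = trace_field t"
proof -
  let ?s = "sqrt (real_of_int (t^2 - 4))"
  have "(2 * \<mu> - t)^2 = 4 * (\<mu>^2 - t * \<mu> + 1) + real_of_int (t^2 - 4)"
    by (simp add: power2_eq_square algebra_simps)
  also have "\<dots> = ?s^2" unfolding \<mu> sqrt_disc_sq[OF t] by simp
  finally have "2 * \<mu> - t = ?s \<or> 2 * \<mu> - t = - ?s" by (simp only: power2_eq_iff)
  then have "\<mu> = t / 2 + 1 / 2 * ?s \<or> \<mu> = t / 2 + - 1 / 2 * ?s" by auto
  then obtain q where q: "q = 1 / 2 \<or> q = - 1 / 2" "\<mu> = t / 2 + q * ?s" by metis
  have "?s^2 \<in> \<rat>" unfolding sqrt_disc_sq[OF t] by (rule Rats_of_int)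
  moreover have "q \<in> \<rat>" using q(1) by (metis Rats_1 Rats_divide Rats_minus_iff Rats_number_of)
  moreover have "q \<noteq> 0" using q(1) by linarith
  ultimately show ?thesis
    unfolding q(2) trace_field_def by (intro Q_adjoin_eq_rat_span sqrt_disc_irrational t) auto
qed

lemma real_quadratic_field_trace:
  assumes "K \<in> real_quadratic_fields"
  obtains t where "t > 2" "K = trace_field t"
proof -
  obtain D where D: "D > 0" "\<nexists>k. D = k^2" "K = rat_span (sqrt (real_of_int D))"
    using real_quadratic_fieldE[OF assms] .
  obtain x y where xy: "x > 1" "y > 0" "x^2 - D * y^2 = 1" using Pell_solution[OF D(1,2)] .
  have "(2 * x)^2 - 4 = (2 * y)^2 * D" using xy(3) by (simp add: power_mult_distrib algebra_simps)
  then have "trace_field (2 * x) = K"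
    unfolding trace_field_def D(3) using rat_span_sqrt_square_mult[of "2 * y" D] xy(2) by simp
  then show thesis using that[of "2 * x"] xy by simp
qed

text \<open>If \<open>\<surd>d = p + q \<surd>d'\<close> with rational \<open>p\<close> and \<open>q\<close>, then squaring shows \<open>p q = 0\<close>. So \<open>\<surd>d\<close> and \<open>\<surd>d'\<close>
  are rationally proportional and have a common surd.\<close>

lemma trace_field_eqE:
  assumes t: "t > 2" "t' > 2" and eq: "trace_field t = trace_field t'"
  obtains a b D :: int where "a > 0" "b > 0" "D > 0" "t^2 - 4 = a^2 * D" "t'^2 - 4 = b^2 * D"
proof -
  let ?d = "real_of_int (t^2 - 4)" and ?d' = "real_of_int (t'^2 - 4)"
  have "sqrt ?d \<in> rat_span (sqrt ?d)" using rat_spanI[of 0 1] by simp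
  then have "sqrt ?d \<in> rat_span (sqrt ?d')" using eq unfolding trace_field_def by simp
  then obtain p q where pq: "p \<in> \<rat>" "q \<in> \<rat>" "sqrt ?d = p + q * sqrt ?d'"
    unfolding rat_span_def by blast
  have q0: "q \<noteq> 0" using sqrt_disc_irrational[OF t(1)] pq(1,3) by auto
  have "?d = (p + q * sqrt ?d')^2" unfolding pq(3)[symmetric] sqrt_disc_sq[OF t(1)] ..
  also have "\<dots> = p^2 + q^2 * (sqrt ?d')^2 + 2 * p * q * sqrt ?d'"
    by (simp add: power2_eq_square algebra_simps)
  finally have "(p^2 + q^2 * ?d' - ?d) + (2 * p * q) * sqrt ?d' = 0"
    unfolding sqrt_disc_sq[OF t(2)] by linarith
  then have "2 * p * q = 0"
    using rat_span_eq_0_iff[OF sqrt_disc_irrational[OF t(2)], of "p^2 + q^2 * ?d' - ?d" "2 * p * q"] pq(1,2)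
    by (simp del: of_int_diff of_int_power)
  then have p0: "p = 0" using q0 by simp
  obtain a b :: int where ab: "b > 0" "coprime a b" "q = a / b" using Rats_cases'[OF pq(2)] by metis
  have "q * sqrt ?d' > 0" using pq(3) p0 norm_one_disc_pos[OF t(1)] by (metis add_0 of_int_0_less_iff real_sqrt_gt_0_iff)
  moreover have "sqrt ?d' > 0" using norm_one_disc_pos[OF t(2)] by (metis of_int_0_less_iff real_sqrt_gt_0_iff)
  ultimately have "q > 0" by (simp only: zero_less_mult_iff) auto
  then have a: "a > 0" using ab by (simp add: zero_less_divide_iff)
  have "?d = q^2 * ?d'"
    using pq(3) p0 sqrt_disc_sq[OF t(1)] sqrt_disc_sq[OF t(2)] by (metis add_0 power_mult_distrib)
  then have "real_of_int b^2 * ?d = real_of_int a^2 * ?d'"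
    using ab by (simp add: power_divide field_simps)
  then have eq: "b^2 * (t^2 - 4) = a^2 * (t'^2 - 4)"
    by (metis of_int_eq_iff of_int_mult of_int_power)
  have "coprime (b^2) (a^2)" using ab(2) by (simp add: coprime_commute)
  moreover have "b^2 dvd a^2 * (t'^2 - 4)" by (metis eq dvd_triv_left)
  ultimately have "b^2 dvd t'^2 - 4" by (simp only: coprime_dvd_mult_right_iff)
  then obtain D where D: "t'^2 - 4 = b^2 * D" by blast
  then have "b^2 * (t^2 - 4) = b^2 * (a^2 * D)" using eq by (simp add: mult.left_commute)
  then have D': "t^2 - 4 = a^2 * D" using ab(1) by simp
  have "D > 0" using norm_one_disc_pos[OF t(1)] a unfolding D' by (simp add: zero_less_mult_iff)
  then show thesis using that a ab(1) D D' by blast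
qed

section \<open>Units of norm one\<close>

lemma plus_inverse_inj:
  fixes x y :: real
  assumes "x \<ge> 1" "y \<ge> 1" "x + inverse x = y + inverse y"
  shows "x = y"
proof -
  have "(x + inverse x - (y + inverse y)) * (x * y) = (x - y) * (x * y - 1)"
    using assms(1,2) by (simp add: algebra_simps)
  then have "x = y \<or> x * y = 1" using assms(3) by simp
  moreover have "x = y" if "x * y = 1"
  proof -
    have "x * 1 \<le> x * y" "1 * y \<le> x * y" using assms(1,2) by (intro mult_mono; simp)+
    then show ?thesis using that assms by simp
  qed
  ultimately show ?thesis by blast
qed

lemma power_sandwich:
  fixes x b :: real
  assumes "x \<ge> 1" "b > 1"
  obtains m where "b ^ m \<le> x" "x < b ^ Suc m"
proof -
  define k where "k = (LEAST k. x < b ^ k)"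
  obtain k0 where "x < b ^ k0" using real_arch_pow[OF assms(2)] by blast
  then have k: "x < b ^ k" unfolding k_def by (rule LeastI)
  then obtain m where m: "k = Suc m" using assms(1) by (cases k) auto
  have "\<not> x < b ^ m" using not_less_Least[of m "\<lambda>k. x < b ^ k"] m by (simp add: k_def)
  then show thesis using that[of m] k m by simp
qed

text \<open>For positive \<open>D\<close> that is not a square, these are the units of norm one in the order of discriminant \<open>D\<close> or \<open>4 D\<close>: the numbers \<open>(p + q \<surd>D) / 2\<close> with
  integral trace \<open>p\<close> and norm \<open>(p\<^sup>2 - D q\<^sup>2) / 4 = 1\<close>.\<close>

definition quadratic_units :: "int \<Rightarrow> real set" where
  "quadratic_units D = {(of_int p + of_int q * sqrt (of_int D)) / 2 | p q :: int. p^2 - D * q^2 = 4}"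

context
  fixes D :: int
  assumes D: "D > 0"
begin

lemma quadratic_units_mult:
  assumes "x \<in> quadratic_units D" "y \<in> quadratic_units D"
  shows "x * y \<in> quadratic_units D"
proof -
  define w where "w = sqrt (real_of_int D)"
  obtain p q where x: "x = (of_int p + of_int q * w) / 2" "p^2 - D * q^2 = 4"
    using assms(1) by (auto simp: quadratic_units_def w_def)
  obtain p' q' where y: "y = (of_int p' + of_int q' * w) / 2" "p'^2 - D * q'^2 = 4"
    using assms(2) by (auto simp: quadratic_units_def w_def)
  have w: "w * w = of_int D" using D by (simp add: w_def)
  have "even (p^2 - D * q^2)" "even (p'^2 - D * q'^2)" unfolding x y by simp_all
  then have ev: "even (p - D * q)" "even (p' - D * q')" by simp_all
  then have "even (p * p' + D * q * q')" "even (p * q' + p' * q)" by auto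
  then obtain P Q where PQ: "p * p' + D * q * q' = 2 * P" "p * q' + p' * q = 2 * Q" by blast
  have "x * y = (of_int (p * p' + D * q * q') + of_int (p * q' + p' * q) * w) / 4"
    unfolding x y by (simp add: algebra_simps) (simp add: w flip: mult.assoc)
  then have e: "x * y = (of_int P + of_int Q * w) / 2" unfolding PQ by (simp add: field_simps)
  have "4 * (P^2 - D * Q^2) = (p * p' + D * q * q')^2 - D * (p * q' + p' * q)^2"
    unfolding PQ by (simp add: power2_eq_square algebra_simps)
  also have "\<dots> = (p^2 - D * q^2) * (p'^2 - D * q'^2)" by (simp add: power2_eq_square algebra_simps)
  finally have "P^2 - D * Q^2 = 4" unfolding x y by simp
  then show ?thesis unfolding e quadratic_units_def w_def by blast
qed

lemma quadratic_units_inverse_trace: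
  assumes "x \<in> quadratic_units D"
  shows "inverse x \<in> quadratic_units D" "x + inverse x \<in> \<int>"
proof -
  define w where "w = sqrt (real_of_int D)"
  obtain p q where x: "x = (of_int p + of_int q * w) / 2" "p^2 - D * q^2 = 4"
    using assms(1) by (auto simp: quadratic_units_def w_def)
  have w: "w * w = of_int D" using D by (simp add: w_def)
  have "x * ((of_int p + of_int (- q) * w) / 2) = of_int (p^2 - D * q^2) / 4"
    unfolding x(1) by (simp add: algebra_simps power2_eq_square) (simp add: w flip: mult.assoc)
  then have e: "inverse x = (of_int p + of_int (- q) * w) / 2"
    unfolding x(2) by (intro inverse_unique) simp
  moreover have "p^2 - D * (- q)^2 = 4" using x(2) by simp
  ultimately show "inverse x \<in> quadratic_units D" unfolding quadratic_units_def w_def by blast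
  have "x + inverse x = of_int p" unfolding e by (simp add: x(1) field_simps)
  then show "x + inverse x \<in> \<int>" by simp
qed

lemma quadratic_units_power:
  assumes "x \<in> quadratic_units D"
  shows "x ^ n \<in> quadratic_units D"
proof (induction n)
  case 0
  have "1 = (of_int 2 + of_int 0 * sqrt (real_of_int D)) / 2" "2^2 - D * 0^2 = (4::int)" by simp_all
  then show ?case unfolding quadratic_units_def power_0 by blast
qed (simp add: quadratic_units_mult assms)

text \<open>This replaces the rank one case of the theorem of Dirichlet on units. Divide each \<open>x\<^sup>n\<close> by the power of \<open>y\<close> that moves
  it into \<open>[1, y)\<close>. A unit \<open>u \<ge> 1\<close> is determined by its trace \<open>u + 1 / u\<close>, which is an integer and
  bounded here, so two of the quotients coincide.\<close>

lemma quadratic_units_common_power: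
  assumes "x \<in> quadratic_units D" "y \<in> quadratic_units D" "x > 1" "y > 1"
  obtains n m :: nat where "n > 0" "m > 0" "x ^ n = y ^ m"
proof -
  have "\<exists>m. y ^ m \<le> x ^ n \<and> x ^ n < y ^ Suc m" for n
    using power_sandwich[of "x ^ n" y] assms(3,4) by (metis less_imp_le one_le_power)
  then obtain m where m: "\<And>n. y ^ m n \<le> x ^ n" "\<And>n. x ^ n < y ^ Suc (m n)" by metis
  define u where "u = (\<lambda>n. x ^ n * inverse (y ^ m n))"
  have ypos: "y ^ k > 0" for k using assms(4) by simp
  have u1: "1 \<le> u n" "u n < y" for n
    using m[of n] ypos[of "m n"] by (simp_all add: u_def field_simps)
  have uD: "u n \<in> quadratic_units D" for n
    unfolding u_def by (intro quadratic_units_mult quadratic_units_inverse_trace quadratic_units_power assms)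
  define f where "f = (\<lambda>n. \<lfloor>u n + inverse (u n)\<rfloor>)"
  have f: "of_int (f n) = u n + inverse (u n)" for n
    unfolding f_def using quadratic_units_inverse_trace(2)[OF uD] by simp
  have "f n \<in> {0..\<lceil>y + 1\<rceil>}" for n
  proof -
    have "inverse (u n) \<le> 1" "0 \<le> inverse (u n)" using u1(1)[of n] by (simp_all add: inverse_le_1_iff)
    then have "0 \<le> real_of_int (f n)" "real_of_int (f n) \<le> y + 1" unfolding f using u1[of n] by linarith+
    then show ?thesis by (simp add: le_ceiling_iff) linarith
  qed
  then have "finite (range f)" by (intro finite_subset[of "range f" "{0..\<lceil>y + 1\<rceil>}"]) auto
  then have "\<not> inj f" using finite_imageD infinite_UNIV_nat by blast
  then obtain i j where "i \<noteq> j" "f i = f j" by (auto simp: inj_def)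
  then obtain i j where ij: "i < j" "f i = f j" by (metis linorder_neqE_nat)
  have "u i + inverse (u i) = u j + inverse (u j)" using f[of i] f[of j] ij(2) by simp
  then have "u i = u j" by (rule plus_inverse_inj[OF u1(1) u1(1)])
  then have "x ^ i * y ^ m j = x ^ j * y ^ m i"
    using ypos[of "m i", THEN less_imp_neq] ypos[of "m j", THEN less_imp_neq]
    unfolding u_def divide_inverse[symmetric] by (subst (asm) frac_eq_eq) auto
  also have "x ^ j = x ^ i * x ^ (j - i)" using ij(1) by (simp flip: power_add)
  finally have e: "y ^ m j = x ^ (j - i) * y ^ m i" using assms(3) by simp
  have x1: "x ^ (j - i) > 1" using ij assms(3) by (intro one_less_power) auto
  then have "1 * y ^ m i < x ^ (j - i) * y ^ m i" using ypos by (intro mult_strict_right_mono) auto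
  then have "y ^ m i < y ^ m j" unfolding e by simp
  then have lt: "m i < m j" using assms(4) by simp
  then have "y ^ m j = y ^ (m j - m i) * y ^ m i" by (simp flip: power_add)
  then have "x ^ (j - i) = y ^ (m j - m i)" using e ypos by (metis less_irrefl mult_right_cancel)
  then show thesis using that[of "j - i" "m j - m i"] ij lt by simp
qed

end

text \<open>The eigenvalue greater than \<open>1\<close> of a matrix of determinant \<open>1\<close> and trace \<open>t > 2\<close>.\<close>

definition large_root :: "int \<Rightarrow> real" where
  "large_root t = (real_of_int t + sqrt (real_of_int (t^2 - 4))) / 2"

lemma large_root:
  assumes "t > 2"
  shows "large_root t > 1" "(large_root t)^2 = t * large_root t - 1"
proof -
  show "large_root t > 1"
  proof -
    have "sqrt (real_of_int (t^2 - 4)) > 0"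
      using norm_one_disc_pos[OF assms] by (metis of_int_0_less_iff real_sqrt_gt_0_iff)
    moreover have "real_of_int t > 2" using assms by simp
    moreover have "(a + b) / 2 > 1" if "b > 0" "a > 2" for a b :: real using that by simp
    ultimately show ?thesis unfolding large_root_def by blast
  qed
  have "4 * (large_root t)^2 = t^2 + 2 * t * sqrt (real_of_int (t^2 - 4)) + (sqrt (real_of_int (t^2 - 4)))^2"
    by (simp add: large_root_def power_divide power2_sum)
  also have "\<dots> = 4 * (t * large_root t - 1)"
    unfolding sqrt_disc_sq[OF assms] by (simp add: large_root_def field_simps power2_eq_square)
  finally show "(large_root t)^2 = t * large_root t - 1" by simp
qed

lemma large_root_common_power:
  assumes t: "t > 2" "t' > 2" and eq: "trace_field t = trace_field t'"
  obtains n m :: nat where "n > 0" "m > 0" "large_root t ^ n = large_root t' ^ m"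
proof -
  obtain a b D :: int where D: "a > 0" "b > 0" "D > 0" "t^2 - 4 = a^2 * D" "t'^2 - 4 = b^2 * D"
    using trace_field_eqE[OF assms] .
  have "large_root t \<in> quadratic_units D" if "a > 0" "t^2 - 4 = a^2 * D" for a t
  proof -
    have "t^2 - D * a^2 = 4" using that(2) by (simp add: algebra_simps)
    moreover have "large_root t = (of_int t + of_int a * sqrt (of_int D)) / 2"
      unfolding large_root_def that(2) using that(1) by (simp add: real_sqrt_mult)
    ultimately show ?thesis unfolding quadratic_units_def by blast
  qed
  then show thesis
    using quadratic_units_common_power[OF D(3), of "large_root t" "large_root t'"] D t large_root(1) that
    by metis
qed

section \<open>Hyperbolic matrices\<close>

definition SL2Z :: "(int ^ 2 ^ 2) monoid" where
  "SL2Z = \<lparr>carrier = {A. det A = 1}, monoid.mult = (**), one = mat 1\<rparr>"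

definition adjugate2 :: "int ^ 2 ^ 2 \<Rightarrow> int ^ 2 ^ 2" where
  "adjugate2 A = vector [vector [A$2$2, - A$1$2], vector [- A$2$1, A$1$1]]"

lemma matrix2_simps:
  fixes A B :: "int ^ 2 ^ 2" and x :: "int ^ 2"
  shows "(A ** B)$i$j = A$i$1 * B$1$j + A$i$2 * B$2$j"
    and "(A *v x)$i = A$i$1 * x$1 + A$i$2 * x$2"
    and "trace A = A$1$1 + A$2$2"
    and "adjugate2 A$1$1 = A$2$2" "adjugate2 A$1$2 = - A$1$2"
    and "adjugate2 A$2$1 = - A$2$1" "adjugate2 A$2$2 = A$1$1"
  by (simp_all add: matrix_matrix_mult_def matrix_vector_mult_def trace_def sum_2 adjugate2_def)

lemma mat_1_2 [simp]:
  "(mat 1 :: int^2^2)$1$1 = 1" "(mat 1 :: int^2^2)$1$2 = 0"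
  "(mat 1 :: int^2^2)$2$1 = 0" "(mat 1 :: int^2^2)$2$2 = 1"
  by (simp_all add: mat_def)

lemma SL2Z_simps [simp]:
  "carrier SL2Z = {A. det A = 1}" "A \<otimes>\<^bsub>SL2Z\<^esub> B = A ** B" "\<one>\<^bsub>SL2Z\<^esub> = mat 1"
  by (simp_all add: SL2Z_def)

interpretation SL2Z: group SL2Z
proof (rule groupI)
  fix A assume A: "A \<in> carrier SL2Z"
  have "adjugate2 A \<in> carrier SL2Z" "adjugate2 A \<otimes>\<^bsub>SL2Z\<^esub> A = \<one>\<^bsub>SL2Z\<^esub>"
    using A by (simp_all add: det_2 vec_eq_iff forall_2 matrix2_simps algebra_simps)
  then show "\<exists>B\<in>carrier SL2Z. B \<otimes>\<^bsub>SL2Z\<^esub> A = \<one>\<^bsub>SL2Z\<^esub>" by blast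
qed (simp_all add: det_mul matrix_mul_assoc det_I)

lemma SL2Z_inv:
  assumes "det A = 1"
  shows "inv\<^bsub>SL2Z\<^esub> A = adjugate2 A"
  by (rule SL2Z.inv_equality)
    (use assms in \<open>simp_all add: det_2 vec_eq_iff forall_2 matrix2_simps algebra_simps\<close>)

lemma det_SL2Z_pow [simp]: "det A = 1 \<Longrightarrow> det (A [^]\<^bsub>SL2Z\<^esub> (n::int)) = 1"
  using SL2Z.int_pow_closed[of A n] by simp

lemma det_SL2Z_nat_pow [simp]: "det A = 1 \<Longrightarrow> det (A [^]\<^bsub>SL2Z\<^esub> (n::nat)) = 1"
  using SL2Z.nat_pow_closed[of A n] by simp

lemma Cayley_Hamilton2:
  fixes A :: "int ^ 2 ^ 2"
  assumes "det A = 1"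
  shows "(A ** A)$i$j = trace A * A$i$j - (mat 1 :: int ^ 2 ^ 2)$i$j"
proof -
  have "\<forall>i j. (A ** A)$i$j = trace A * A$i$j - (mat 1 :: int ^ 2 ^ 2)$i$j"
    using assms by (simp add: forall_2 det_2 matrix2_simps algebra_simps)
  then show ?thesis by blast
qed

lemma trace_mult_square:
  assumes "det A = 1"
  shows "trace (M ** A ** A) = trace A * trace (M ** A) - trace (M :: int ^ 2 ^ 2)"
  unfolding matrix_mul_assoc[symmetric] matrix2_simps(3)[of "M ** _"] matrix2_simps(1)[of M]
    Cayley_Hamilton2[OF assms]
  by (simp add: matrix2_simps algebra_simps)

lemma trace_pow_rec:
  assumes "det A = 1"
  shows "trace (A [^]\<^bsub>SL2Z\<^esub> Suc (Suc n)) = trace A * trace (A [^]\<^bsub>SL2Z\<^esub> Suc n) - trace (A [^]\<^bsub>SL2Z\<^esub> n)"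
  using trace_mult_square[OF assms, of "A [^]\<^bsub>SL2Z\<^esub> n"] by simp

lemma trace_pow_01:
  "trace (A [^]\<^bsub>SL2Z\<^esub> (0::nat)) = 2" "trace (A [^]\<^bsub>SL2Z\<^esub> Suc 0) = trace A"
  by (simp_all add: matrix2_simps)

text \<open>A matrix of determinant one and its inverse have the same trace.\<close>

lemma trace_pow_int:
  assumes "det A = 1"
  shows "trace (A [^]\<^bsub>SL2Z\<^esub> (n::int)) = trace (A [^]\<^bsub>SL2Z\<^esub> nat \<bar>n\<bar>)"
proof (cases "n \<ge> 0")
  case True
  then show ?thesis by (simp flip: int_pow_int)
next
  case False
  define k where "k = nat \<bar>n\<bar>"
  have n: "n = - int k" using False by (simp add: k_def)
  have "A [^]\<^bsub>SL2Z\<^esub> n = inv\<^bsub>SL2Z\<^esub> (A [^]\<^bsub>SL2Z\<^esub> k)"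
    unfolding n using assms by (simp add: SL2Z.int_pow_neg int_pow_int del: SL2Z_simps(2,3))
  then have "A [^]\<^bsub>SL2Z\<^esub> n = adjugate2 (A [^]\<^bsub>SL2Z\<^esub> nat \<bar>n\<bar>)"
    using assms by (simp add: SL2Z_inv k_def del: SL2Z_simps(2,3))
  then show ?thesis by (simp add: matrix2_simps)
qed

text \<open>By Cayley and Hamilton the traces of the powers satisfy a linear recursion, which makes them
  strictly increasing from \<open>tr 1 = 2\<close> on.\<close>

lemma hyperbolic_trace_pow:
  assumes "det B = 1" "trace B > 2" "n \<noteq> (0::int)"
  shows "trace (B [^]\<^bsub>SL2Z\<^esub> n) > 2"
proof -
  have "trace (B [^]\<^bsub>SL2Z\<^esub> k) \<ge> 2 \<and> trace (B [^]\<^bsub>SL2Z\<^esub> Suc k) > trace (B [^]\<^bsub>SL2Z\<^esub> k)" for k :: nat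
  proof (induction k)
    case 0 then show ?case using assms(2) unfolding trace_pow_01 by simp
  next
    case (Suc k)
    let ?x = "trace (B [^]\<^bsub>SL2Z\<^esub> k)" and ?y = "trace (B [^]\<^bsub>SL2Z\<^esub> Suc k)"
    have "2 * ?y \<le> (trace B - 1) * ?y" using assms(2) Suc by (intro mult_right_mono) linarith+
    then have "?y < trace B * ?y - ?x" using Suc by (simp only: left_diff_distrib) linarith
    then show ?case using Suc unfolding trace_pow_rec[OF assms(1)] by linarith
  qed
  note * = this
  obtain k where "nat \<bar>n\<bar> = Suc k" using assms(3) by (cases "nat \<bar>n\<bar>") auto
  then show ?thesis unfolding trace_pow_int[OF assms(1)] using *[of k] by simp
qed

lemma trace_pow_large_root:
  assumes "det B = 1" "trace B > 2"
  shows "real_of_int (trace (B [^]\<^bsub>SL2Z\<^esub> n)) = large_root (trace B) ^ n + inverse (large_root (trace B)) ^ n"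
proof -
  define x where "x = large_root (trace B)"
  have x: "x > 1" "x^2 = trace B * x - 1" unfolding x_def using large_root[OF assms(2)] by simp_all
  have "x * (trace B - x) = 1" using x(2) by (simp add: power2_eq_square algebra_simps)
  then have ix: "inverse x = trace B - x" by (rule inverse_unique)
  have "(inverse x)^2 = inverse x * (trace B - x)" unfolding power2_eq_square ix[symmetric] ..
  then have y: "(inverse x)^2 = trace B * inverse x - 1" using x(1) by (simp add: algebra_simps)
  have rec: "z ^ Suc (Suc n) = trace B * z ^ Suc n - z ^ n" if "z^2 = trace B * z - 1" for z :: real and n
  proof -
    have "z ^ Suc (Suc n) = z ^ n * z^2" by (simp add: power2_eq_square)
    then show ?thesis unfolding that by (simp add: algebra_simps)
  qed
  show ?thesis
    unfolding x_def[symmetric]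
  proof (induction n rule: induct_nat_012)
    case 0 show ?case unfolding trace_pow_01 by simp
  next
    case 1 show ?case unfolding trace_pow_01 using ix by simp
  next
    case (ge2 n)
    then show ?case
      unfolding trace_pow_rec[OF assms(1)] of_int_diff of_int_mult rec[OF x(2)] rec[OF y]
      by (simp add: algebra_simps)
  qed
qed

lemma equal_trace_powers:
  assumes "det A = 1" "trace A > 2" "det B = 1" "trace B > 2"
    and "trace_field (trace A) = trace_field (trace B)"
  obtains n m :: nat where "n > 0" "m > 0" "trace (A [^]\<^bsub>SL2Z\<^esub> n) = trace (B [^]\<^bsub>SL2Z\<^esub> m)"
proof -
  obtain n m :: nat where nm: "n > 0" "m > 0" "large_root (trace A) ^ n = large_root (trace B) ^ m"
    using large_root_common_power[OF assms(2,4,5)] .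
  then have "inverse (large_root (trace A)) ^ n = inverse (large_root (trace B)) ^ m"
    by (simp add: power_inverse)
  then have "real_of_int (trace (A [^]\<^bsub>SL2Z\<^esub> n)) = real_of_int (trace (B [^]\<^bsub>SL2Z\<^esub> m))"
    unfolding trace_pow_large_root[OF assms(1,2)] trace_pow_large_root[OF assms(3,4)] using nm(3) by simp
  then show thesis using that nm(1,2) by simp
qed

lemma pow_affine:
  assumes "det A = 1"
  shows "\<exists>u v. \<forall>i j. (A [^]\<^bsub>SL2Z\<^esub> (n::nat))$i$j = u * A$i$j + v * (mat 1 :: int ^ 2 ^ 2)$i$j"
proof (induction n)
  case 0
  show ?case by (rule exI[of _ 0], rule exI[of _ 1]) simp
next
  case (Suc n)
  then obtain u v where uv: "\<And>i j. (A [^]\<^bsub>SL2Z\<^esub> n)$i$j = u * A$i$j + v * (mat 1 :: int ^ 2 ^ 2)$i$j" by blast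
  have "\<forall>i j. (A [^]\<^bsub>SL2Z\<^esub> Suc n)$i$j = (u * trace A + v) * A$i$j + (- u) * (mat 1 :: int ^ 2 ^ 2)$i$j"
    using assms by (simp add: forall_2 matrix2_simps uv det_2 algebra_simps)
  then show ?case by blast
qed

text \<open>A power of \<open>B\<close> has the form \<open>u B + v\<close>, so the discriminant of its characteristic polynomial is \<open>u\<^sup>2\<close> times that of \<open>B\<close>.\<close>

lemma trace_field_pow:
  assumes B: "det B = 1" "trace B > 2" and n: "n \<noteq> (0::int)"
  shows "trace_field (trace (B [^]\<^bsub>SL2Z\<^esub> n)) = trace_field (trace B)"
proof -
  let ?C = "B [^]\<^bsub>SL2Z\<^esub> nat \<bar>n\<bar>"
  obtain u v where uv: "\<And>i j. ?C$i$j = u * B$i$j + v * (mat 1 :: int ^ 2 ^ 2)$i$j"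
    using pow_affine[OF B(1)] by blast
  \<comment> \<open>In this form the discriminant does not see multiples of the identity.\<close>
  have disc: "(trace A)^2 - 4 = (A$1$1 - A$2$2)^2 + 4 * A$1$2 * A$2$1" if "det A = 1" for A :: "int ^ 2 ^ 2"
    using that by (simp add: det_2 matrix2_simps power2_eq_square algebra_simps)
  have "(trace ?C)^2 - 4 = u^2 * ((trace B)^2 - 4)"
    unfolding disc[OF B(1)] disc[OF det_SL2Z_nat_pow[OF B(1)]] uv
    by (simp add: power2_eq_square algebra_simps)
  moreover have "(trace ?C)^2 - 4 > 0"
    using hyperbolic_trace_pow[OF B n] norm_one_disc_pos unfolding trace_pow_int[OF B(1)] by blast
  ultimately have u: "u \<noteq> 0" and eq: "(trace ?C)^2 - 4 = u^2 * ((trace B)^2 - 4)" by auto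
  show ?thesis
    unfolding trace_field_def trace_pow_int[OF B(1)] eq by (rule rat_span_sqrt_square_mult[OF u])
qed

text \<open>The determinant of \<open>A - 1\<close> is \<open>2 - tr A\<close>.\<close>

lemma fixed_vector_0:
  fixes A :: "int ^ 2 ^ 2"
  assumes "det A = 1" "trace A \<noteq> 2" "A *v x = x"
  shows "x = 0"
proof -
  define a b c d where "a = A$1$1" and "b = A$1$2" and "c = A$2$1" and "d = A$2$2"
  have 1: "a * x$1 + b * x$2 = x$1" and 2: "c * x$1 + d * x$2 = x$2"
    using assms(3) by (simp_all add: vec_eq_iff forall_2 matrix2_simps a_def b_def c_def d_def)
  have det: "a * d - b * c = 1" and t: "a + d \<noteq> 2"
    using assms by (simp_all add: det_2 matrix2_simps a_def b_def c_def d_def)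
  have "(2 - (a + d)) * x$1 = (d - 1) * (a * x$1 + b * x$2 - x$1) - b * (c * x$1 + d * x$2 - x$2) + (1 - (a * d - b * c)) * x$1"
    by (simp add: algebra_simps)
  moreover have "(2 - (a + d)) * x$2 = (a - 1) * (c * x$1 + d * x$2 - x$2) - c * (a * x$1 + b * x$2 - x$1) + (1 - (a * d - b * c)) * x$2"
    by (simp add: algebra_simps)
  ultimately show ?thesis using t unfolding 1 2 det by (simp add: vec_eq_iff forall_2)
qed

lemma eigenvalue_root:
  assumes "det B = 1" "real_eigenvalue B \<mu>"
  shows "\<mu>^2 - real_of_int (trace B) * \<mu> + 1 = 0"
proof -
  define a b c d where "a = real_of_int (B$1$1)" and "b = real_of_int (B$1$2)"
    and "c = real_of_int (B$2$1)" and "d = real_of_int (B$2$2)"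
  obtain v where v: "v \<noteq> 0" "map_matrix real_of_int B *v v = \<mu> *s v"
    using assms(2) by (auto simp: real_eigenvalue_def)
  have 1: "a * v$1 + b * v$2 = \<mu> * v$1" and 2: "c * v$1 + d * v$2 = \<mu> * v$2"
    using v(2) by (simp_all add: vec_eq_iff forall_2 matrix_vector_mult_def sum_2 map_matrix_def
        a_def b_def c_def d_def)
  have "real_of_int (B$1$1 * B$2$2 - B$1$2 * B$2$1) = 1" using assms(1) by (simp add: det_2)
  then have det: "a * d - b * c = 1" by (simp add: a_def b_def c_def d_def)
  let ?p = "\<mu>^2 - (a + d) * \<mu> + 1"
  have "?p * v$1 = (\<mu> - d) * (\<mu> * v$1 - (a * v$1 + b * v$2)) + b * (\<mu> * v$2 - (c * v$1 + d * v$2)) + (1 - (a * d - b * c)) * v$1"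
    by (simp add: algebra_simps power2_eq_square)
  moreover have "?p * v$2 = (\<mu> - a) * (\<mu> * v$2 - (c * v$1 + d * v$2)) + c * (\<mu> * v$1 - (a * v$1 + b * v$2)) + (1 - (a * d - b * c)) * v$2"
    by (simp add: algebra_simps power2_eq_square)
  ultimately have "?p * v$1 = 0" "?p * v$2 = 0" unfolding 1 2 det by simp_all
  then have "?p = 0" using v(1) by (auto simp: vec_eq_iff forall_2)
  then show ?thesis by (simp add: matrix2_simps a_def d_def)
qed

lemma hyperbolic_off_diagonal:
  fixes B :: "int ^ 2 ^ 2"
  assumes "det B = 1" "trace B > 2"
  shows "B$1$2 \<noteq> 0" "B$2$1 \<noteq> 0"
proof -
  have "B$1$2 * B$2$1 \<noteq> 0"
  proof
    assume "B$1$2 * B$2$1 = 0"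
    then have "B$1$1 * B$2$2 = 1" using assms(1) unfolding det_2 by linarith
    then have "(B$1$1 = 1 \<and> B$2$2 = 1) \<or> (B$1$1 = -1 \<and> B$2$2 = -1)" by (simp add: zmult_eq_1_iff)
    then show False using assms(2) by (auto simp: matrix2_simps)
  qed
  then show "B$1$2 \<noteq> 0" "B$2$1 \<noteq> 0" by auto
qed

lemma real_eigenvalue_ex:
  assumes "det B = 1" "trace B > 2"
  shows "real_eigenvalue B (large_root (trace B))"
proof -
  define a b c d where "a = real_of_int (B$1$1)" and "b = real_of_int (B$1$2)"
    and "c = real_of_int (B$2$1)" and "d = real_of_int (B$2$2)"
  define x where "x = large_root (trace B)"
  have "b \<noteq> 0" using hyperbolic_off_diagonal[OF assms] by (simp add: b_def)
  have x: "x^2 = (a + d) * x - 1"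
    unfolding x_def using large_root(2)[OF assms(2)] by (simp add: matrix2_simps a_def d_def)
  have "real_of_int (B$1$1 * B$2$2 - B$1$2 * B$2$1) = 1" using assms(1) by (simp add: det_2)
  then have det: "a * d - b * c = 1" by (simp add: a_def b_def c_def d_def)
  \<comment> \<open>The first row of \<open>B - x\<close> is \<open>(a - x, b)\<close>, and this vector is orthogonal to it.\<close>
  define v :: "real ^ 2" where "v = vector [b, x - a]"
  have "c * b + d * (x - a) = x * (x - a)"
    using x det by (simp add: algebra_simps power2_eq_square)
  then have "map_matrix real_of_int B *v v = x *s v"
    by (simp add: vec_eq_iff forall_2 matrix_vector_mult_def sum_2 map_matrix_def v_def
        flip: a_def b_def c_def d_def) (simp add: algebra_simps)
  moreover have "v \<noteq> 0" using \<open>b \<noteq> 0\<close> by (simp add: vec_eq_iff forall_2 v_def)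
  ultimately show ?thesis unfolding real_eigenvalue_def x_def by blast
qed

lemma hyperbolic_SL2Z_trace_ex:
  assumes "t > 2"
  obtains B where "B \<in> hyperbolic_SL2Z" "trace B = t"
proof
  let ?B = "vector [vector [0, -1], vector [1, t]] :: int ^ 2 ^ 2"
  show "trace ?B = t" by (simp add: matrix2_simps)
  then show "?B \<in> hyperbolic_SL2Z" using assms by (simp add: hyperbolic_SL2Z_def det_2)
qed

section \<open>Semidirect products with the integers\<close>

lemma AutoGroup_simps:
  "carrier (AutoGroup H) = auto H"
  "\<one>\<^bsub>AutoGroup H\<^esub> = (\<lambda>x\<in>carrier H. x)"
  "f \<in> auto H \<Longrightarrow> g \<in> auto H \<Longrightarrow> f \<otimes>\<^bsub>AutoGroup H\<^esub> g = compose (carrier H) f g"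
  by (auto simp: AutoGroup_def BijGroup_def auto_def)

lemma auto_iff:
  "f \<in> auto H \<longleftrightarrow> f \<in> iso H H \<and> f \<in> extensional (carrier H)"
  by (auto simp: auto_def iso_def Bij_def)

locale int_action = group H for H :: "'a monoid" (structure) +
  fixes \<phi> :: "int \<Rightarrow> 'a \<Rightarrow> 'a"
  assumes hom_Auto: "\<phi> \<in> hom integer_group (AutoGroup H)"
begin

lemma action_auto: "\<phi> n \<in> auto H"
  using hom_in_carrier[OF hom_Auto, of n] by (simp add: AutoGroup_simps)

lemma action_hom: "\<phi> n \<in> hom H H"
  using action_auto by (simp add: auto_def)

lemma action_closed [simp]: "x \<in> carrier H \<Longrightarrow> \<phi> n x \<in> carrier H"
  by (rule hom_in_carrier[OF action_hom])

lemma action_add: "x \<in> carrier H \<Longrightarrow> \<phi> (m + n) x = \<phi> m (\<phi> n x)"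
  using hom_mult[OF hom_Auto, of m n] by (simp add: AutoGroup_simps action_auto compose_def)

lemma action_0 [simp]: "x \<in> carrier H \<Longrightarrow> \<phi> 0 x = x"
proof -
  interpret A: group "AutoGroup H" by (rule AutoGroup)
  have "\<phi> 0 = \<one>\<^bsub>AutoGroup H\<^esub>"
    using hom_one[OF hom_Auto] A.is_group by simp
  then show "x \<in> carrier H \<Longrightarrow> \<phi> 0 x = x" by (simp add: AutoGroup_simps)
qed

lemma action_mult: "x \<in> carrier H \<Longrightarrow> y \<in> carrier H \<Longrightarrow> \<phi> n (x \<otimes> y) = \<phi> n x \<otimes> \<phi> n y"
  using action_hom by (simp add: hom_mult)

lemma action_neg [simp]: "x \<in> carrier H \<Longrightarrow> \<phi> (- n) (\<phi> n x) = x"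
  by (simp flip: action_add)

lemma action_neg' [simp]: "x \<in> carrier H \<Longrightarrow> \<phi> n (\<phi> (- n) x) = x"
  by (simp flip: action_add)

abbreviation SD where "SD \<equiv> semidirect_product H integer_group \<phi>"

lemma semidirect_simps:
  "carrier SD = carrier H \<times> UNIV" "\<one>\<^bsub>SD\<^esub> = (\<one>, 0)"
  "(h, m) \<otimes>\<^bsub>SD\<^esub> (k, n) = (h \<otimes> \<phi> m k, m + n)"
  by (simp_all add: semidirect_product_def)

lemma semidirect_group: "group SD"
proof (rule groupI)
  fix x assume "x \<in> carrier SD"
  then obtain h n where x: "x = (h, n)" "h \<in> carrier H" by (auto simp: semidirect_simps)
  show "\<exists>y\<in>carrier SD. y \<otimes>\<^bsub>SD\<^esub> x = \<one>\<^bsub>SD\<^esub>"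
    by (rule bexI[of _ "(inv (\<phi> (- n) h), - n)"]) (simp_all add: x semidirect_simps)
qed (auto simp: semidirect_simps m_assoc action_add action_mult)

end

text \<open>Only the generator of the acting group has to be checked.\<close>

lemma int_actions_intertwine:
  assumes \<phi>: "int_action H \<phi>" and \<psi>: "int_action K \<psi>"
    and \<theta>: "\<theta> \<in> hom H K" and gen: "\<And>x. x \<in> carrier H \<Longrightarrow> \<theta> (\<phi> 1 x) = \<psi> 1 (\<theta> x)"
    and x: "x \<in> carrier H"
  shows "\<theta> (\<phi> n x) = \<psi> n (\<theta> x)"
proof -
  interpret \<phi>: int_action H \<phi> by fact
  interpret \<psi>: int_action K \<psi> by fact
  have cl: "\<theta> y \<in> carrier K" if "y \<in> carrier H" for y using \<theta> that by (rule hom_in_carrier)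
  have nat: "\<theta> (\<phi> (int m) y) = \<psi> (int m) (\<theta> y)" if "y \<in> carrier H" for m y
  proof (induction m)
    case (Suc m)
    then show ?case using that
      by (simp add: \<phi>.action_add[of y 1] \<psi>.action_add[of _ 1] cl gen)
  qed (simp add: that cl)
  show ?thesis
  proof (cases "n \<ge> 0")
    case True
    then show ?thesis using nat[OF x, of "nat n"] by simp
  next
    case False
    then have n: "n = - int (nat (- n))" by simp
    then obtain m where n: "n = - int m" by (rule that)
    have "\<theta> (\<phi> n x) = \<psi> n (\<psi> (int m) (\<theta> (\<phi> n x)))" using x by (simp add: n cl)
    also have "\<dots> = \<psi> n (\<theta> x)" using nat[of "\<phi> n x" m] x by (simp add: n)
    finally show ?thesis .
  qed
qed

lemma semidirect_map:
  assumes \<phi>: "int_action H \<phi>" and \<psi>: "int_action K \<psi>"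
    and \<theta>: "\<theta> \<in> hom H K" and gen: "\<And>x. x \<in> carrier H \<Longrightarrow> \<theta> (\<phi> 1 x) = \<psi> 1 (\<theta> x)"
  shows "map_prod \<theta> id \<in> hom (semidirect_product H integer_group \<phi>) (semidirect_product K integer_group \<psi>)"
    and "inj_on \<theta> (carrier H) \<Longrightarrow> inj_on (map_prod \<theta> id) (carrier (semidirect_product H integer_group \<phi>))"
    and "\<theta> \<in> iso H K \<Longrightarrow>
      map_prod \<theta> id \<in> iso (semidirect_product H integer_group \<phi>) (semidirect_product K integer_group \<psi>)"
proof -
  interpret \<phi>: int_action H \<phi> by fact
  interpret \<psi>: int_action K \<psi> by fact
  note simps = \<phi>.semidirect_simps \<psi>.semidirect_simps
  show hom: "map_prod \<theta> id \<in> hom \<phi>.SD \<psi>.SD"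
    by (rule homI) (auto simp: simps hom_in_carrier[OF \<theta>] hom_mult[OF \<theta>]
        int_actions_intertwine[OF \<phi> \<psi> \<theta> gen])
  show inj: "inj_on (map_prod \<theta> id) (carrier \<phi>.SD)" if "inj_on \<theta> (carrier H)"
    using that by (auto simp: simps inj_on_def)
  show "map_prod \<theta> id \<in> iso \<phi>.SD \<psi>.SD" if "\<theta> \<in> iso H K"
  proof -
    have "map_prod \<theta> id ` carrier \<phi>.SD = carrier \<psi>.SD"
      using that unfolding iso_iff simps by (metis map_prod_surj_on surj_id)
    then show ?thesis using hom inj that by (simp add: iso_iff)
  qed
qed

lemma pow_int_action:
  assumes "group H" "f \<in> auto H"
  shows "int_action H (\<lambda>n::int. f [^]\<^bsub>AutoGroup H\<^esub> n)" and "x \<in> carrier H \<Longrightarrow> (f [^]\<^bsub>AutoGroup H\<^esub> (1::int)) x = f x"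
proof -
  interpret group H by fact
  interpret A: group "AutoGroup H" by (rule AutoGroup)
  have f: "f \<in> carrier (AutoGroup H)" using assms by (simp add: AutoGroup_simps)
  show "int_action H (\<lambda>n::int. f [^]\<^bsub>AutoGroup H\<^esub> n)"
    by (intro int_action.intro int_action_axioms.intro assms A.hom_integer_group_pow f)
  show "(f [^]\<^bsub>AutoGroup H\<^esub> (1::int)) x = f x" using f by simp
qed

section \<open>An integral model\<close>

definition vec_det :: "int ^ 2 \<Rightarrow> int ^ 2 \<Rightarrow> int" where
  "vec_det v w = v$1 * w$2 - v$2 * w$1"

text \<open>In contrast to the coordinates \<open>\<alpha>\<^sup>m \<beta>\<^sup>n \<gamma>\<^sup>k\<close>, the cocycle is alternating here. It is therefore invariant
  under \<open>SL(2, \<int>)\<close>, which can act linearly and without correction terms on the centre.\<close>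

definition heis_model :: "((int ^ 2) \<times> int) monoid" where
  "heis_model = \<lparr>carrier = UNIV, monoid.mult = (\<lambda>(v, z) (w, y). (v + w, z + y + vec_det v w)), one = (0, 0)\<rparr>"

lemma heis_model_simps [simp]:
  "carrier heis_model = UNIV" "\<one>\<^bsub>heis_model\<^esub> = (0, 0)"
  "(v, z) \<otimes>\<^bsub>heis_model\<^esub> (w, y) = (v + w, z + y + vec_det v w)"
  by (simp_all add: heis_model_def)

lemma vec_det_self [simp]: "vec_det v v = 0" "vec_det v (- v) = 0" "vec_det v 0 = 0" "vec_det 0 v = 0" "vec_det (- v) v = 0"
  by (simp_all add: vec_det_def)

lemma vec_det_add: "vec_det (u + v) w = vec_det u w + vec_det v w" "vec_det w (u + v) = vec_det w u + vec_det w v"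
  by (simp_all add: vec_det_def algebra_simps)

lemma vec_det_mult: "vec_det (A *v v) (A *v w) = det A * vec_det v w"
  by (simp add: vec_det_def matrix2_simps det_2 algebra_simps)

interpretation HM: group heis_model
proof (rule groupI)
  fix x :: "(int ^ 2) \<times> int"
  obtain v z where x: "x = (v, z)" by force
  show "\<exists>y\<in>carrier heis_model. y \<otimes>\<^bsub>heis_model\<^esub> x = \<one>\<^bsub>heis_model\<^esub>"
    by (rule bexI[of _ "(- v, - z)"]) (simp_all add: x)
qed (auto simp: vec_det_add)

lemma heis_model_int_pow: "(v, z) [^]\<^bsub>heis_model\<^esub> (k::int) = (k *s v, k * z)"
proof -
  have nat: "(v, z) [^]\<^bsub>heis_model\<^esub> (k::nat) = (int k *s v, int k * z)" for k
    by (induction k) (simp_all add: vec_eq_iff vec_det_def algebra_simps)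
  show ?thesis
  proof (cases "k \<ge> 0")
    case True
    then show ?thesis using nat[of "nat k"] by (simp flip: int_pow_int)
  next
    case False
    define m where "m = nat (- k)"
    have k: "k = - int m" using False by (simp add: m_def)
    have "(v, z) [^]\<^bsub>heis_model\<^esub> k = inv\<^bsub>heis_model\<^esub> (int m *s v, int m * z)"
      by (simp add: k HM.int_pow_neg int_pow_int nat)
    also have "\<dots> = (k *s v, k * z)"
      by (rule HM.inv_equality) (simp_all add: k vec_eq_iff vec_det_def)
    finally show ?thesis .
  qed
qed

definition osc_action :: "int ^ 2 ^ 2 \<Rightarrow> int \<Rightarrow> (int ^ 2) \<times> int \<Rightarrow> (int ^ 2) \<times> int" where
  "osc_action B n = (\<lambda>(v, z). ((B [^]\<^bsub>SL2Z\<^esub> n) *v v, z))"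

lemma osc_action_1: "osc_action B 1 (v, z) = (B *v v, z)"
  by (simp add: osc_action_def matrix_mul_lid int_pow_def nat_pow_def)

lemma osc_action:
  assumes "det B = 1"
  shows "int_action heis_model (osc_action B)"
proof (intro int_action.intro int_action_axioms.intro HM.is_group homI)
  have comp: "osc_action B m (osc_action B n x) = osc_action B (m + n) x" for m n x
    using assms by (cases x) (simp add: osc_action_def matrix_vector_mul_assoc flip: SL2Z.int_pow_mult[of B m n, simplified])
  have id: "osc_action B 0 x = x" for x by (cases x) (simp add: osc_action_def)
  have "bij (osc_action B n)" for n
    by (rule o_bij[of "osc_action B (- n)"]) (simp_all add: fun_eq_iff comp id)
  then show auto: "osc_action B n \<in> carrier (AutoGroup heis_model)" for n
    using assms by (auto simp: AutoGroup_simps auto_iff iso_def hom_def osc_action_def matrix_vector_right_distrib vec_det_mult)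
  show "osc_action B (m \<otimes>\<^bsub>integer_group\<^esub> n) = osc_action B m \<otimes>\<^bsub>AutoGroup heis_model\<^esub> osc_action B n" for m n
    using auto by (simp add: AutoGroup_simps compose_def comp fun_eq_iff)
qed

definition osc_model :: "int ^ 2 ^ 2 \<Rightarrow> (((int ^ 2) \<times> int) \<times> int) monoid" where
  "osc_model B = semidirect_product heis_model integer_group (osc_action B)"

lemma osc_model_simps [simp]:
  "carrier (osc_model B) = UNIV" "\<one>\<^bsub>osc_model B\<^esub> = ((0, 0), 0)"
  "((v, z), n) \<otimes>\<^bsub>osc_model B\<^esub> ((w, y), m) =
    ((v + (B [^]\<^bsub>SL2Z\<^esub> n) *v w, z + y + vec_det v ((B [^]\<^bsub>SL2Z\<^esub> n) *v w)), n + m)"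
  by (simp_all add: osc_model_def semidirect_product_def osc_action_def)

lemma osc_model_group: "det B = 1 \<Longrightarrow> group (osc_model B)"
  unfolding osc_model_def by (rule int_action.semidirect_group[OF osc_action])

section \<open>Embeddings with image of finite index\<close>

text \<open>The finite index of the image is expressed by finitely many left coset representatives, which is
  easy to verify for explicit groups and visibly transitive.\<close>

definition virtually_embeds :: "'a monoid \<Rightarrow> 'b monoid \<Rightarrow> bool" where
  "virtually_embeds K G \<longleftrightarrow> (\<exists>j\<in>hom K G. inj_on j (carrier K) \<and>
    (\<exists>Q. finite Q \<and> Q \<subseteq> carrier G \<and> (\<forall>g\<in>carrier G. \<exists>x\<in>Q. \<exists>k\<in>carrier K. g = x \<otimes>\<^bsub>G\<^esub> j k)))"

lemma virtually_embedsI: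
  assumes "j \<in> hom K G" "inj_on j (carrier K)" "finite Q" "Q \<subseteq> carrier G"
    "\<And>g. g \<in> carrier G \<Longrightarrow> \<exists>x\<in>Q. \<exists>k\<in>carrier K. g = x \<otimes>\<^bsub>G\<^esub> j k"
  shows "virtually_embeds K G"
  using assms unfolding virtually_embeds_def by blast

lemma virtually_embeds_trans:
  assumes "group G\<^sub>3" "virtually_embeds G\<^sub>1 G\<^sub>2" "virtually_embeds G\<^sub>2 G\<^sub>3"
  shows "virtually_embeds G\<^sub>1 G\<^sub>3"
proof -
  interpret G3: group G\<^sub>3 by fact
  obtain i Q where i: "i \<in> hom G\<^sub>1 G\<^sub>2" "inj_on i (carrier G\<^sub>1)" "finite Q" "Q \<subseteq> carrier G\<^sub>2"
    "\<And>g. g \<in> carrier G\<^sub>2 \<Longrightarrow> \<exists>x\<in>Q. \<exists>k\<in>carrier G\<^sub>1. g = x \<otimes>\<^bsub>G\<^sub>2\<^esub> i k"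
    using assms(2) unfolding virtually_embeds_def by blast
  obtain j Y where j: "j \<in> hom G\<^sub>2 G\<^sub>3" "inj_on j (carrier G\<^sub>2)" "finite Y" "Y \<subseteq> carrier G\<^sub>3"
    "\<And>g. g \<in> carrier G\<^sub>3 \<Longrightarrow> \<exists>y\<in>Y. \<exists>k\<in>carrier G\<^sub>2. g = y \<otimes>\<^bsub>G\<^sub>3\<^esub> j k"
    using assms(3) unfolding virtually_embeds_def by blast
  show ?thesis
  proof (rule virtually_embedsI)
    show "j \<circ> i \<in> hom G\<^sub>1 G\<^sub>3" using i(1) j(1) by (rule hom_compose)
    show "inj_on (j \<circ> i) (carrier G\<^sub>1)"
      using i(2) inj_on_subset[OF j(2) hom_carrier[OF i(1)]] by (rule comp_inj_on)
    show "finite ((\<lambda>(y, x). y \<otimes>\<^bsub>G\<^sub>3\<^esub> j x) ` (Y \<times> Q))" using i(3) j(3) by simp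
    show "(\<lambda>(y, x). y \<otimes>\<^bsub>G\<^sub>3\<^esub> j x) ` (Y \<times> Q) \<subseteq> carrier G\<^sub>3"
      using i(4) j(4) hom_in_carrier[OF j(1)] by auto
    fix g assume "g \<in> carrier G\<^sub>3"
    then obtain y k where y: "y \<in> Y" "k \<in> carrier G\<^sub>2" "g = y \<otimes>\<^bsub>G\<^sub>3\<^esub> j k" using j(5) by blast
    then obtain x k' where x: "x \<in> Q" "k' \<in> carrier G\<^sub>1" "k = x \<otimes>\<^bsub>G\<^sub>2\<^esub> i k'" using i(5) by blast
    have "j k = j x \<otimes>\<^bsub>G\<^sub>3\<^esub> j (i k')"
      unfolding x(3) using x(1,2) i(4) hom_in_carrier[OF i(1)] by (intro hom_mult[OF j(1)]) auto
    then have g: "g = (y \<otimes>\<^bsub>G\<^sub>3\<^esub> j x) \<otimes>\<^bsub>G\<^sub>3\<^esub> (j \<circ> i) k'"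
      using x y i(4) j(4) hom_in_carrier[OF i(1)] hom_in_carrier[OF j(1)]
      by (subst y(3)) (simp add: subset_iff G3.m_assoc)
    show "\<exists>z\<in>(\<lambda>(y, x). y \<otimes>\<^bsub>G\<^sub>3\<^esub> j x) ` (Y \<times> Q). \<exists>k\<in>carrier G\<^sub>1. g = z \<otimes>\<^bsub>G\<^sub>3\<^esub> (j \<circ> i) k"
      by (rule bexI[of _ "y \<otimes>\<^bsub>G\<^sub>3\<^esub> j x"], rule bexI[of _ k']) (use x y g in auto)
  qed
qed

lemma virtually_embeds_iso:
  assumes "group G" "virtually_embeds K G" "G \<cong> G'"
  shows "virtually_embeds K G'"
proof -
  obtain j Q where j: "j \<in> hom K G" "inj_on j (carrier K)" "finite Q" "Q \<subseteq> carrier G"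
    "\<And>g. g \<in> carrier G \<Longrightarrow> \<exists>x\<in>Q. \<exists>k\<in>carrier K. g = x \<otimes>\<^bsub>G\<^esub> j k"
    using assms(2) unfolding virtually_embeds_def by blast
  obtain h where h: "h \<in> hom G G'" "h ` carrier G = carrier G'" "inj_on h (carrier G)"
    using assms(3) by (auto simp: is_iso_def iso_iff)
  show ?thesis
  proof (rule virtually_embedsI)
    show "h \<circ> j \<in> hom K G'" using j(1) h(1) by (rule hom_compose)
    show "inj_on (h \<circ> j) (carrier K)"
      using j(2) inj_on_subset[OF h(3) hom_carrier[OF j(1)]] by (rule comp_inj_on)
    show "finite (h ` Q)" using j(3) by simp
    show "h ` Q \<subseteq> carrier G'" using j(4) h(2) by blast
    fix g assume "g \<in> carrier G'"
    then obtain g0 where g0: "g0 \<in> carrier G" "g = h g0" using h(2) by blast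
    then obtain x k where x: "x \<in> Q" "k \<in> carrier K" "g0 = x \<otimes>\<^bsub>G\<^esub> j k" using j(5) by blast
    have "g = h x \<otimes>\<^bsub>G'\<^esub> (h \<circ> j) k"
      unfolding g0(2) x(3) o_apply using x j(4) hom_in_carrier[OF j(1)] by (intro hom_mult[OF h(1)]) auto
    then show "\<exists>x\<in>h ` Q. \<exists>k\<in>carrier K. g = x \<otimes>\<^bsub>G'\<^esub> (h \<circ> j) k" using x by blast
  qed
qed

text \<open>A subgroup of finite index in \<open>S\<close> that lies inside the image of \<open>G\<close> has finite index in \<open>G\<close> as well.\<close>

lemma virtually_embeds_through:
  assumes "group K" "group G" "group S" and \<iota>: "\<iota> \<in> hom G S" "inj_on \<iota> (carrier G)"
    and j: "j \<in> hom K S" "inj_on j (carrier K)" "finite Q" "Q \<subseteq> carrier S"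
      "\<And>g. g \<in> carrier S \<Longrightarrow> \<exists>x\<in>Q. \<exists>k\<in>carrier K. g = x \<otimes>\<^bsub>S\<^esub> j k"
    and sub: "j ` carrier K \<subseteq> \<iota> ` carrier G"
  shows "virtually_embeds K G"
proof -
  interpret K: group K by fact
  interpret G: group G by fact
  interpret S: group S by fact
  interpret \<iota>: group_hom G S \<iota> by unfold_locales (rule \<iota>(1))
  let ?r = "inv_into (carrier G) \<iota>"
  have r: "?r (\<iota> g) = g" if "g \<in> carrier G" for g using \<iota>(2) that by (rule inv_into_f_f)
  have ex: "\<exists>g\<in>carrier G. j k = \<iota> g" if "k \<in> carrier K" for k using sub that by blast
  show ?thesis
  proof (rule virtually_embedsI)
    show "?r \<circ> j \<in> hom K G"
    proof (rule homI)
      fix k assume k: "k \<in> carrier K"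
      then show "(?r \<circ> j) k \<in> carrier G" using ex[OF k] r by auto
      fix l assume l: "l \<in> carrier K"
      obtain g h where g: "g \<in> carrier G" "j k = \<iota> g" and h: "h \<in> carrier G" "j l = \<iota> h"
        using ex k l by blast
      have "j (k \<otimes>\<^bsub>K\<^esub> l) = \<iota> (g \<otimes>\<^bsub>G\<^esub> h)" using g h hom_mult[OF j(1) k l] by simp
      then show "(?r \<circ> j) (k \<otimes>\<^bsub>K\<^esub> l) = (?r \<circ> j) k \<otimes>\<^bsub>G\<^esub> (?r \<circ> j) l" 
        unfolding o_apply g(2) h(2) by (simp only: r g(1) h(1) G.m_closed)
    qed
    show "inj_on (?r \<circ> j) (carrier K)"
      using j(2) inj_on_inv_into[OF sub] by (rule comp_inj_on)
    show "finite (?r ` (Q \<inter> \<iota> ` carrier G))" using j(3) by simp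
    show "?r ` (Q \<inter> \<iota> ` carrier G) \<subseteq> carrier G" by (auto simp: r)
    fix g assume g: "g \<in> carrier G"
    then obtain x k where x: "x \<in> Q" "k \<in> carrier K" "\<iota> g = x \<otimes>\<^bsub>S\<^esub> j k" using j(5)[of "\<iota> g"] by auto
    obtain h where h: "h \<in> carrier G" "j k = \<iota> h" using ex[OF x(2)] by blast
    have xS: "x \<in> carrier S" using x(1) j(4) by blast
    have "\<iota> (g \<otimes>\<^bsub>G\<^esub> inv\<^bsub>G\<^esub> h) = x"
      using g h x(3) xS by (simp add: S.m_assoc)
    note e = this
    have gh: "g \<otimes>\<^bsub>G\<^esub> inv\<^bsub>G\<^esub> h \<in> carrier G" using g h by simp
    have im: "x \<in> \<iota> ` carrier G" unfolding e[symmetric] using gh by (rule imageI)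
    have "?r x = g \<otimes>\<^bsub>G\<^esub> inv\<^bsub>G\<^esub> h" unfolding e[symmetric] by (rule r[OF gh])
    then have "g = ?r x \<otimes>\<^bsub>G\<^esub> (?r \<circ> j) k" using g h by (simp add: r G.m_assoc)
    then show "\<exists>x\<in>?r ` (Q \<inter> \<iota> ` carrier G). \<exists>k\<in>carrier K. g = x \<otimes>\<^bsub>G\<^esub> (?r \<circ> j) k"
      using x im by blast
  qed
qed

text \<open>Inversion turns the left cosets into right cosets.\<close>

lemma virtually_embeds_finite_index:
  assumes "group K" "group G" "virtually_embeds K G"
  obtains H where "subgroup H G" "finite (rcosets\<^bsub>G\<^esub> H)" "K \<cong> G\<lparr>carrier := H\<rparr>"
proof -
  interpret K: group K by fact
  interpret G: group G by fact
  obtain j Q where j: "j \<in> hom K G" "inj_on j (carrier K)" "finite Q" "Q \<subseteq> carrier G"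
    "\<And>g. g \<in> carrier G \<Longrightarrow> \<exists>x\<in>Q. \<exists>k\<in>carrier K. g = x \<otimes>\<^bsub>G\<^esub> j k"
    using assms(3) unfolding virtually_embeds_def by blast
  interpret j: group_hom K G j by unfold_locales (rule j(1))
  let ?H = "j ` carrier K"
  have sub: "subgroup ?H G" by (rule j.img_is_subgroup)
  have "rcosets\<^bsub>G\<^esub> ?H \<subseteq> (\<lambda>x. ?H #>\<^bsub>G\<^esub> inv\<^bsub>G\<^esub> x) ` Q"
  proof
    fix C assume "C \<in> rcosets\<^bsub>G\<^esub> ?H"
    then obtain g where g: "g \<in> carrier G" "C = ?H #>\<^bsub>G\<^esub> g" by (auto simp: RCOSETS_def)
    obtain x k where x: "x \<in> Q" "k \<in> carrier K" "inv\<^bsub>G\<^esub> g = x \<otimes>\<^bsub>G\<^esub> j k"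
      using j(5)[of "inv\<^bsub>G\<^esub> g"] g(1) by auto
    have xG: "x \<in> carrier G" using x(1) j(4) by blast
    have "g = inv\<^bsub>G\<^esub> (x \<otimes>\<^bsub>G\<^esub> j k)" using g(1) x(3) by (metis G.inv_inv)
    then have "g = j (inv\<^bsub>K\<^esub> k) \<otimes>\<^bsub>G\<^esub> inv\<^bsub>G\<^esub> x" using xG x(2) by (simp add: G.inv_mult_group)
    moreover have "?H #>\<^bsub>G\<^esub> (j (inv\<^bsub>K\<^esub> k) \<otimes>\<^bsub>G\<^esub> inv\<^bsub>G\<^esub> x) = ?H #>\<^bsub>G\<^esub> inv\<^bsub>G\<^esub> x"
    proof -
      have h: "j (inv\<^bsub>K\<^esub> k) \<in> ?H" using x(2) by blast
      then have hG: "j (inv\<^bsub>K\<^esub> k) \<in> carrier G" using subgroup.subset[OF sub] by blast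
      have "?H #>\<^bsub>G\<^esub> j (inv\<^bsub>K\<^esub> k) = ?H" by (rule G.coset_join2[OF hG sub h])
      then show ?thesis
        using G.coset_mult_assoc[OF subgroup.subset[OF sub] hG G.inv_closed[OF xG]] by simp
    qed
    ultimately have "C = ?H #>\<^bsub>G\<^esub> inv\<^bsub>G\<^esub> x" using g(2) by simp
    then show "C \<in> (\<lambda>x. ?H #>\<^bsub>G\<^esub> inv\<^bsub>G\<^esub> x) ` Q" using x(1) by blast
  qed
  then have "finite (rcosets\<^bsub>G\<^esub> ?H)" using j(3) by (simp add: finite_subset)
  moreover have "j \<in> iso K (G\<lparr>carrier := ?H\<rparr>)"
    using j(1,2) by (auto simp: iso_iff hom_def)
  ultimately show thesis using that sub by (blast intro: is_isoI)
qed

lemma common_virtual_subgroup_commensurable: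
  assumes "group K" "group G" "group G'" "virtually_embeds K G" "virtually_embeds K G'"
  shows "abstractly_commensurable G G'"
proof -
  interpret K: group K by fact
  obtain H where H: "subgroup H G" "finite (rcosets\<^bsub>G\<^esub> H)" "K \<cong> G\<lparr>carrier := H\<rparr>"
    using virtually_embeds_finite_index assms by blast
  obtain H' where H': "subgroup H' G'" "finite (rcosets\<^bsub>G'\<^esub> H')" "K \<cong> G'\<lparr>carrier := H'\<rparr>"
    using virtually_embeds_finite_index assms by blast
  have "G\<lparr>carrier := H\<rparr> \<cong> G'\<lparr>carrier := H'\<rparr>" using K.iso_sym[OF H(3)] H'(3) by (rule iso_trans)
  then show ?thesis unfolding abstractly_commensurable_def using H H' by blast
qed

text \<open>Two powers of \<open>g\<close> lie in the same coset; their quotient is in \<open>H\<close>.\<close>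

lemma finite_index_power:
  assumes "group G" "subgroup H G" "finite (rcosets\<^bsub>G\<^esub> H)" "g \<in> carrier G"
  obtains n :: nat where "n > 0" "g [^]\<^bsub>G\<^esub> n \<in> H"
proof -
  interpret group G by fact
  define f where "f = (\<lambda>n::nat. H #>\<^bsub>G\<^esub> g [^]\<^bsub>G\<^esub> n)"
  have "range f \<subseteq> rcosets\<^bsub>G\<^esub> H" using assms(4) by (auto simp: f_def RCOSETS_def)
  then have "finite (range f)" using assms(3) by (rule finite_subset)
  then have "\<not> inj f" using finite_imageD infinite_UNIV_nat by blast
  then obtain i j where "i \<noteq> j" "f i = f j" by (auto simp: inj_def)
  then obtain i j where ij: "i < j" "f i = f j" by (metis linorder_neqE_nat)
  have "g [^]\<^bsub>G\<^esub> j \<in> H #>\<^bsub>G\<^esub> g [^]\<^bsub>G\<^esub> i"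
    using rcos_self[of "g [^]\<^bsub>G\<^esub> j" H] assms ij(2) by (simp add: f_def)
  then obtain h where h: "h \<in> H" "g [^]\<^bsub>G\<^esub> j = h \<otimes>\<^bsub>G\<^esub> g [^]\<^bsub>G\<^esub> i" by (auto simp: r_coset_def)
  have "g [^]\<^bsub>G\<^esub> j = g [^]\<^bsub>G\<^esub> (j - i) \<otimes>\<^bsub>G\<^esub> g [^]\<^bsub>G\<^esub> i"
    using ij(1) assms(4) by (simp add: nat_pow_mult)
  then have "h = g [^]\<^bsub>G\<^esub> (j - i)" using h assms(4) subgroup.subset[OF assms(2)] by (auto simp: subset_iff)
  then show thesis using that[of "j - i"] h(1) ij(1) by simp
qed

section \<open>A commensurability invariant\<close>

text \<open>Modulo the centre, and written additively, the condition says that conjugation by \<open>d\<close> satisfies \<open>x\<^sup>2 - t x + 1 = 0\<close> on \<open>a\<close>.\<close>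

definition twist_traces :: "'a monoid \<Rightarrow> int set" where
  "twist_traces G = {t. t > 2 \<and> (\<exists>a\<in>carrier G. \<exists>d\<in>carrier G. a \<notin> center G \<and>
     (let b = d \<otimes>\<^bsub>G\<^esub> a \<otimes>\<^bsub>G\<^esub> inv\<^bsub>G\<^esub> d
      in d \<otimes>\<^bsub>G\<^esub> b \<otimes>\<^bsub>G\<^esub> inv\<^bsub>G\<^esub> d \<otimes>\<^bsub>G\<^esub> b [^]\<^bsub>G\<^esub> (- t) \<otimes>\<^bsub>G\<^esub> a \<in> center G))}"

lemma center_iso:
  assumes "group G" "h \<in> iso G K" "a \<in> carrier G"
  shows "h a \<in> center K \<longleftrightarrow> a \<in> center G"
proof -
  interpret G: group G by fact
  have h: "h \<in> hom G K" "h ` carrier G = carrier K" "inj_on h (carrier G)" using assms(2) by (auto simp: iso_iff)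
  have "h a \<otimes>\<^bsub>K\<^esub> h x = h x \<otimes>\<^bsub>K\<^esub> h a \<longleftrightarrow> a \<otimes>\<^bsub>G\<^esub> x = x \<otimes>\<^bsub>G\<^esub> a" if "x \<in> carrier G" for x
    using that assms(3) inj_on_eq_iff[OF h(3), of "a \<otimes>\<^bsub>G\<^esub> x" "x \<otimes>\<^bsub>G\<^esub> a"]
    by (simp add: hom_mult[OF h(1)])
  then show ?thesis using assms(3) by (auto simp: center_def h(2)[symmetric])
qed

lemma twist_traces_iso:
  assumes G: "group G" and K: "group K" and h: "h \<in> iso G K"
  shows "twist_traces G \<subseteq> twist_traces K"
proof
  fix t assume "t \<in> twist_traces G"
  then obtain a d where ad: "t > 2" "a \<in> carrier G" "d \<in> carrier G" "a \<notin> center G"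
    "d \<otimes>\<^bsub>G\<^esub> (d \<otimes>\<^bsub>G\<^esub> a \<otimes>\<^bsub>G\<^esub> inv\<^bsub>G\<^esub> d) \<otimes>\<^bsub>G\<^esub> inv\<^bsub>G\<^esub> d \<otimes>\<^bsub>G\<^esub> (d \<otimes>\<^bsub>G\<^esub> a \<otimes>\<^bsub>G\<^esub> inv\<^bsub>G\<^esub> d) [^]\<^bsub>G\<^esub> (- t) \<otimes>\<^bsub>G\<^esub> a \<in> center G"
    (is "?c \<in> _")
    by (auto simp: twist_traces_def Let_def)
  interpret G: group G by fact
  interpret h: group_hom G K h
    using G K h by (simp add: group_hom_def group_hom_axioms_def iso_imp_homomorphism)
  have "?c \<in> carrier G" using ad by simp
  then have "h ?c \<in> center K" using center_iso[OF G h] ad(5) by blast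
  then have "h d \<otimes>\<^bsub>K\<^esub> (h d \<otimes>\<^bsub>K\<^esub> h a \<otimes>\<^bsub>K\<^esub> inv\<^bsub>K\<^esub> h d) \<otimes>\<^bsub>K\<^esub> inv\<^bsub>K\<^esub> h d \<otimes>\<^bsub>K\<^esub>
      (h d \<otimes>\<^bsub>K\<^esub> h a \<otimes>\<^bsub>K\<^esub> inv\<^bsub>K\<^esub> h d) [^]\<^bsub>K\<^esub> (- t) \<otimes>\<^bsub>K\<^esub> h a \<in> center K"
    using ad(2,3) by (simp add: h.hom_int_pow)
  then show "t \<in> twist_traces K"
    using ad(1) h.hom_closed[OF ad(2)] h.hom_closed[OF ad(3)] ad(4)[folded center_iso[OF G h ad(2)]]
    unfolding twist_traces_def Let_def mem_Collect_eq
    by (intro conjI bexI[of _ "h a"] bexI[of _ "h d"])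
qed

context
  fixes B :: "int ^ 2 ^ 2"
  assumes det: "det B = 1" and tr: "trace B > 2"
begin

interpretation S: group "osc_model B" by (rule osc_model_group[OF det])

lemma snd_hom: "snd \<in> hom (osc_model B) integer_group"
  by (rule homI) (auto split: prod.splits)

text \<open>Only the component in \<open>\<int>\<^sup>2\<close> matters; the central one is left implicit.\<close>

lemma osc_model_conj:
  "\<exists>z'. ((w, y), m) \<otimes>\<^bsub>osc_model B\<^esub> ((v, z), 0) \<otimes>\<^bsub>osc_model B\<^esub> inv\<^bsub>osc_model B\<^esub> ((w, y), m)
    = (((B [^]\<^bsub>SL2Z\<^esub> m) *v v, z'), 0)"
proof -
  let ?d = "((w, y), m)" and ?a = "((v, z), 0 :: int)"
  obtain bv bz bn where b: "?d \<otimes>\<^bsub>osc_model B\<^esub> ?a \<otimes>\<^bsub>osc_model B\<^esub> inv\<^bsub>osc_model B\<^esub> ?d = ((bv, bz), bn)"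
    by (metis prod.exhaust)
  then have "((bv, bz), bn) \<otimes>\<^bsub>osc_model B\<^esub> ?d = ?d \<otimes>\<^bsub>osc_model B\<^esub> ?a"
    using S.inv_solve_right'[of "((bv, bz), bn)" "?d \<otimes>\<^bsub>osc_model B\<^esub> ?a" ?d] by (simp del: osc_model_simps(3))
  then have eq: "bn + m = m + 0" "bv + (B [^]\<^bsub>SL2Z\<^esub> bn) *v w = w + (B [^]\<^bsub>SL2Z\<^esub> m) *v v"
    by (simp_all only: osc_model_simps(3) prod.inject)
  have "bn = 0" using eq(1) by simp
  moreover have "bv = (B [^]\<^bsub>SL2Z\<^esub> m) *v v" using eq(2) unfolding \<open>bn = 0\<close> by simp
  ultimately have "bn = 0" "bv = (B [^]\<^bsub>SL2Z\<^esub> m) *v v" by blast+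
  then show ?thesis unfolding b by simp
qed

lemma osc_model_int_pow: "((v, z), 0) [^]\<^bsub>osc_model B\<^esub> (k::int) = ((k *s v, k * z), 0)"
proof -
  have "(\<lambda>x. (x, 0)) \<in> hom heis_model (osc_model B)" by (rule homI) auto
  then interpret e: group_hom heis_model "osc_model B" "\<lambda>x. (x, 0)" by unfold_locales
  show ?thesis using e.hom_int_pow[of "(v, z)" k] by (simp add: heis_model_int_pow)
qed

lemma power_fixed_vector_0:
  assumes "n \<noteq> 0" "(B [^]\<^bsub>SL2Z\<^esub> (n::int)) *v x = x"
  shows "x = 0"
  using fixed_vector_0[OF _ _ assms(2)] hyperbolic_trace_pow[OF det tr assms(1)] det by simp

text \<open>A subgroup of finite index contains a nontrivial power of the generator of the acting group and an
  element of the Heisenberg part outside its centre. All that follows holds for any subgroup with these two elements.\<close>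

context
  fixes \<Gamma> :: "(((int ^ 2) \<times> int) \<times> int) set" and k :: int and u :: "int ^ 2" and y :: int
  assumes \<Gamma>: "subgroup \<Gamma> (osc_model B)" and k: "k \<noteq> 0" "((0, 0), k) \<in> \<Gamma>" and u: "u \<noteq> 0" "((u, y), 0) \<in> \<Gamma>"
begin

private abbreviation (input) "GG \<equiv> osc_model B\<lparr>carrier := \<Gamma>\<rparr>"

text \<open>Commuting with \<open>((0, 0), k)\<close> means that \<open>v\<close> is fixed by \<open>B\<^sup>k\<close>, hence zero; commuting with
  \<open>((u, y), 0)\<close> means that \<open>u\<close> is fixed by \<open>B\<^sup>n\<close>, hence \<open>n = 0\<close>.\<close>

lemma center_subgroup_model: "c \<in> center GG \<longleftrightarrow> c \<in> \<Gamma> \<and> fst (fst c) = 0 \<and> snd c = 0"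
proof
  assume c: "c \<in> center GG"
  obtain v z n where c_eq: "c = ((v, z), n)" by (metis prod.exhaust)
  have comm: "c \<otimes>\<^bsub>osc_model B\<^esub> x = x \<otimes>\<^bsub>osc_model B\<^esub> c" if "x \<in> \<Gamma>" for x
    using c that by (auto simp: center_def)
  have "v = (B [^]\<^bsub>SL2Z\<^esub> k) *v v" using comm[OF k(2)] by (simp add: c_eq)
  then have v: "v = 0" using power_fixed_vector_0[OF k(1)] by metis
  have "(B [^]\<^bsub>SL2Z\<^esub> n) *v u = u" using comm[OF u(2)] by (simp add: c_eq v)
  then have "n = 0" using power_fixed_vector_0 u(1) by blast
  then show "c \<in> \<Gamma> \<and> fst (fst c) = 0 \<and> snd c = 0" using c v by (simp add: c_eq center_def)
next
  assume c: "c \<in> \<Gamma> \<and> fst (fst c) = 0 \<and> snd c = 0"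
  then show "c \<in> center GG" by (cases c) (auto simp: center_def)
qed

lemma twist_simps:
  assumes "d \<in> \<Gamma>"
  shows "inv\<^bsub>GG\<^esub> d = inv\<^bsub>osc_model B\<^esub> d" "d [^]\<^bsub>GG\<^esub> (m::int) = d [^]\<^bsub>osc_model B\<^esub> m"
  using S.m_inv_consistent[OF \<Gamma> assms] S.int_pow_consistent[OF \<Gamma> assms] by simp_all

text \<open>With \<open>M\<close> the action of \<open>d\<close> and \<open>v\<close> the vector of \<open>a\<close>, the vector of \<open>c\<close> is \<open>M\<^sup>2 v - t M v + v\<close>, which
  Cayley and Hamilton turn into \<open>(tr M - t) M v\<close>.\<close>

lemma twist_element:
  fixes t :: int
  assumes "d \<in> \<Gamma>" "a \<in> \<Gamma>"
  defines "b \<equiv> d \<otimes>\<^bsub>GG\<^esub> a \<otimes>\<^bsub>GG\<^esub> inv\<^bsub>GG\<^esub> d"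
  defines "c \<equiv> d \<otimes>\<^bsub>GG\<^esub> b \<otimes>\<^bsub>GG\<^esub> inv\<^bsub>GG\<^esub> d \<otimes>\<^bsub>GG\<^esub> b [^]\<^bsub>GG\<^esub> (- t) \<otimes>\<^bsub>GG\<^esub> a"
  shows "c \<in> \<Gamma>" "snd c = (2 - t) * snd a"
    and "snd a = 0 \<Longrightarrow> fst (fst c) = (trace (B [^]\<^bsub>SL2Z\<^esub> snd d) - t) *s ((B [^]\<^bsub>SL2Z\<^esub> snd d) *v fst (fst a))"
proof -
  interpret G: group GG by (rule subgroup.subgroup_is_group[OF \<Gamma> S.is_group])
  have b\<Gamma>: "b \<in> \<Gamma>" using assms G.m_closed G.inv_closed by (simp add: b_def)
  show "c \<in> \<Gamma>" using G.int_pow_closed[of b "- t"] G.m_closed G.inv_closed assms(1,2) b\<Gamma> by (simp add: c_def)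
  have b: "b = d \<otimes>\<^bsub>osc_model B\<^esub> a \<otimes>\<^bsub>osc_model B\<^esub> inv\<^bsub>osc_model B\<^esub> d"
    using twist_simps[OF assms(1)] by (simp add: b_def)
  have c: "c = d \<otimes>\<^bsub>osc_model B\<^esub> b \<otimes>\<^bsub>osc_model B\<^esub> inv\<^bsub>osc_model B\<^esub> d \<otimes>\<^bsub>osc_model B\<^esub> b [^]\<^bsub>osc_model B\<^esub> (- t) \<otimes>\<^bsub>osc_model B\<^esub> a"
    using twist_simps[OF assms(1)] twist_simps[OF b\<Gamma>] by (simp add: c_def)
  interpret s: group_hom "osc_model B" integer_group snd
    by (simp add: group_hom_def group_hom_axioms_def S.is_group snd_hom)
  have sb: "snd b = snd a" unfolding b by (simp del: osc_model_simps(3))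
  show "snd c = (2 - t) * snd a"
    unfolding c using sb by (simp add: s.hom_int_pow algebra_simps del: osc_model_simps(3))
  assume a0: "snd a = 0"
  let ?M = "B [^]\<^bsub>SL2Z\<^esub> snd d"
  have detM: "det ?M = 1" using det by simp
  obtain v z where a: "a = ((v, z), 0)" using a0 by (metis prod.collapse)
  obtain w y' m where d: "d = ((w, y'), m)" by (metis prod.exhaust)
  obtain z1 where b1: "b = ((?M *v v, z1), 0)" unfolding b a d snd_conv using osc_model_conj by blast
  obtain z2 where b2: "d \<otimes>\<^bsub>osc_model B\<^esub> b \<otimes>\<^bsub>osc_model B\<^esub> inv\<^bsub>osc_model B\<^esub> d = ((?M *v (?M *v v), z2), 0)"
    unfolding b1 d snd_conv using osc_model_conj by blast
  have "fst (fst c) = ?M *v (?M *v v) + (- t) *s (?M *v v) + v"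
    unfolding c b2 unfolding b1 osc_model_int_pow a by simp
  also have "?M *v (?M *v v) = (?M ** ?M) *v v" by (simp add: matrix_vector_mul_assoc)
  also have "(?M ** ?M) *v v + (- t) *s (?M *v v) + v = (trace ?M - t) *s (?M *v v)"
    by (simp add: vec_eq_iff forall_2 matrix2_simps(2) Cayley_Hamilton2[OF detM] algebra_simps)
  finally show "fst (fst c) = (trace ?M - t) *s (?M *v fst (fst a))" by (simp add: a)
qed

text \<open>Since \<open>t \<noteq> 2\<close>, a central twist forces \<open>a\<close> into the Heisenberg part, and then \<open>t = tr M\<close>. As
  \<open>t > 2\<close>, the exponent of \<open>M\<close> as a power of \<open>B\<close> cannot be zero.\<close>

lemma twist_traces_model:
  "twist_traces GG \<noteq> {}" "t \<in> twist_traces GG \<Longrightarrow> \<exists>m. m \<noteq> 0 \<and> t = trace (B [^]\<^bsub>SL2Z\<^esub> (m::int))"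
proof -
  let ?t = "trace (B [^]\<^bsub>SL2Z\<^esub> k)"
  have "?t \<in> twist_traces GG"
    unfolding twist_traces_def Let_def mem_Collect_eq
  proof (intro conjI bexI)
    show "?t > 2" by (rule hyperbolic_trace_pow[OF det tr k(1)])
    show "((u, y), 0) \<notin> center GG" using u by (simp add: center_subgroup_model)
    show "((0, 0), k) \<otimes>\<^bsub>GG\<^esub> (((0, 0), k) \<otimes>\<^bsub>GG\<^esub> ((u, y), 0) \<otimes>\<^bsub>GG\<^esub> inv\<^bsub>GG\<^esub> ((0, 0), k)) \<otimes>\<^bsub>GG\<^esub> inv\<^bsub>GG\<^esub> ((0, 0), k) \<otimes>\<^bsub>GG\<^esub>
        (((0, 0), k) \<otimes>\<^bsub>GG\<^esub> ((u, y), 0) \<otimes>\<^bsub>GG\<^esub> inv\<^bsub>GG\<^esub> ((0, 0), k)) [^]\<^bsub>GG\<^esub> (- ?t) \<otimes>\<^bsub>GG\<^esub> ((u, y), 0) \<in> center GG"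
      unfolding center_subgroup_model using twist_element[OF k(2) u(2), of ?t] by simp
  qed (use k u in simp_all)
  then show "twist_traces GG \<noteq> {}" by blast
next
  assume "t \<in> twist_traces GG"
  then obtain a d where ad: "t > 2" "a \<in> \<Gamma>" "d \<in> \<Gamma>" "a \<notin> center GG"
    "d \<otimes>\<^bsub>GG\<^esub> (d \<otimes>\<^bsub>GG\<^esub> a \<otimes>\<^bsub>GG\<^esub> inv\<^bsub>GG\<^esub> d) \<otimes>\<^bsub>GG\<^esub> inv\<^bsub>GG\<^esub> d \<otimes>\<^bsub>GG\<^esub> (d \<otimes>\<^bsub>GG\<^esub> a \<otimes>\<^bsub>GG\<^esub> inv\<^bsub>GG\<^esub> d) [^]\<^bsub>GG\<^esub> (- t) \<otimes>\<^bsub>GG\<^esub> a \<in> center GG"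
    by (auto simp: twist_traces_def Let_def simp del: osc_model_simps(3))
  note c = ad(5)[unfolded center_subgroup_model]
  have "snd a = 0" using c twist_element(2)[OF ad(3,2), of t] ad(1) by simp
  moreover have "fst (fst a) \<noteq> 0" using ad(2,4) \<open>snd a = 0\<close> by (simp add: center_subgroup_model)
  let ?M = "B [^]\<^bsub>SL2Z\<^esub> snd d" and ?v = "fst (fst a)"
  have "(trace ?M - t) *s (?M *v ?v) = 0"
    using c twist_element(3)[OF ad(3,2) \<open>snd a = 0\<close>, of t] by simp
  moreover have "?M *v ?v \<noteq> 0"
  proof
    assume "?M *v ?v = 0"
    then have "(adjugate2 ?M ** ?M) *v ?v = 0" by (simp flip: matrix_vector_mul_assoc)
    moreover have "adjugate2 ?M ** ?M = mat 1"
      using det_SL2Z_pow[OF det, of "snd d"] by (simp add: det_2 vec_eq_iff forall_2 matrix2_simps algebra_simps)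
    ultimately show False using \<open>?v \<noteq> 0\<close> by simp
  qed
  ultimately have t: "t = trace ?M" by (auto simp: vec_eq_iff)
  then have "snd d \<noteq> 0" using ad(1) by (auto simp: trace_I)
  then show "\<exists>m. m \<noteq> 0 \<and> t = trace (B [^]\<^bsub>SL2Z\<^esub> (m::int))" using t by blast
qed

end
end

section \<open>Commensurable models\<close>

text \<open>An integral \<open>P\<close> with \<open>A P = P A'\<close> maps one model into the other and scales the centre by \<open>det P\<close>. The image
  has finite index because \<open>P \<int>\<^sup>2\<close> contains \<open>(det P) \<int>\<^sup>2\<close>, by the adjugate of \<open>P\<close>.\<close>

lemma osc_model_similar:
  assumes A: "det A = 1" and A': "det A' = 1" and P: "det P \<noteq> 0" and AP: "A ** P = P ** A'"
  defines "j \<equiv> \<lambda>((v, z), n). ((P *v v, det P * z), n)"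
  shows "j \<in> hom (osc_model A') (osc_model A)" "inj_on j (carrier (osc_model A'))"
    "\<exists>Q. finite Q \<and> (\<forall>g. \<exists>x\<in>Q. \<exists>k. g = x \<otimes>\<^bsub>osc_model A\<^esub> j k)"
proof -
  define p where "p = det P"
  have p0: "p \<noteq> 0" using P by (simp add: p_def)
  define \<theta> where "\<theta> = (\<lambda>(v, z). (P *v v, p * z))"
  have \<theta>: "\<theta> \<in> hom heis_model heis_model"
    by (rule homI) (auto simp: \<theta>_def vec_det_mult p_def algebra_simps matrix_vector_right_distrib)
  have j: "j = map_prod \<theta> id" by (auto simp: j_def \<theta>_def p_def)
  have gen: "\<theta> (osc_action A' 1 x) = osc_action A 1 (\<theta> x)" for x
    by (cases x) (simp add: \<theta>_def osc_action_1 matrix_vector_mul_assoc AP)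
  have adj: "adjugate2 P *v (P *v v) = p *s v" "P *v (adjugate2 P *v v) = p *s v" for v
    by (simp_all add: p_def det_2 vec_eq_iff forall_2 matrix2_simps algebra_simps)
  have inj: "inj \<theta>"
  proof (rule injI)
    fix x y assume "\<theta> x = \<theta> y"
    obtain v z w u where xy: "x = (v, z)" "y = (w, u)" by (metis prod.exhaust)
    have "P *v v = P *v w" "z = u" using \<open>\<theta> x = \<theta> y\<close> p0 by (simp_all add: xy \<theta>_def)
    then have "p *s v = p *s w" by (metis adj(1))
    then show "x = y" using p0 \<open>z = u\<close> by (simp add: xy vec_eq_iff)
  qed
  note map = semidirect_map[OF osc_action[OF A'] osc_action[OF A] \<theta> gen, folded osc_model_def j]
  show "j \<in> hom (osc_model A') (osc_model A)" by (rule map(1))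
  show "inj_on j (carrier (osc_model A'))" by (rule map(2)) (use inj in \<open>auto simp: inj_on_def inj_def\<close>)
  \<comment> \<open>Coset representatives: vectors reduced modulo \<open>p\<close>, with the central component reduced as well.\<close>
  define r where "r = (\<lambda>v :: int ^ 2. (\<chi> i. v$i mod p) :: int ^ 2)"
  have fin: "finite (range r)"
  proof (rule finite_subset)
    show "range r \<subseteq> (\<lambda>(a, b). vector [a, b]) ` ({-\<bar>p\<bar>..\<bar>p\<bar>} \<times> {-\<bar>p\<bar>..\<bar>p\<bar>})"
    proof
      fix x assume "x \<in> range r"
      then obtain v where x: "x = r v" by blast
      have m: "a mod p \<in> {-\<bar>p\<bar>..\<bar>p\<bar>}" for a using abs_mod_less[OF p0, of a] by auto
      have "x = (\<lambda>(a, b). vector [a, b]) (v$1 mod p, v$2 mod p)"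
        by (simp add: x r_def vec_eq_iff forall_2)
      then show "x \<in> (\<lambda>(a, b). vector [a, b]) ` ({-\<bar>p\<bar>..\<bar>p\<bar>} \<times> {-\<bar>p\<bar>..\<bar>p\<bar>})" using m by blast
    qed
  qed simp
  let ?Q = "(\<lambda>(v, z). ((v, z), 0 :: int)) ` (range r \<times> {-\<bar>p\<bar>..\<bar>p\<bar>})"
  show "\<exists>Q. finite Q \<and> (\<forall>g. \<exists>x\<in>Q. \<exists>k. g = x \<otimes>\<^bsub>osc_model A\<^esub> j k)"
  proof (rule exI[of _ ?Q], intro conjI allI)
    show "finite ?Q" using fin by simp
    fix g :: "((int ^ 2) \<times> int) \<times> int"
    obtain v z n where g: "g = ((v, z), n)" by (metis prod.exhaust)
    define q where "q = (\<chi> i. v$i div p)"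
    have v: "v = r v + p *s q" by (simp add: vec_eq_iff r_def q_def)
    define s where "s = z - vec_det (r v) (p *s q)"
    have "s mod p \<in> {-\<bar>p\<bar>..\<bar>p\<bar>}" using abs_mod_less[OF p0, of s] by auto
    then have "((r v, s mod p), 0) \<in> ?Q" by force
    moreover have "g = ((r v, s mod p), 0) \<otimes>\<^bsub>osc_model A\<^esub> j ((adjugate2 P *v q, s div p), n)"
    proof -
      have "z = s mod p + p * (s div p) + vec_det (r v) (p *s q)" by (simp add: s_def)
      then show ?thesis using v by (simp add: g j_def adj p_def[symmetric])
    qed
    ultimately show "\<exists>x\<in>?Q. \<exists>k. g = x \<otimes>\<^bsub>osc_model A\<^esub> j k" by blast
  qed
qed

lemma osc_model_similar_embeds:
  assumes "det A = 1" "det A' = 1" "det P \<noteq> 0" "A ** P = P ** A'"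
  shows "virtually_embeds (osc_model A') (osc_model A)"
proof -
  obtain Q where "finite Q" "\<forall>g. \<exists>x\<in>Q. \<exists>k. g = x \<otimes>\<^bsub>osc_model A\<^esub> (\<lambda>((v, z), n). ((P *v v, det P * z), n)) k"
    using osc_model_similar(3)[OF assms] by blast
  then show ?thesis
    by (intro virtually_embedsI[OF osc_model_similar(1,2)[OF assms], of Q]) auto
qed

lemma osc_model_pow_embeds:
  assumes "det B = 1" "n > 0"
  shows "virtually_embeds (osc_model (B [^]\<^bsub>SL2Z\<^esub> (n::nat))) (osc_model B)"
proof (rule virtually_embedsI)
  let ?j = "\<lambda>(x, k). (x, int n * k) :: (((int ^ 2) \<times> int) \<times> int)"
  have pow: "(B [^]\<^bsub>SL2Z\<^esub> n) [^]\<^bsub>SL2Z\<^esub> (k::int) = B [^]\<^bsub>SL2Z\<^esub> (int n * k)" for k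
    using SL2Z.int_pow_pow[of B "int n" k] assms(1) by (simp add: int_pow_int)
  show "?j \<in> hom (osc_model (B [^]\<^bsub>SL2Z\<^esub> n)) (osc_model B)"
    by (rule homI) (auto simp: pow algebra_simps)
  show "inj_on ?j (carrier (osc_model (B [^]\<^bsub>SL2Z\<^esub> n)))" using assms(2) by (auto simp: inj_on_def)
  show "finite ((\<lambda>i. ((0, 0), i)) ` {0..<int n})" by simp
  show "(\<lambda>i. ((0, 0), i)) ` {0..<int n} \<subseteq> carrier (osc_model B)" by simp
  fix g :: "((int ^ 2) \<times> int) \<times> int"
  obtain v z m where g: "g = ((v, z), m)" by (metis prod.exhaust)
  let ?i = "m mod int n"
  let ?k = "(((B [^]\<^bsub>SL2Z\<^esub> (- ?i)) *v v, z), m div int n)"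
  have i: "((0, 0), ?i) \<in> (\<lambda>i. ((0, 0), i)) ` {0..<int n}" using assms(2) by simp
  have "g = ((0, 0), ?i) \<otimes>\<^bsub>osc_model B\<^esub> ?j ?k"
    using assms(1) by (simp add: g matrix_vector_mul_assoc flip: SL2Z.int_pow_mult[of B, simplified])
  then have "\<exists>k\<in>carrier (osc_model (B [^]\<^bsub>SL2Z\<^esub> n)). g = ((0, 0), ?i) \<otimes>\<^bsub>osc_model B\<^esub> ?j k"
    by (intro bexI[of _ ?k]) (simp_all del: osc_model_simps(3))
  then show "\<exists>x\<in>(\<lambda>i. ((0, 0), i)) ` {0..<int n}. \<exists>k\<in>carrier (osc_model (B [^]\<^bsub>SL2Z\<^esub> n)). g = x \<otimes>\<^bsub>osc_model B\<^esub> ?j k"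
    using i by (rule bexI)
qed

definition companion2 :: "int \<Rightarrow> int ^ 2 ^ 2" where
  "companion2 t = vector [vector [0, -1], vector [1, t]]"

lemma companion2: "det (companion2 t) = 1" "trace (companion2 t) = t"
  by (simp_all add: companion2_def det_2 matrix2_simps)

text \<open>The columns of the transition matrix are \<open>e\<^sub>1\<close> and \<open>A e\<^sub>1\<close>, which are independent because a hyperbolic
  matrix is not triangular.\<close>

lemma osc_model_companion_embeds:
  assumes "det A = 1" "trace A > 2"
  shows "virtually_embeds (osc_model (companion2 (trace A))) (osc_model A)"
proof (rule osc_model_similar_embeds[OF assms(1) companion2(1)])
  let ?P = "vector [vector [1, A$1$1], vector [0, A$2$1]] :: int ^ 2 ^ 2"
  show "det ?P \<noteq> 0" using hyperbolic_off_diagonal[OF assms] by (simp add: det_2)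
  show "A ** ?P = ?P ** companion2 (trace A)"
    using assms(1) by (simp add: vec_eq_iff forall_2 matrix2_simps companion2_def det_2 algebra_simps)
qed

lemma common_virtual_model:
  assumes B: "det B = 1" "trace B > 2" and B': "det B' = 1" "trace B' > 2"
    and "trace_field (trace B) = trace_field (trace B')"
  obtains C where "det C = 1" "virtually_embeds (osc_model C) (osc_model B)" "virtually_embeds (osc_model C) (osc_model B')"
proof -
  obtain n m :: nat where nm: "n > 0" "m > 0" "trace (B [^]\<^bsub>SL2Z\<^esub> n) = trace (B' [^]\<^bsub>SL2Z\<^esub> m)"
    using equal_trace_powers[OF assms] .
  have *: "virtually_embeds (osc_model (companion2 (trace (A [^]\<^bsub>SL2Z\<^esub> k)))) (osc_model A)"
    if "det A = 1" "trace A > 2" "k > 0" for A and k :: nat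
  proof (rule virtually_embeds_trans[OF osc_model_group[OF that(1)] _ osc_model_pow_embeds[OF that(1,3)]])
    have "trace (A [^]\<^bsub>SL2Z\<^esub> int k) > 2" using that by (intro hyperbolic_trace_pow) simp_all
    then show "virtually_embeds (osc_model (companion2 (trace (A [^]\<^bsub>SL2Z\<^esub> k)))) (osc_model (A [^]\<^bsub>SL2Z\<^esub> k))"
      using that(1) by (intro osc_model_companion_embeds) (simp_all add: int_pow_int)
  qed
  show thesis using that[of "companion2 (trace (B [^]\<^bsub>SL2Z\<^esub> n))"] *[OF B nm(1)] *[OF B' nm(2)] nm(3)
    by (simp add: companion2)
qed

section \<open>Coordinates on Heisenberg groups\<close>

text \<open>A group with generators \<open>a, b, c\<close> that satisfy exactly the relations of the discrete Heisenberg group \<open>H\<^sup>r(\<int>)\<close>.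
  That \<open>c\<close> has infinite order is enough for uniqueness of the normal form \<open>E m n k\<close>.\<close>

locale heis_coords = heis_triple G a b c r for G :: "'a monoid" (structure) and a b c r +
  assumes r_pos: "r > 0"
    and c_inf: "\<And>k::int. c [^] k = \<one> \<Longrightarrow> k = 0"
    and coords: "\<And>x. x \<in> carrier G \<Longrightarrow> \<exists>m n k. x = E m n k"
begin

lemma E_0_inj: "E 0 0 k = E 0 0 k' \<Longrightarrow> k = k'"
proof -
  assume "E 0 0 k = E 0 0 k'"
  then have "E 0 0 k \<otimes> E 0 0 (- k') = E 0 0 k' \<otimes> E 0 0 (- k')" by simp
  then have "E 0 0 (k - k') = E 0 0 0" by (simp add: E_mult)
  then show "k = k'" using c_inf[of "k - k'"] unfolding E_gens by simp
qed

lemma E_commutator: "E m n k \<otimes> E m' n' k' = E 0 0 (r * (m * n' - m' * n)) \<otimes> (E m' n' k' \<otimes> E m n k)"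
  by (simp add: E_mult) (simp add: algebra_simps)

lemma E_commute_iff:
  "E m n k \<otimes> E m' n' k' = E m' n' k' \<otimes> E m n k \<longleftrightarrow> m * n' = m' * n"
proof -
  let ?x = "E m' n' k' \<otimes> E m n k" and ?z = "E 0 0 (r * (m * n' - m' * n))"
  have "?z \<otimes> ?x = ?x \<longleftrightarrow> ?z = \<one>" by simp
  also have "\<dots> \<longleftrightarrow> r * (m * n' - m' * n) = 0" using E_0_inj[of _ 0] unfolding E_gens(4)[symmetric] by metis
  also have "\<dots> \<longleftrightarrow> m * n' = m' * n" using r_pos by simp
  finally show ?thesis unfolding E_commutator[of m n k] .
qed

text \<open>The element \<open>E m n k (E m' n' k')\<^sup>-\<^sup>1\<close> is \<open>E (m - m') (n - n') j\<close> for some \<open>j\<close>. If it is trivial,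
  it commutes with \<open>a\<close> and \<open>b\<close>, so its first two exponents vanish.\<close>

lemma E_inj: "E m n k = E m' n' k' \<longleftrightarrow> m = m' \<and> n = n' \<and> k = k'"
proof
  assume eq: "E m n k = E m' n' k'"
  have "E m' n' k' \<otimes> E 1 0 0 = E 1 0 0 \<otimes> E m' n' k' \<longleftrightarrow> n' = 0" for m' n' k'
    unfolding E_commute_iff by auto
  have p: "\<exists>j. E m n k \<otimes> inv (E m' n' k') = E (m - m') (n - n') j"
    by (simp add: E_inv E_mult) blast
  then obtain j where j: "E (m - m') (n - n') j = \<one>" using eq by force
  have "E (m - m') (n - n') j \<otimes> x = x \<otimes> E (m - m') (n - n') j" if "x \<in> carrier G" for x
    using that by (simp add: j)
  from this[of "E 1 0 0"] this[of "E 0 1 0"] have mn: "m = m'" "n = n'"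
    by (simp_all add: E_commute_iff)
  have "E m n k \<otimes> inv (E m' n' k') = E 0 0 (k - k')" unfolding mn by (simp add: E_inv E_mult)
  then have "E 0 0 (k - k') = E 0 0 0" using eq by (simp add: E_gens(4))
  then show "m = m' \<and> n = n' \<and> k = k'" using mn E_0_inj by force
qed simp

lemma center_eq: "center G = range (E 0 0)"
proof (intro equalityI subsetI)
  fix x assume x: "x \<in> center G"
  then have "x \<in> carrier G" by (simp add: center_def)
  then obtain m n k where e: "x = E m n k" using coords by blast
  have comm: "x \<otimes> y = y \<otimes> x" if "y \<in> carrier G" for y using x that by (simp add: center_def)
  have "m = 0" "n = 0" using comm[of "E 1 0 0"] comm[of "E 0 1 0"] by (simp_all add: e E_commute_iff)
  then show "x \<in> range (E 0 0)" by (simp add: e)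
next
  fix x assume "x \<in> range (E 0 0)"
  then obtain k where e: "x = E 0 0 k" by blast
  have "x \<otimes> y = y \<otimes> x" if "y \<in> carrier G" for y
    using coords[OF that] by (auto simp: e E_commute_iff)
  then show "x \<in> center G" by (simp add: center_def e)
qed

end

lemma hom_E:
  assumes G: "heis_triple G a b c r" and K: "heis_triple K (h a) (h b) (h c) r" and h: "h \<in> hom G K"
  shows "h (heis_triple.E G a b c m n k) = heis_triple.E K (h a) (h b) (h c) m n k"
proof -
  interpret G: heis_triple G a b c r by fact
  interpret K: heis_triple K "h a" "h b" "h c" r by fact
  interpret h: group_hom G K h by unfold_locales (rule h)
  show ?thesis by (simp add: G.E_def K.E_def h.hom_int_pow)
qed

lemma heis_triple_hom:
  assumes "heis_triple G a b c r" "group K" "h \<in> hom G K"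
  shows "heis_triple K (h a) (h b) (h c) r"
proof -
  interpret G: heis_triple G a b c r by fact
  interpret K: group K by fact
  interpret h: group_hom G K h by unfold_locales (rule assms)
  have "h a \<otimes>\<^bsub>K\<^esub> h c = h c \<otimes>\<^bsub>K\<^esub> h a" "h b \<otimes>\<^bsub>K\<^esub> h c = h c \<otimes>\<^bsub>K\<^esub> h b"
    using G.ac G.bc by (metis G.closed h.hom_mult)+
  moreover have "h a \<otimes>\<^bsub>K\<^esub> h b = h c [^]\<^bsub>K\<^esub> r \<otimes>\<^bsub>K\<^esub> (h b \<otimes>\<^bsub>K\<^esub> h a)"
    using arg_cong[OF G.ab, of h] by (simp add: h.hom_int_pow)
  ultimately show ?thesis by unfold_locales auto
qed

lemma heis_coords_iso:
  assumes "heis_coords G a b c r" "group K" "h \<in> iso G K"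
  shows "heis_coords K (h a) (h b) (h c) r"
proof -
  interpret G: heis_coords G a b c r by fact
  have h: "h \<in> hom G K" "h ` carrier G = carrier K" "inj_on h (carrier G)" using assms(3) by (auto simp: iso_iff)
  interpret K: heis_triple K "h a" "h b" "h c" r by (rule heis_triple_hom[OF G.heis_triple_axioms assms(2) h(1)])
  interpret h: group_hom G K h by unfold_locales (rule h)
  note E = hom_E[OF G.heis_triple_axioms K.heis_triple_axioms h(1)]
  show ?thesis
  proof
    show "r > 0" by (rule G.r_pos)
    fix k :: int assume "h c [^]\<^bsub>K\<^esub> k = \<one>\<^bsub>K\<^esub>"
    then have "h (c [^]\<^bsub>G\<^esub> k) = h \<one>\<^bsub>G\<^esub>" by (simp add: h.hom_int_pow)
    then have "c [^]\<^bsub>G\<^esub> k = \<one>\<^bsub>G\<^esub>" by (rule inj_onD[OF h(3)]) simp_all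
    then show "k = 0" by (rule G.c_inf)
  next
    fix x assume "x \<in> carrier K"
    then obtain y where y: "y \<in> carrier G" "x = h y" using h(2) by blast
    then show "\<exists>m n k. x = K.E m n k" using G.coords[OF y(1)] E by metis
  qed
qed

lemma heisenberg_universal:
  assumes "heis_triple K a b c (int r)"
  obtains h where "h \<in> hom (heisenberg_group r) K"
    "h (heis_elem r Gen_alpha) = a" "h (heis_elem r Gen_beta) = b" "h (heis_elem r Gen_gamma) = c"
proof -
  interpret K: heis_triple K a b c "int r" by fact
  define g where "g = (\<lambda>x. case x of Gen_alpha \<Rightarrow> K.E 1 0 0 | Gen_beta \<Rightarrow> K.E 0 1 0 | Gen_gamma \<Rightarrow> K.E 0 0 1)"
  have gcl: "g x \<in> carrier K" for x by (cases x) (simp_all add: g_def)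
  have rep: "K.word_eval g (replicate q (Gen_gamma, True)) = K.E 0 0 (int q)" for q
    by (induction q) (simp_all add: K.word_eval_simps g_def K.E_mult K.E_gens(4))
  have one: "x \<otimes>\<^bsub>K\<^esub> \<one>\<^bsub>K\<^esub> = x \<otimes>\<^bsub>K\<^esub> K.E 0 0 0" for x by (simp only: K.E_gens(4))
  have comm: "K.word_eval g [(Gen_alpha, True), (Gen_beta, True), (Gen_alpha, False), (Gen_beta, False)] =
      K.word_eval g (replicate r (Gen_gamma, True))"
    unfolding rep by (simp add: K.word_eval_simps g_def K.E_inv one K.E_mult del: K.r_one)
  have central: "K.word_eval g [(x, True), (Gen_gamma, True)] = K.word_eval g [(Gen_gamma, True), (x, True)]" for x
    by (cases x) (simp_all add: K.word_eval_simps g_def one K.E_mult del: K.r_one)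
  have rel: "K.word_eval g u = K.word_eval g v" if "(u, v) \<in> heis_relations r" for u v
    using that unfolding heis_relations_def insert_iff empty_iff prod.inject
    using comm central by (elim disjE conjE FalseE) (simp_all only:)
  obtain f where "f \<in> hom (heisenberg_group r) K" "\<And>x. f (heis_elem r x) = g x"
    by (rule K.presented_hom_ex[where R = "heis_relations r" and g = g,
          folded heisenberg_group_def heis_elem_def]) (rule gcl | erule rel | blast)+
  then show thesis using that by (simp add: g_def K.E_gens)
qed

lemma heisenberg_hom_eq:
  assumes "group K" "f \<in> hom (heisenberg_group r) K" "h \<in> hom (heisenberg_group r) K"
    "f (heis_elem r Gen_alpha) = h (heis_elem r Gen_alpha)" "f (heis_elem r Gen_beta) = h (heis_elem r Gen_beta)"
    "f (heis_elem r Gen_gamma) = h (heis_elem r Gen_gamma)" "x \<in> carrier (heisenberg_group r)"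
  shows "f x = h x"
proof (rule presented_hom_unique[of K f "heis_relations r" h, folded heisenberg_group_def heis_elem_def])
  show "f (heis_elem r y) = h (heis_elem r y)" for y using assms by (cases y) auto
qed (use assms in auto)

text \<open>The homomorphisms from the Heisenberg group to the model that are used below: a dilation by \<open>D\<close> with two
  free central parameters \<open>e1\<close> and \<open>e2\<close>. The generator of the centre goes to \<open>2 r D\<^sup>2\<close> because the
  commutator of \<open>(v, z)\<close> and \<open>(w, y)\<close> in the model is \<open>2 det (v, w)\<close>.\<close>

lemma heis_model_triple:
  fixes D r e1 e2 :: int
  defines "a \<equiv> (vector [D * r, 0], e1)" and "b \<equiv> (vector [0, D * r], e2)" and "c \<equiv> (0, 2 * r * D\<^sup>2)"
  shows "heis_triple heis_model a b c r"
    and "heis_triple.E heis_model a b c m n k =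
      (vector [D * r * m, D * r * n], m * e1 + n * e2 + D\<^sup>2 * r\<^sup>2 * m * n + 2 * r * D\<^sup>2 * k)"
proof -
  show t: "heis_triple heis_model a b c r"
    by unfold_locales
      (simp_all add: a_def b_def c_def heis_model_int_pow vec_det_def vec_eq_iff forall_2 power2_eq_square)
  show "heis_triple.E heis_model a b c m n k =
      (vector [D * r * m, D * r * n], m * e1 + n * e2 + D\<^sup>2 * r\<^sup>2 * m * n + 2 * r * D\<^sup>2 * k)"
    by (subst heis_triple.E_def[OF t])
      (simp add: a_def b_def c_def heis_model_int_pow vec_det_def vec_eq_iff forall_2 power2_eq_square)
qed

text \<open>A homomorphism to the model detects the powers of \<open>\<gamma>\<close>.\<close>

lemma heis_coords_heisenberg:
  assumes "r \<ge> 1"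
  shows "heis_coords (heisenberg_group r) (heis_elem r Gen_alpha) (heis_elem r Gen_beta) (heis_elem r Gen_gamma) (int r)"
proof -
  interpret H: heis_triple "heisenberg_group r" "heis_elem r Gen_alpha" "heis_elem r Gen_beta" "heis_elem r Gen_gamma" "int r"
    by (rule heis_triple_heisenberg)
  show ?thesis
  proof
    show "int r > 0" using assms by simp
  next
    fix k :: int assume k: "heis_elem r Gen_gamma [^]\<^bsub>heisenberg_group r\<^esub> k = \<one>\<^bsub>heisenberg_group r\<^esub>"
    obtain h where h: "h \<in> hom (heisenberg_group r) heis_model" "h (heis_elem r Gen_gamma) = (0, 2 * int r * 1\<^sup>2)"
      by (rule heisenberg_universal[OF heis_model_triple(1)[of 1 "int r" 0 0]])
    interpret h: group_hom "heisenberg_group r" heis_model h by unfold_locales (rule h)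
    have "h (heis_elem r Gen_gamma [^]\<^bsub>heisenberg_group r\<^esub> k) = (0, k * (2 * int r))"
      by (simp add: h.hom_int_pow h(2) heis_model_int_pow)
    then show "k = 0" using assms by (simp add: k)
  next
    fix x assume x: "x \<in> carrier (heisenberg_group r)"
    let ?S = "{x. \<exists>m n k. x = H.E m n k}"
    have "subgroup ?S (heisenberg_group r)"
    proof (rule H.subgroupI)
      show "?S \<noteq> {}" by blast
    qed (auto simp: H.E_inv H.E_mult, blast+)
    moreover have "heis_elem r y \<in> ?S" for y
    proof (cases y)
      case Gen_alpha then show ?thesis using H.E_gens(1) by (metis (mono_tags) mem_Collect_eq)
    next
      case Gen_beta then show ?thesis using H.E_gens(2) by (metis (mono_tags) mem_Collect_eq)
    next
      case Gen_gamma then show ?thesis using H.E_gens(3) by (metis (mono_tags) mem_Collect_eq)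
    qed
    ultimately have "x \<in> ?S"
      using presented_gen_induct[of x "heis_relations r" ?S, folded heisenberg_group_def heis_elem_def] x by blast
    then show "\<exists>m n k. x = H.E m n k" by blast
  qed
qed

lemma heis_coords_iso_heisenberg:
  assumes "heis_coords K a b c (int r)"
  obtains h where "h \<in> iso (heisenberg_group r) K"
    "h (heis_elem r Gen_alpha) = a" "h (heis_elem r Gen_beta) = b" "h (heis_elem r Gen_gamma) = c"
proof -
  interpret K: heis_coords K a b c "int r" by fact
  have "r \<ge> 1" using K.r_pos by simp
  then interpret H: heis_coords "heisenberg_group r" "heis_elem r Gen_alpha" "heis_elem r Gen_beta" "heis_elem r Gen_gamma" "int r"
    by (rule heis_coords_heisenberg)
  obtain h where h: "h \<in> hom (heisenberg_group r) K" "h (heis_elem r Gen_alpha) = a"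
    "h (heis_elem r Gen_beta) = b" "h (heis_elem r Gen_gamma) = c"
    by (rule heisenberg_universal[OF K.heis_triple_axioms])
  have E: "h (H.E m n k) = K.E m n k" for m n k
    using hom_E[OF H.heis_triple_axioms _ h(1), of m n k] K.heis_triple_axioms by (simp add: h)
  have "inj_on h (carrier (heisenberg_group r))"
  proof (rule inj_onI)
    fix x y assume xy: "x \<in> carrier (heisenberg_group r)" "y \<in> carrier (heisenberg_group r)" "h x = h y"
    obtain m n k where x: "x = H.E m n k" using H.coords[OF xy(1)] by blast
    obtain m' n' k' where y: "y = H.E m' n' k'" using H.coords[OF xy(2)] by blast
    show "x = y" using xy(3) by (simp add: x y E K.E_inj)
  qed
  moreover have "carrier K \<subseteq> h ` carrier (heisenberg_group r)"
  proof
    fix x assume "x \<in> carrier K"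
    then obtain m n k where "x = K.E m n k" using K.coords by blast
    then show "x \<in> h ` carrier (heisenberg_group r)" using E[of m n k] by (metis H.E_closed imageI)
  qed
  ultimately have "h \<in> iso (heisenberg_group r) K" using h(1) hom_carrier[OF h(1)] by (auto simp: iso_iff)
  then show thesis using that h by blast
qed

section \<open>The quotient by the centre\<close>

lemma int_vec_group_simps [simp]:
  "carrier int_vec_group = UNIV" "v \<otimes>\<^bsub>int_vec_group\<^esub> w = v + w" "\<one>\<^bsub>int_vec_group\<^esub> = 0"
  by (simp_all add: int_vec_group_def)

interpretation IV: group int_vec_group
  by (rule groupI) (auto intro: exI[of _ "- _"] simp: add.assoc)

lemma int_vec_group_pow: "v [^]\<^bsub>int_vec_group\<^esub> (k::int) = k *s v"
proof -
  have "fst \<in> hom heis_model int_vec_group" by (rule homI) auto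
  then interpret f: group_hom heis_model int_vec_group fst by unfold_locales
  show ?thesis using f.hom_int_pow[of "(v, 0)" k] by (simp add: heis_model_int_pow)
qed

locale plain_group = group G for G :: "'a monoid" (structure)

sublocale heis_coords \<subseteq> plain_group
  by unfold_locales

lemma (in plain_group) center_subgroup: "subgroup (center G) G"
proof (rule subgroupI)
  show "center G \<noteq> {}" by (auto simp: center_def intro!: exI[of _ \<one>])
  fix x assume x: "x \<in> center G"
  then have xG: "x \<in> carrier G" by (simp add: center_def)
  have "inv x \<otimes> y = y \<otimes> inv x" if "y \<in> carrier G" for y
  proof -
    have "x \<otimes> inv y = inv y \<otimes> x" using x that by (simp add: center_def)
    then have "inv (x \<otimes> inv y) = inv (inv y \<otimes> x)" by simp
    then show ?thesis using xG that by (simp add: inv_mult_group)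
  qed
  then show "inv x \<in> center G" using xG by (simp add: center_def)
  fix y assume y: "y \<in> center G"
  then have yG: "y \<in> carrier G" by (simp add: center_def)
  have "x \<otimes> y \<otimes> w = w \<otimes> (x \<otimes> y)" if "w \<in> carrier G" for w
  proof -
    have "x \<otimes> y \<otimes> w = x \<otimes> (w \<otimes> y)" using y xG yG that by (simp add: m_assoc center_def)
    also have "\<dots> = (w \<otimes> x) \<otimes> y" using x xG yG that by (simp add: center_def flip: m_assoc)
    finally show ?thesis using xG yG that by (simp add: m_assoc)
  qed
  then show "x \<otimes> y \<in> center G" using xG yG by (simp add: center_def)
qed (simp add: center_def)

lemma (in plain_group) center_normal: "center G \<lhd> G"
proof (rule normalI[OF center_subgroup], rule ballI)
  fix x assume "x \<in> carrier G"
  then show "center G #> x = x <# center G" by (auto simp: r_coset_def l_coset_def center_def)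
qed

lemma (in plain_group) auto_center_coset:
  assumes f: "f \<in> auto G" and x: "x \<in> carrier G"
  shows "f ` (center G #> x) = center G #> f x"
proof -
  have iso: "f \<in> iso G G" using f by (simp add: auto_iff)
  then have hom: "f \<in> hom G G" and im: "f ` carrier G = carrier G" by (auto simp: iso_iff)
  have c: "center G \<subseteq> carrier G" by (auto simp: center_def)
  have "f ` center G = center G"
  proof (intro equalityI subsetI)
    fix y assume "y \<in> f ` center G"
    then show "y \<in> center G" using center_iso[OF is_group iso] c by auto
  next
    fix y assume y: "y \<in> center G"
    then obtain z where z: "z \<in> carrier G" "y = f z" using im c by blast
    then show "y \<in> f ` center G" using center_iso[OF is_group iso z(1)] y by blast
  qed
  moreover have "f ` (center G #> x) = f ` center G #> f x"
  proof -
    have "f (z \<otimes> x) = f z \<otimes> f x" if "z \<in> center G" for z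
      using that c x by (intro hom_mult[OF hom]) auto
    then show ?thesis by (simp add: r_coset_def image_UN)
  qed
  ultimately show ?thesis by simp
qed

context plain_group
begin

context
  fixes \<psi> assumes \<psi>: "\<psi> \<in> iso (G Mod center G) int_vec_group"
begin

lemma center_quotient_hom: "(\<lambda>x. \<psi> (center G #> x)) \<in> hom G int_vec_group"
proof (rule homI)
  interpret N: normal "center G" G by (rule center_normal)
  fix x y assume xy: "x \<in> carrier G" "y \<in> carrier G"
  have "\<psi> ((center G #> x) \<otimes>\<^bsub>G Mod center G\<^esub> (center G #> y)) = \<psi> (center G #> x) + \<psi> (center G #> y)"
    using hom_mult[OF iso_imp_homomorphism[OF \<psi>], of "center G #> x" "center G #> y"] xy
    by (simp add: FactGroup_def RCOSETS_def) blast
  then show "\<psi> (center G #> (x \<otimes> y)) = \<psi> (center G #> x) \<otimes>\<^bsub>int_vec_group\<^esub> \<psi> (center G #> y)"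
    using xy by (simp add: FactGroup_def N.rcos_sum)
qed simp

lemma center_quotient_surj: "\<exists>x\<in>carrier G. \<psi> (center G #> x) = v"
proof -
  have "v \<in> \<psi> ` carrier (G Mod center G)" using \<psi> by (simp add: iso_iff)
  then show ?thesis by (auto simp: FactGroup_def RCOSETS_def)
qed

lemma center_quotient_eq:
  assumes "x \<in> carrier G" "y \<in> carrier G" "\<psi> (center G #> x) = \<psi> (center G #> y)"
  obtains z where "z \<in> center G" "x = z \<otimes> y"
proof -
  have "inj_on \<psi> (carrier (G Mod center G))" using \<psi> by (simp add: iso_iff)
  then have "center G #> x = center G #> y"
    using assms by (auto simp: FactGroup_def RCOSETS_def dest!: inj_onD)
  then have "x \<in> center G #> y" using rcos_self[OF assms(1) center_subgroup] by simp
  then show thesis using that by (auto simp: r_coset_def)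
qed

end
end

text \<open>Lift the standard basis of \<open>\<int>\<^sup>2\<close> to \<open>a'\<close> and \<open>b'\<close>. Their commutator is \<open>c\<^sup>r\<^sup>s\<close> for an integer \<open>s\<close>. It must be
  \<open>c\<^sup>\<plusminus>\<^sup>r\<close>, as the commutator of the old generators is a power of it; in the negative case \<open>c\<close> is
  replaced by its inverse.\<close>

lemma (in heis_coords) adapted_coords:
  assumes \<psi>: "\<psi> \<in> iso (G Mod center G) int_vec_group"
  obtains a' b' c' where "heis_coords G a' b' c' r"
    "\<And>m n k. \<psi> (center G #> heis_triple.E G a' b' c' m n k) = vector [m, n]"
proof -
  define \<pi> where "\<pi> = (\<lambda>x. \<psi> (center G #> x))"
  have hom: "\<pi> \<in> hom G int_vec_group" unfolding \<pi>_def by (rule center_quotient_hom[OF \<psi>])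
  interpret \<pi>: group_hom G int_vec_group \<pi> by unfold_locales (rule hom)
  obtain a' where a': "a' \<in> carrier G" "\<pi> a' = vector [1, 0]"
    unfolding \<pi>_def using center_quotient_surj[OF \<psi>] by blast
  obtain b' where b': "b' \<in> carrier G" "\<pi> b' = vector [0, 1]"
    unfolding \<pi>_def using center_quotient_surj[OF \<psi>] by blast
  obtain m1 n1 k1 where aE: "a' = E m1 n1 k1" using coords[OF a'(1)] by blast
  obtain m2 n2 k2 where bE: "b' = E m2 n2 k2" using coords[OF b'(1)] by blast
  define s where "s = m1 * n2 - m2 * n1"
  have central: "x \<otimes> c = c \<otimes> x" if "x \<in> carrier G" for x
    using coords[OF that] E_commute_iff[of _ _ _ 0 0 1] by (auto simp: E_gens)
  have ab': "a' \<otimes> b' = c [^] (r * s) \<otimes> (b' \<otimes> a')"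
    unfolding aE bE E_commutator[of m1] by (simp add: E_gens s_def)
  interpret T: heis_triple G a' b' c "r * s"
    by unfold_locales (use a' b' central ab' in auto)
  have piE: "\<pi> (T.E m n k) = vector [m, n]" for m n k
  proof -
    have "\<pi> c = 0"
    proof -
      have "c \<in> center G" using E_gens(3) unfolding center_eq by (metis rangeI)
      then have "center G #> c = center G" by (intro coset_join2 center_subgroup) simp_all
      then have "\<pi> c = \<pi> \<one>" using coset_join2[OF one_closed center_subgroup] subgroup.one_closed[OF center_subgroup]
        by (simp add: \<pi>_def)
      then show ?thesis by simp
    qed
    then show ?thesis using a' b'
      by (simp add: T.E_def \<pi>.hom_int_pow int_vec_group_pow vec_eq_iff forall_2)
  qed
  have surj: "\<exists>m n k. x = T.E m n k" if x: "x \<in> carrier G" for x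
  proof -
    have "\<pi> x = \<pi> (T.E (\<pi> x$1) (\<pi> x$2) 0)" unfolding piE by (simp add: vec_eq_iff forall_2)
    then obtain z where z: "z \<in> center G" "x = z \<otimes> T.E (\<pi> x$1) (\<pi> x$2) 0"
      using center_quotient_eq[OF \<psi> x T.E_closed] unfolding \<pi>_def by metis
    then obtain k where "z = T.E 0 0 k" unfolding center_eq E_gens T.E_gens by blast
    then have "x = T.E (\<pi> x$1) (\<pi> x$2) k" using z(2) by (simp add: T.E_mult)
    then show ?thesis by blast
  qed
  \<comment> \<open>The old generators are words in the new ones as well, so \<open>r * s\<close> divides \<open>r\<close>.\<close>
  obtain i1 j1 l1 where aT: "a = T.E i1 j1 l1" using surj[of a] by auto
  obtain i2 j2 l2 where bT: "b = T.E i2 j2 l2" using surj[of b] by auto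
  have "a \<otimes> b = T.E 0 0 (r * s * (i1 * j2 - i2 * j1)) \<otimes> (b \<otimes> a)"
    unfolding aT bT by (simp add: T.E_mult) (simp add: algebra_simps)
  then have "c [^] (r * s * (i1 * j2 - i2 * j1)) = c [^] r"
    using ab by (simp add: T.E_gens)
  then have "r * s * (i1 * j2 - i2 * j1) = r"
    using E_0_inj by (simp add: E_gens)
  then have "s * (i1 * j2 - i2 * j1) = 1" using r_pos by (simp add: mult.assoc)
  then have s: "s = 1 \<or> s = - 1" by (simp add: zmult_eq_1_iff) blast
  define c' where "c' = c [^] s"
  have ss: "s * s = 1" using s by auto
  have c'p: "c' [^] k = c [^] (s * k)" for k :: int by (simp add: c'_def int_pow_pow)
  interpret T': heis_triple G a' b' c' r
  proof unfold_locales
    show "c' \<in> carrier G" by (simp add: c'_def)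
    show "a' \<otimes> c' = c' \<otimes> a'" "b' \<otimes> c' = c' \<otimes> b'"
      using T.pow_commute[of a' c 1 s] T.pow_commute[of b' c 1 s] a' b' central by (simp_all add: c'_def)
    show "a' \<otimes> b' = c' [^] r \<otimes> (b' \<otimes> a')" unfolding c'p ab' by (simp add: mult.commute)
  qed (use a' b' in auto)
  have E': "T'.E m n k = T.E m n (s * k)" for m n k by (simp add: T'.E_def T.E_def c'p)
  have "heis_coords G a' b' c' r"
  proof
    show "r > 0" by (rule r_pos)
    show "k = 0" if "c' [^] k = \<one>" for k :: int using c_inf[of "s * k"] that s by (auto simp: c'p)
    show "\<exists>m n k. x = T'.E m n k" if "x \<in> carrier G" for x
    proof -
      obtain m n k where x: "x = T.E m n k" using surj[OF \<open>x \<in> carrier G\<close>] by blast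
      have "x = T'.E m n (s * k)" unfolding E' x using ss by (simp flip: mult.assoc)
      then show ?thesis by blast
    qed
  qed
  moreover have "\<psi> (center G #> T'.E m n k) = vector [m, n]" for m n k
    using piE unfolding E' \<pi>_def by blast
  ultimately show thesis using that by blast
qed

text \<open>The exponents \<open>(m, n)\<close> of \<open>E m n k\<close> identify the quotient by the centre with \<open>\<int>\<^sup>2\<close>.\<close>

lemma (in heis_coords) induces_hyperbolicI:
  assumes f: "f \<in> auto G" and B: "B \<in> hyperbolic_SL2Z"
    and fa: "f a = E (B$1$1) (B$2$1) p" and fb: "f b = E (B$1$2) (B$2$2) q" and fc: "f c = c"
  shows "induces_hyperbolic G f"
proof -
  have hom: "f \<in> hom G G" using f by (simp add: auto_def)
  interpret f: group_hom G G f by unfold_locales (rule hom)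
  define xy where "xy = (\<lambda>x. SOME v :: int ^ 2. \<exists>k. x = E (v$1) (v$2) k)"
  have xy: "xy (E m n k) = vector [m, n]" for m n k
  proof -
    have "\<exists>k'. E m n k = E (xy (E m n k)$1) (xy (E m n k)$2) k'"
      unfolding xy_def by (rule someI[of _ "vector [m, n]"]) auto
    then show ?thesis by (auto simp: E_inj vec_eq_iff forall_2)
  qed
  have xy_hom: "xy \<in> hom G int_vec_group"
  proof (rule homI)
    fix x y assume "x \<in> carrier G" "y \<in> carrier G"
    then obtain m n k m' n' k' where "x = E m n k" "y = E m' n' k'" using coords by metis
    then show "xy (x \<otimes> y) = xy x \<otimes>\<^bsub>int_vec_group\<^esub> xy y" by (simp add: E_mult xy vec_eq_iff forall_2)
  qed simp
  interpret xy: group_hom G int_vec_group xy by unfold_locales (rule xy_hom)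
  have ker: "kernel G int_vec_group xy = center G"
  proof (intro equalityI subsetI)
    fix x assume "x \<in> kernel G int_vec_group xy"
    then have x: "x \<in> carrier G" "xy x = 0" by (auto simp: kernel_def)
    then obtain m n k where "x = E m n k" using coords by blast
    then show "x \<in> center G" using x(2) by (simp add: center_eq xy vec_eq_iff forall_2)
  next
    fix x assume "x \<in> center G"
    then show "x \<in> kernel G int_vec_group xy" by (auto simp: center_eq kernel_def xy vec_eq_iff forall_2)
  qed
  have "xy ` carrier G = carrier int_vec_group"
  proof -
    have "v \<in> xy ` carrier G" for v
      by (rule image_eqI[of _ _ "E (v$1) (v$2) 0"]) (simp_all add: xy vec_eq_iff forall_2)
    then show ?thesis by auto
  qed
  then have iso: "(\<lambda>C. the_elem (xy ` C)) \<in> iso (G Mod center G) int_vec_group"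
    using xy.FactGroup_iso_set unfolding ker by blast
  have elem: "the_elem (xy ` (center G #> x)) = xy x" if "x \<in> carrier G" for x
  proof -
    have "xy ` (center G #> x) = {xy x}"
    proof -
      have "xy (z \<otimes> x) = xy x" if "z \<in> center G" for z
        using that \<open>x \<in> carrier G\<close> by (auto simp: center_eq xy vec_eq_iff forall_2)
      then have "xy ` (center G #> x) \<subseteq> {xy x}" by (auto simp: r_coset_def)
      moreover have "xy x \<in> xy ` (center G #> x)"
        by (rule imageI[OF rcos_self[OF \<open>x \<in> carrier G\<close> center_subgroup]])
      ultimately show ?thesis by blast
    qed
    then show ?thesis by simp
  qed
  have fxy: "xy (f x) = B *v xy x" if xG: "x \<in> carrier G" for x
  proof -
    obtain m n k where x: "x = E m n k" using coords[OF xG] by blast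
    have "f x = f a [^] m \<otimes> f b [^] n \<otimes> c [^] k" by (simp add: x E_def f.hom_int_pow fc)
    then have "xy (f x) = m *s xy (f a) + n *s xy (f b) + xy (c [^] k)"
      by (simp add: xy.hom_int_pow int_vec_group_pow)
    then show ?thesis
      unfolding E_gens(5)[symmetric] fa fb x xy by (simp add: vec_eq_iff forall_2 matrix2_simps)
  qed
  have "the_elem (xy ` (f ` C)) = B *v the_elem (xy ` C)" if C: "C \<in> carrier (G Mod center G)" for C
  proof -
    obtain x where x: "x \<in> carrier G" "C = center G #> x" using C by (auto simp: FactGroup_def RCOSETS_def)
    show ?thesis using x by (simp add: auto_center_coset[OF f] elem fxy)
  qed
  then show ?thesis
    unfolding induces_hyperbolic_def by (intro bexI[OF _ iso] bexI[OF _ B] ballI)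
qed

section \<open>The normal form of discrete split oscillator groups\<close>

text \<open>In adapted coordinates the automorphism has the shape required of \<open>\<phi>(\<delta>)\<close>, and the central parts of the
  images of the two generators are read off as \<open>l\<close>. It fixes \<open>\<gamma>\<close>, because it acts on commutators by \<open>det B = 1\<close>.\<close>

lemma discrete_split_oscillator_normal_form:
  assumes "discrete_split_oscillator_group G"
  obtains r B l where "r \<ge> 1" "B \<in> hyperbolic_SL2Z" "Osc r B l \<cong> G"
proof -
  obtain H :: "'a monoid" and r \<phi> where G: "group G" and H: "group H" and r: "r \<ge> 1"
    and H_heis: "H \<cong> heisenberg_group r" and \<phi>: "\<phi> \<in> hom integer_group (AutoGroup H)"
    and ind: "induces_hyperbolic H (\<phi> 1)" and G_iso: "G \<cong> semidirect_product H integer_group \<phi>"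
    using assms unfolding discrete_split_oscillator_group_def by blast
  obtain \<psi> B where \<psi>: "\<psi> \<in> iso (H Mod center H) int_vec_group" and B: "B \<in> hyperbolic_SL2Z"
    and \<psi>B: "\<And>C. C \<in> carrier (H Mod center H) \<Longrightarrow> \<psi> (\<phi> 1 ` C) = B *v \<psi> C"
    using ind unfolding induces_hyperbolic_def by blast
  have det: "det B = 1" using B by (simp add: hyperbolic_SL2Z_def)
  interpret A: int_action H \<phi> using H \<phi> by (intro int_action.intro int_action_axioms.intro)
  obtain h where h: "h \<in> iso (heisenberg_group r) H"
    using group.iso_sym[OF H H_heis] by (auto simp: is_iso_def)
  interpret H0: heis_coords H "h (heis_elem r Gen_alpha)" "h (heis_elem r Gen_beta)" "h (heis_elem r Gen_gamma)" "int r"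
    by (rule heis_coords_iso[OF heis_coords_heisenberg[OF r] H h])
  obtain a b c where coords: "heis_coords H a b c (int r)"
    and \<psi>E: "\<And>m n k. \<psi> (center H #>\<^bsub>H\<^esub> heis_triple.E H a b c m n k) = vector [m, n]"
    using H0.adapted_coords[OF \<psi>] by blast
  interpret H1: heis_coords H a b c "int r" by (rule coords)
  let ?f = "\<phi> 1"
  have f_auto: "?f \<in> auto H" by (rule A.action_auto)
  have fE: "\<exists>k'. ?f (H1.E m n k) = H1.E (B$1$1 * m + B$1$2 * n) (B$2$1 * m + B$2$2 * n) k'" for m n k
  proof -
    obtain m' n' k' where e: "?f (H1.E m n k) = H1.E m' n' k'" using H1.coords[of "?f (H1.E m n k)"] by auto
    have "center H #>\<^bsub>H\<^esub> H1.E m n k \<in> carrier (H Mod center H)" by (auto simp: FactGroup_def RCOSETS_def)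
    then have "\<psi> (center H #>\<^bsub>H\<^esub> H1.E m' n' k') = B *v \<psi> (center H #>\<^bsub>H\<^esub> H1.E m n k)"
      using \<psi>B[of "center H #>\<^bsub>H\<^esub> H1.E m n k"] by (simp add: H0.auto_center_coset[OF f_auto] e)
    then have "vector [m', n'] = B *v vector [m, n]" unfolding \<psi>E .
    then have "m' = B$1$1 * m + B$1$2 * n" "n' = B$2$1 * m + B$2$2 * n"
      by (simp_all add: vec_eq_iff forall_2 matrix2_simps)
    then show ?thesis using e by blast
  qed
  obtain p where fa: "?f a = H1.E (B$1$1) (B$2$1) p" using fE[of 1 0 0] by (auto simp: H1.E_gens)
  obtain q where fb: "?f b = H1.E (B$1$2) (B$2$2) q" using fE[of 0 1 0] by (auto simp: H1.E_gens)
  obtain e where fc: "?f c = H1.E 0 0 e" using fE[of 0 0 1] by (auto simp: H1.E_gens)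
  have "?f a \<otimes>\<^bsub>H\<^esub> ?f b = ?f (c [^]\<^bsub>H\<^esub> int r) \<otimes>\<^bsub>H\<^esub> (?f b \<otimes>\<^bsub>H\<^esub> ?f a)"
    using arg_cong[OF H1.ab, of ?f] by (simp add: A.action_mult)
  moreover have "?f (c [^]\<^bsub>H\<^esub> int r) = H1.E 0 0 (e * int r)"
  proof -
    interpret f: group_hom H H ?f by unfold_locales (rule A.action_hom)
    show ?thesis by (simp add: f.hom_int_pow fc H1.E_gens A.int_pow_pow)
  qed
  ultimately have "H1.E 0 0 (int r * (B$1$1 * B$2$2 - B$1$2 * B$2$1)) \<otimes>\<^bsub>H\<^esub> (?f b \<otimes>\<^bsub>H\<^esub> ?f a)
      = H1.E 0 0 (e * int r) \<otimes>\<^bsub>H\<^esub> (?f b \<otimes>\<^bsub>H\<^esub> ?f a)"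
    unfolding fa fb by (metis H1.E_commutator)
  then have "int r * (B$1$1 * B$2$2 - B$1$2 * B$2$1) = e * int r"
    unfolding fa fb by (simp add: H1.E_mult H1.E_inj)
  then have "e = 1" using det r by (simp add: det_2)
  then have fc': "?f c = c" using fc by (simp add: H1.E_gens)
  \<comment> \<open>The signs and the order are those of the definition of \<open>Osc\<close>.\<close>
  define l :: "int ^ 2" where "l = vector [q, - p]"
  let ?HH = "heisenberg_group r" and ?o = "osc_aut r B l"
  have is_osc: "is_osc_aut r B l ?o"
    unfolding osc_aut_def by (rule theI'[OF ex1_osc_aut[OF det]])
  have o: "?o \<in> auto ?HH" using is_osc by (simp add: is_osc_aut_def Let_def)
  then have oh: "?o \<in> hom ?HH ?HH" by (simp add: auto_def)
  interpret HH: heis_coords ?HH "heis_elem r Gen_alpha" "heis_elem r Gen_beta" "heis_elem r Gen_gamma" "int r"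
    by (rule heis_coords_heisenberg[OF r])
  have oE: "?o (heis_elem r Gen_alpha) = HH.E (B$1$1) (B$2$1) p" "?o (heis_elem r Gen_beta) = HH.E (B$1$2) (B$2$2) q"
    "?o (heis_elem r Gen_gamma) = heis_elem r Gen_gamma"
    using is_osc by (simp_all add: is_osc_aut_def Let_def HH.E_def l_def)
  obtain \<theta> where \<theta>: "\<theta> \<in> iso ?HH H" "\<theta> (heis_elem r Gen_alpha) = a" "\<theta> (heis_elem r Gen_beta) = b" "\<theta> (heis_elem r Gen_gamma) = c"
    by (rule heis_coords_iso_heisenberg[OF coords])
  have \<theta>h: "\<theta> \<in> hom ?HH H" using \<theta>(1) by (rule iso_imp_homomorphism)
  have \<theta>E: "\<theta> (HH.E m n k) = H1.E m n k" for m n k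
    using hom_E[OF HH.heis_triple_axioms _ \<theta>h, of m n k] H1.heis_triple_axioms by (simp add: \<theta>)
  have eq: "\<theta> (?o x) = ?f (\<theta> x)" if "x \<in> carrier ?HH" for x
  proof -
    have "(\<theta> \<circ> ?o) x = (?f \<circ> \<theta>) x"
      by (rule heisenberg_hom_eq[OF H hom_compose[OF oh \<theta>h] hom_compose[OF \<theta>h A.action_hom] _ _ _ that])
        (simp_all add: oE \<theta> \<theta>E fa fb fc')
    then show ?thesis by simp
  qed
  note act = pow_int_action[OF HH.is_group o]
  have "map_prod \<theta> id \<in> iso (Osc r B l) (semidirect_product H integer_group \<phi>)"
    unfolding Osc_def
    by (rule semidirect_map(3)[OF act(1) A.int_action_axioms \<theta>h _ \<theta>(1)]) (simp add: act(2) eq)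
  then have "Osc r B l \<cong> semidirect_product H integer_group \<phi>" by (rule is_isoI)
  also have "\<dots> \<cong> G" by (rule group.iso_sym[OF G G_iso])
  finally show thesis using that r B by blast
qed

section \<open>Oscillator groups inside the model\<close>

context
  fixes r :: nat and B :: "int ^ 2 ^ 2" and l :: "int ^ 2"
  assumes r: "r \<ge> 1" and B: "B \<in> hyperbolic_SL2Z"
begin

interpretation HH: heis_coords "heisenberg_group r" "heis_elem r Gen_alpha" "heis_elem r Gen_beta" "heis_elem r Gen_gamma" "int r"
  by (rule heis_coords_heisenberg[OF r])

private abbreviation (input) "HH \<equiv> heisenberg_group r"
private abbreviation (input) "osc \<equiv> osc_aut r B l"

lemma det_tr: "det B = 1" "trace B > 2" using B by (simp_all add: hyperbolic_SL2Z_def)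

lemma osc_aut_props:
  shows "osc \<in> auto HH" "osc \<in> hom HH HH"
    "osc (heis_elem r Gen_alpha) = HH.E (B$1$1) (B$2$1) (- (l$2))"
    "osc (heis_elem r Gen_beta) = HH.E (B$1$2) (B$2$2) (l$1)"
    "osc (heis_elem r Gen_gamma) = heis_elem r Gen_gamma"
proof -
  have "is_osc_aut r B l osc" unfolding osc_aut_def by (rule theI'[OF ex1_osc_aut[OF det_tr(1)]])
  then show "osc \<in> auto HH"
    "osc (heis_elem r Gen_alpha) = HH.E (B$1$1) (B$2$1) (- (l$2))"
    "osc (heis_elem r Gen_beta) = HH.E (B$1$2) (B$2$2) (l$1)"
    "osc (heis_elem r Gen_gamma) = heis_elem r Gen_gamma"
    by (simp_all add: is_osc_aut_def Let_def HH.E_def)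
  then show "osc \<in> hom HH HH" by (simp add: auto_def)
qed

lemmas osc_act = pow_int_action[OF HH.is_group osc_aut_props(1)]

lemma Osc_group: "group (Osc r B l)"
  unfolding Osc_def by (rule int_action.semidirect_group[OF osc_act(1)])

text \<open>The embedding sends \<open>\<alpha>, \<beta>, \<gamma>\<close> to \<open>(D r e\<^sub>1, D e1)\<close>, \<open>(D r e\<^sub>2, D e2)\<close> and \<open>(0, 2 r D\<^sup>2)\<close>. It has to turn the
  automorphism of \<open>Osc\<close> into the linear action of \<open>B\<close>. This is the linear system \<open>lin1\<close>, \<open>lin2\<close> for the central
  parameters, whose determinant is \<open>det (B - 1) = - D\<close>. Therefore \<open>D = tr B - 2\<close> is the dilation that makes the solution
  integral, and \<open>e1\<close>, \<open>e2\<close> come from the rule of Cramer.\<close>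

lemma Osc_embedding:
  "\<exists>\<iota> K. \<iota> \<in> hom (Osc r B l) (osc_model B) \<and> inj_on \<iota> (carrier (Osc r B l)) \<and>
    (K :: int) > 0 \<and> (\<forall>v z n. ((K *s v, K\<^sup>2 * z), n) \<in> \<iota> ` carrier (Osc r B l))"
proof -
  define D where "D = trace B - 2"
  define a b c d where abcd: "a = B$1$1" "b = B$1$2" "c = B$2$1" "d = B$2$2"
  define x1 x2 where x: "x1 = (int r)\<^sup>2 * a * c - 2 * int r * l$2" "x2 = (int r)\<^sup>2 * b * d + 2 * int r * l$1"
  define e1 e2 where e: "e1 = (d - 1) * x1 - c * x2" "e2 = (a - 1) * x2 - b * x1"
  have D: "D > 0" using det_tr by (simp add: D_def)
  have ad: "a * d = 1 + b * c" using det_tr(1) by (simp add: det_2 abcd)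
  have Dad: "D = a + d - 2" by (simp add: D_def matrix2_simps abcd)
  have r0: "int r > 0" using r by simp
  let ?a = "(vector [D * r, 0] :: int ^ 2, D * e1)" and ?b = "(vector [0, D * r] :: int ^ 2, D * e2)"
    and ?c = "(0 :: int ^ 2, 2 * int r * D\<^sup>2)"
  note triple = heis_model_triple[where D = D and r = "int r" and ?e1.0 = "D * e1" and ?e2.0 = "D * e2"]
  obtain \<theta> where \<theta>: "\<theta> \<in> hom HH heis_model" and \<theta>g: "\<theta> (heis_elem r Gen_alpha) = ?a" "\<theta> (heis_elem r Gen_beta) = ?b"
    "\<theta> (heis_elem r Gen_gamma) = ?c"
    by (rule heisenberg_universal[OF triple(1)])
  have \<theta>E: "\<theta> (HH.E m n k) = (vector [D * r * m, D * r * n],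
      m * (D * e1) + n * (D * e2) + D\<^sup>2 * (int r)\<^sup>2 * m * n + 2 * int r * D\<^sup>2 * k)" for m n k
    using hom_E[OF HH.heis_triple_axioms _ \<theta>, of m n k] triple by (simp only: \<theta>g)
  have lin1: "a * (D * e1) + c * (D * e2) + D\<^sup>2 * x1 = D * e1"
  proof -
    have "(a - 1) * e1 + c * e2 + D * x1 = (a * d - 1 - b * c) * x1"
      by (simp add: e Dad algebra_simps)
    then have "(a - 1) * e1 + c * e2 + D * x1 = 0" by (simp add: ad)
    then have "D * ((a - 1) * e1 + c * e2 + D * x1) = 0" by simp
    then show ?thesis by (simp add: power2_eq_square algebra_simps)
  qed
  have lin2: "b * (D * e1) + d * (D * e2) + D\<^sup>2 * x2 = D * e2"
  proof -
    have "b * e1 + (d - 1) * e2 + D * x2 = (a * d - 1 - b * c) * x2"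
      by (simp add: e Dad algebra_simps)
    then have "b * e1 + (d - 1) * e2 + D * x2 = 0" by (simp add: ad)
    then have "D * (b * e1 + (d - 1) * e2 + D * x2) = 0" by simp
    then show ?thesis by (simp add: power2_eq_square algebra_simps)
  qed
  have gen: "\<theta> (osc x) = osc_action B 1 (\<theta> x)" if "x \<in> carrier HH" for x
  proof -
    have "(\<theta> \<circ> osc) x = (osc_action B 1 \<circ> \<theta>) x"
    proof (rule heisenberg_hom_eq[OF HM.is_group hom_compose[OF osc_aut_props(2) \<theta>]
          hom_compose[OF \<theta> int_action.action_hom[OF osc_action[OF det_tr(1)]]] _ _ _ that])
      show "(\<theta> \<circ> osc) (heis_elem r Gen_alpha) = (osc_action B 1 \<circ> \<theta>) (heis_elem r Gen_alpha)"
      using lin1 by (simp add: osc_aut_props \<theta>E \<theta>g osc_action_1 vec_eq_iff forall_2 matrix2_simps x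
          flip: abcd) (simp add: algebra_simps power2_eq_square)
      show "(\<theta> \<circ> osc) (heis_elem r Gen_beta) = (osc_action B 1 \<circ> \<theta>) (heis_elem r Gen_beta)"
      using lin2 by (simp add: osc_aut_props \<theta>E \<theta>g osc_action_1 vec_eq_iff forall_2 matrix2_simps x
          flip: abcd) (simp add: algebra_simps power2_eq_square)
      show "(\<theta> \<circ> osc) (heis_elem r Gen_gamma) = (osc_action B 1 \<circ> \<theta>) (heis_elem r Gen_gamma)"
      by (simp add: osc_aut_props \<theta>g osc_action_1)
    qed
    then show ?thesis by simp
  qed
  have inj: "inj_on \<theta> (carrier HH)"
  proof (rule inj_onI)
    fix x y assume xy: "x \<in> carrier HH" "y \<in> carrier HH" "\<theta> x = \<theta> y"
    obtain m n k where x: "x = HH.E m n k" using HH.coords[OF xy(1)] by blast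
    obtain m' n' k' where y: "y = HH.E m' n' k'" using HH.coords[OF xy(2)] by blast
    show "x = y" using xy(3) D r0 by (auto simp: x y \<theta>E HH.E_inj vec_eq_iff forall_2)
  qed
  note act = osc_act
  have map: "map_prod \<theta> id \<in> hom (Osc r B l) (osc_model B)" "inj_on (map_prod \<theta> id) (carrier (Osc r B l))"
    unfolding Osc_def osc_model_def
    using semidirect_map(1,2)[OF act(1) osc_action[OF det_tr(1)] \<theta>] act(2) gen inj by auto
  \<comment> \<open>The equation \<open>K v = D r m\<close> gives \<open>m = 2 r D v\<close>. This makes the central parts \<open>m D e1\<close> and \<open>n D e2\<close> divisible by
    \<open>2 r D\<^sup>2\<close>, the amount by which \<open>\<gamma>\<close> moves the centre.\<close>
  define K where "K = 2 * (int r)\<^sup>2 * D\<^sup>2"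
  have "((K *s v, K\<^sup>2 * z), n) \<in> map_prod \<theta> id ` carrier (Osc r B l)" for v z n
  proof -
    define m1 m2 where m: "m1 = 2 * int r * D * v$1" "m2 = 2 * int r * D * v$2"
    define k where "k = 2 * (int r)^3 * D\<^sup>2 * z - (v$1 * e1 + v$2 * e2 + 2 * (int r)^3 * D\<^sup>2 * v$1 * v$2)"
    have "\<theta> (HH.E m1 m2 k) = (K *s v, K\<^sup>2 * z)"
      by (simp add: \<theta>E m k_def K_def vec_eq_iff forall_2 power2_eq_square power3_eq_cube algebra_simps)
    then have "((K *s v, K\<^sup>2 * z), n) = map_prod \<theta> id (HH.E m1 m2 k, n)" by simp
    moreover have "(HH.E m1 m2 k, n) \<in> carrier (Osc r B l)" by (simp add: Osc_def semidirect_product_def)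
    ultimately show ?thesis by (rule image_eqI)
  qed
  moreover have "K > 0" using D r0 by (simp add: K_def)
  ultimately show ?thesis using map by blast
qed

text \<open>A dilation commutes with \<open>B\<close>, so it embeds the model into itself with finite index, and its image can be pulled back along
  the embedding of \<open>Osc\<^sup>r(B, l)\<close>.\<close>

lemma Osc_virtual_model: "virtually_embeds (osc_model B) (Osc r B l)"
proof -
  obtain \<iota> K where \<iota>: "\<iota> \<in> hom (Osc r B l) (osc_model B)" "inj_on \<iota> (carrier (Osc r B l))"
    "(K :: int) > 0" "\<And>v z n. ((K *s v, K\<^sup>2 * z), n) \<in> \<iota> ` carrier (Osc r B l)" using Osc_embedding by blast
  define P :: "int ^ 2 ^ 2" where "P = vector [vector [K, 0], vector [0, K]]"
  have P: "det P = K\<^sup>2" "P *v v = K *s v" for v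
    by (simp_all add: P_def det_2 vec_eq_iff forall_2 matrix2_simps power2_eq_square)
  have com: "B ** P = P ** B" by (simp add: P_def vec_eq_iff forall_2 matrix2_simps)
  have P0: "det P \<noteq> 0" using \<iota>(3) P by simp
  note sim = osc_model_similar[OF det_tr(1) det_tr(1) P0 com]
  obtain Q where Q: "finite Q" "\<forall>g. \<exists>x\<in>Q. \<exists>k. g = x \<otimes>\<^bsub>osc_model B\<^esub> (\<lambda>((v, z), n). ((P *v v, det P * z), n)) k"
    using sim(3) by blast
  show ?thesis
  proof (rule virtually_embeds_through[OF osc_model_group Osc_group osc_model_group \<iota>(1,2) sim(1,2) Q(1)])
    show "(\<lambda>((v, z), n). ((P *v v, det P * z), n)) ` carrier (osc_model B) \<subseteq> \<iota> ` carrier (Osc r B l)"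
      using \<iota>(4) by (auto simp: P)
  qed (use Q det_tr in auto)
qed

end

lemma Osc_iso_commensurable:
  assumes B: "r \<ge> 1" "B \<in> hyperbolic_SL2Z" and B': "r' \<ge> 1" "B' \<in> hyperbolic_SL2Z"
    and G: "group G" "Osc r B l \<cong> G" and G': "group G'" "Osc r' B' l' \<cong> G'"
    and eq: "trace_field (trace B) = trace_field (trace B')"
  shows "abstractly_commensurable G G'"
proof -
  have *: "virtually_embeds (osc_model C) G"
    if "r \<ge> 1" "B \<in> hyperbolic_SL2Z" "Osc r B l \<cong> G" "virtually_embeds (osc_model C) (osc_model B)"
    for r B l C and G :: "'c monoid"
    by (rule virtually_embeds_iso[OF Osc_group[OF that(1,2)] _ that(3)],
        rule virtually_embeds_trans[OF Osc_group[OF that(1,2)] that(4) Osc_virtual_model[OF that(1,2)]])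
  obtain C where C: "det C = 1" "virtually_embeds (osc_model C) (osc_model B)" "virtually_embeds (osc_model C) (osc_model B')"
    using common_virtual_model[of B B'] B B' eq by (auto simp: hyperbolic_SL2Z_def)
  show ?thesis
    by (rule common_virtual_subgroup_commensurable[OF osc_model_group[OF C(1)] G(1) G'(1)])
      (use *[OF B G(2) C(2)] *[OF B' G'(2) C(3)] in auto)
qed

text \<open>In the model, a finite-index subgroup still contains powers of the images of \<open>\<delta>\<close> and of a
  noncentral element of the Heisenberg part.\<close>

lemma finite_index_twist_traces:
  assumes B: "r \<ge> 1" "B \<in> hyperbolic_SL2Z" and G: "group G" "Osc r B l \<cong> G"
    and H: "subgroup H G" "finite (rcosets\<^bsub>G\<^esub> H)"
  shows "twist_traces (G\<lparr>carrier := H\<rparr>) \<noteq> {}"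
    and "t \<in> twist_traces (G\<lparr>carrier := H\<rparr>) \<Longrightarrow> trace_field t = trace_field (trace B)"
proof -
  have dt: "det B = 1" "trace B > 2" using B by (simp_all add: hyperbolic_SL2Z_def)
  let ?S = "osc_model B"
  obtain \<iota>0 K where \<iota>0: "\<iota>0 \<in> hom (Osc r B l) ?S" "inj_on \<iota>0 (carrier (Osc r B l))"
    "(K :: int) > 0" "\<And>v z n. ((K *s v, K\<^sup>2 * z), n) \<in> \<iota>0 ` carrier (Osc r B l)"
    using Osc_embedding[OF B, where l = l] by blast
  obtain g where g: "g \<in> iso G (Osc r B l)"
    using group.iso_sym[OF Osc_group[OF B] G(2)] by (auto simp: is_iso_def)
  define \<iota> where "\<iota> = \<iota>0 \<circ> g"
  have gi: "g \<in> hom G (Osc r B l)" "g ` carrier G = carrier (Osc r B l)" "inj_on g (carrier G)"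
    using g by (auto simp: iso_iff)
  have \<iota>: "\<iota> \<in> hom G ?S" unfolding \<iota>_def using gi(1) \<iota>0(1) by (rule hom_compose)
  have inj: "inj_on \<iota> (carrier G)" unfolding \<iota>_def using gi \<iota>0(2) by (intro comp_inj_on) auto
  have im: "((K *s v, K\<^sup>2 * z), n) \<in> \<iota> ` carrier G" for v z n
    unfolding \<iota>_def image_comp[symmetric] gi(2) by (rule \<iota>0(4))
  interpret G: group G by fact
  interpret S: group ?S by (rule osc_model_group[OF dt(1)])
  interpret \<iota>: group_hom G ?S \<iota> by unfold_locales (rule \<iota>)
  let ?\<Gamma> = "\<iota> ` H" and ?GH = "G\<lparr>carrier := H\<rparr>"
  have HG: "H \<subseteq> carrier G" by (rule subgroup.subset[OF H(1)])
  have \<Gamma>: "subgroup ?\<Gamma> ?S" by (rule \<iota>.subgroup_img_is_subgroup[OF H(1)])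
  have pow: "\<exists>n>0. x [^]\<^bsub>?S\<^esub> (n::int) \<in> ?\<Gamma>" if x: "x \<in> \<iota> ` carrier G" for x
  proof -
    obtain y where y: "y \<in> carrier G" "x = \<iota> y" using x by blast
    obtain n :: nat where n: "n > 0" "y [^]\<^bsub>G\<^esub> n \<in> H" using finite_index_power[OF G(1) H y(1)] .
    have "x [^]\<^bsub>?S\<^esub> int n = \<iota> (y [^]\<^bsub>G\<^esub> n)" using y by (simp add: int_pow_int \<iota>.hom_nat_pow)
    then show ?thesis using n by (intro exI[of _ "int n"]) auto
  qed
  have "((0, 0), 1) \<in> \<iota> ` carrier G" using im[of 0 0 1] by simp
  then obtain k where k: "k > 0" "((0, 0), 1) [^]\<^bsub>?S\<^esub> (k::int) \<in> ?\<Gamma>" using pow by blast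
  have "((0, 0), 1) [^]\<^bsub>?S\<^esub> k = ((0, 0), k)"
  proof -
    have "(\<lambda>n. ((0, 0), n)) \<in> hom integer_group ?S" by (rule homI) auto
    then interpret e: group_hom integer_group ?S "\<lambda>n. ((0, 0), n)"
      by (simp add: group_hom_def group_hom_axioms_def S.is_group)
    show ?thesis using e.hom_int_pow[of 1 k] by simp
  qed
  then have k': "k \<noteq> 0" "((0, 0), k) \<in> ?\<Gamma>" using k by simp_all
  define v :: "int ^ 2" where "v = vector [1, 0]"
  obtain j where j: "j > 0" "((K *s v, K\<^sup>2 * 0), 0) [^]\<^bsub>?S\<^esub> (j::int) \<in> ?\<Gamma>" using pow[OF im[of v 0 0]] by blast
  then have u: "j *s (K *s v) \<noteq> 0" "((j *s (K *s v), j * (K\<^sup>2 * 0)), 0) \<in> ?\<Gamma>"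
    using \<iota>0(3) unfolding osc_model_int_pow[OF dt] by (simp_all add: v_def vec_eq_iff forall_2)
  note T = twist_traces_model[OF dt \<Gamma> k' u]
  have iso: "\<iota> \<in> iso ?GH (?S\<lparr>carrier := ?\<Gamma>\<rparr>)"
    using inj_on_subset[OF inj HG] by (auto simp: iso_iff hom_def subsetD[OF HG])
  have gr: "group ?GH" "group (?S\<lparr>carrier := ?\<Gamma>\<rparr>)"
    using subgroup.subgroup_is_group H(1) \<Gamma> G(1) S.is_group by blast+
  have "twist_traces ?GH = twist_traces (?S\<lparr>carrier := ?\<Gamma>\<rparr>)"
    using twist_traces_iso[OF gr iso] twist_traces_iso[OF gr(2,1) group.iso_set_sym[OF gr(1) iso]] by blast
  then show "twist_traces ?GH \<noteq> {}" "t \<in> twist_traces ?GH \<Longrightarrow> trace_field t = trace_field (trace B)"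
    using T trace_field_pow[OF dt] by metis+
qed

lemma commensurable_imp_same_field:
  assumes B: "r \<ge> 1" "B \<in> hyperbolic_SL2Z" and B': "r' \<ge> 1" "B' \<in> hyperbolic_SL2Z"
    and G: "group G" "Osc r B l \<cong> G" and G': "group G'" "Osc r' B' l' \<cong> G'"
    and comm: "abstractly_commensurable G G'"
  shows "trace_field (trace B) = trace_field (trace B')"
proof -
  obtain H H' where H: "subgroup H G" "finite (rcosets\<^bsub>G\<^esub> H)" and H': "subgroup H' G'" "finite (rcosets\<^bsub>G'\<^esub> H')"
    and "G\<lparr>carrier := H\<rparr> \<cong> G'\<lparr>carrier := H'\<rparr>"
    using comm unfolding abstractly_commensurable_def by blast
  then obtain h where h: "h \<in> iso (G\<lparr>carrier := H\<rparr>) (G'\<lparr>carrier := H'\<rparr>)" by (auto simp: is_iso_def)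
  have gr: "group (G\<lparr>carrier := H\<rparr>)" "group (G'\<lparr>carrier := H'\<rparr>)"
    using subgroup.subgroup_is_group H(1) H'(1) G(1) G'(1) by blast+
  obtain t where "t \<in> twist_traces (G\<lparr>carrier := H\<rparr>)" using finite_index_twist_traces(1)[OF B G H] by blast
  then show ?thesis
    using twist_traces_iso[OF gr h] finite_index_twist_traces(2)[OF B G H] finite_index_twist_traces(2)[OF B' G' H']
    by (metis subsetD)
qed

section \<open>Copies on a given infinite type\<close>

lemma image_group_copy:
  assumes "group G" "inj_on j (carrier G)"
  shows "group (image_group j G)" "j \<in> iso G (image_group j G)"
  using group.inj_imp_image_group_is_group[OF assms] inj_imp_image_group_iso[OF assms(2)] .

lemma countable_inj_into_infinite:
  assumes "infinite (UNIV :: 'a set)" "countable A"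
  obtains j :: "'b \<Rightarrow> 'a" where "inj_on j A"
proof -
  obtain f :: "nat \<Rightarrow> 'a" where "inj f" using infinite_countable_subset[OF assms(1)] by blast
  then have "inj_on (f \<circ> to_nat_on A) A"
    using inj_on_to_nat_on[OF assms(2)] by (intro comp_inj_on) (auto intro: inj_on_subset)
  then show thesis by (rule that)
qed

lemma countable_heisenberg_group:
  assumes "r \<ge> 1"
  shows "countable (carrier (heisenberg_group r))"
proof -
  interpret H: heis_coords "heisenberg_group r" "heis_elem r Gen_alpha" "heis_elem r Gen_beta" "heis_elem r Gen_gamma" "int r"
    by (rule heis_coords_heisenberg[OF assms])
  have "carrier (heisenberg_group r) \<subseteq> range (\<lambda>(m, n, k). H.E m n k)"
  proof
    fix x assume "x \<in> carrier (heisenberg_group r)"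
    then obtain m n k where "x = H.E m n k" using H.coords by blast
    then show "x \<in> range (\<lambda>(m, n, k). H.E m n k)" by (intro image_eqI[of _ _ "(m, n, k)"]) simp_all
  qed
  then show ?thesis by (rule countable_subset) simp
qed

text \<open>Both the Heisenberg group and its semidirect product are copied, since the definition of a discrete split
  oscillator group asks for the Heisenberg factor on the same type.\<close>

lemma Osc_copy:
  assumes inf: "infinite (UNIV :: 'a set)" and r: "r \<ge> 1" and B: "B \<in> hyperbolic_SL2Z"
  obtains G :: "'a monoid" where "discrete_split_oscillator_group G" "Osc r B l \<cong> G"
proof -
  let ?HH = "heisenberg_group r" and ?o = "osc_aut r B l"
  interpret HH: heis_coords ?HH "heis_elem r Gen_alpha" "heis_elem r Gen_beta" "heis_elem r Gen_gamma" "int r"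
    by (rule heis_coords_heisenberg[OF r])
  note o = osc_aut_props[OF r B, where l = l]
  obtain j :: "heis_gen word set \<Rightarrow> 'a" where j: "inj_on j (carrier ?HH)"
    by (rule countable_inj_into_infinite[OF inf countable_heisenberg_group[OF r]])
  define H where "H = image_group j ?HH"
  have H: "group H" and iso: "j \<in> iso ?HH H" unfolding H_def by (rule image_group_copy[OF HH.is_group j])+
  have jh: "j \<in> hom ?HH H" by (rule iso_imp_homomorphism[OF iso])
  interpret H: heis_coords H "j (heis_elem r Gen_alpha)" "j (heis_elem r Gen_beta)" "j (heis_elem r Gen_gamma)" "int r"
    by (rule heis_coords_iso[OF HH.heis_coords_axioms H iso])
  note E = hom_E[OF HH.heis_triple_axioms H.heis_triple_axioms jh]
  define f where "f = (\<lambda>y\<in>carrier H. j (?o (inv_into (carrier ?HH) j y)))"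
  have fj: "f (j x) = j (?o x)" if "x \<in> carrier ?HH" for x
    using that j hom_in_carrier[OF jh] by (simp add: f_def)
  have "j \<circ> (?o \<circ> inv_into (carrier ?HH) j) \<in> iso H H"
    using o(1) by (intro iso_set_trans[OF _ iso] iso_set_trans[OF HH.iso_set_sym[OF iso]]) (simp add: auto_iff)
  then have "f \<in> iso H H" by (rule H.iso_eq) (simp add: f_def)
  then have f: "f \<in> auto H" by (simp add: auto_iff f_def)
  define \<phi> where "\<phi> = (\<lambda>n::int. f [^]\<^bsub>AutoGroup H\<^esub> n)"
  interpret A: int_action H \<phi> unfolding \<phi>_def by (rule pow_int_action(1)[OF H f])
  have \<phi>1: "\<phi> 1 = f"
  proof -
    interpret AG: group "AutoGroup H" by (rule H.AutoGroup)
    show ?thesis unfolding \<phi>_def using f by (simp add: AutoGroup_simps)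
  qed
  have ind: "induces_hyperbolic H (\<phi> 1)"
    unfolding \<phi>1 by (rule H.induces_hyperbolicI[OF f B]) (simp_all add: fj o E)
  have Osc_iso: "Osc r B l \<cong> A.SD"
    unfolding Osc_def
    by (rule is_isoI, rule semidirect_map(3)[OF pow_int_action(1)[OF HH.is_group o(1)] A.int_action_axioms jh _ iso])
      (simp add: pow_int_action(2)[OF HH.is_group o(1)] \<phi>1 fj)
  have "countable (carrier A.SD)"
    unfolding A.semidirect_simps(1) using countable_heisenberg_group[OF r] by (simp add: H_def image_group_carrier)
  then obtain i :: "'a \<times> int \<Rightarrow> 'a" where i: "inj_on i (carrier A.SD)"
    by (rule countable_inj_into_infinite[OF inf])
  define G where "G = image_group i A.SD"
  have G: "group G" and "i \<in> iso A.SD G" unfolding G_def by (rule image_group_copy[OF A.semidirect_group i])+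
  then have SG: "A.SD \<cong> G" by (blast intro: is_isoI)
  have "discrete_split_oscillator_group G"
    unfolding discrete_split_oscillator_group_def
  proof (intro conjI exI)
    show "H \<cong> heisenberg_group r" by (rule HH.iso_sym[OF is_isoI[OF iso]])
    show "G \<cong> A.SD" by (rule group.iso_sym[OF A.semidirect_group SG])
  qed (use G H r A.hom_Auto ind in auto)
  then show thesis using that iso_trans[OF Osc_iso SG] by blast
qed

section \<open>The classification\<close>

definition osc_field :: "'a monoid \<Rightarrow> real set" where
  "osc_field G = (THE K. \<exists>r\<ge>1. \<exists>B\<in>hyperbolic_SL2Z. \<exists>l. Osc r B l \<cong> G \<and> K = trace_field (trace B))"

lemma isomorphic_imp_commensurable:
  assumes "group G" "group G'" "G \<cong> G'"
  shows "abstractly_commensurable G G'"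
proof -
  interpret group G by fact
  have "virtually_embeds G G"
    by (rule virtually_embedsI[of "\<lambda>x. x" _ _ "{\<one>\<^bsub>G\<^esub>}"]) (auto simp: hom_def)
  then show ?thesis
    using virtually_embeds_iso[OF assms(1) _ assms(3)]
    by (intro common_virtual_subgroup_commensurable[OF assms(1) assms(1,2)]) auto
qed

lemma osc_field_eq:
  assumes G: "group G" and B: "r \<ge> 1" "B \<in> hyperbolic_SL2Z" "Osc r B l \<cong> G"
  shows "osc_field G = trace_field (trace B)"
  unfolding osc_field_def
proof (rule the_equality)
  show "\<exists>r\<ge>1. \<exists>C\<in>hyperbolic_SL2Z. \<exists>l. Osc r C l \<cong> G \<and> trace_field (trace B) = trace_field (trace C)"
    using B by blast
  fix K assume "\<exists>r\<ge>1. \<exists>B\<in>hyperbolic_SL2Z. \<exists>l. Osc r B l \<cong> G \<and> K = trace_field (trace B)"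
  then obtain r' B' l' where B': "r' \<ge> 1" "B' \<in> hyperbolic_SL2Z" "Osc r' B' l' \<cong> G" "K = trace_field (trace B')"
    by blast
  show "K = trace_field (trace B)"
    unfolding B'(4)
    by (rule commensurable_imp_same_field[OF B'(1,2) B(1,2) G B'(3) G B(3) isomorphic_imp_commensurable[OF G G iso_refl]])
qed

lemma osc_groups_normal_form:
  assumes "G \<in> osc_groups"
  obtains r B l where "group G" "r \<ge> 1" "B \<in> hyperbolic_SL2Z" "Osc r B l \<cong> G" "osc_field G = trace_field (trace B)"
proof -
  have G: "discrete_split_oscillator_group G" using assms by (simp add: osc_groups_def)
  then have g: "group G" by (simp add: discrete_split_oscillator_group_def)
  obtain r B l where "r \<ge> 1" "B \<in> hyperbolic_SL2Z" "Osc r B l \<cong> G"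
    by (rule discrete_split_oscillator_normal_form[OF G])
  then show thesis using that g osc_field_eq[OF g] by blast
qed

lemma commensurable_iff_osc_field:
  assumes "G \<in> osc_groups" "G' \<in> osc_groups"
  shows "abstractly_commensurable G G' \<longleftrightarrow> osc_field G = osc_field G'"
proof -
  obtain r B l where G: "group G" "r \<ge> 1" "B \<in> hyperbolic_SL2Z" "Osc r B l \<cong> G" "osc_field G = trace_field (trace B)"
    using osc_groups_normal_form[OF assms(1)] .
  obtain r' B' l' where G': "group G'" "r' \<ge> 1" "B' \<in> hyperbolic_SL2Z" "Osc r' B' l' \<cong> G'" "osc_field G' = trace_field (trace B')"
    using osc_groups_normal_form[OF assms(2)] .
  show ?thesis
    using Osc_iso_commensurable[OF G(2,3) G'(2,3) G(1,4) G'(1,4)]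
      commensurable_imp_same_field[OF G(2,3) G'(2,3) G(1,4) G'(1,4)] G(5) G'(5) by auto
qed

lemma isomorphic_osc_field:
  assumes "G \<in> osc_groups" "G' \<in> osc_groups" "G \<cong> G'"
  shows "osc_field G = osc_field G'"
proof -
  have "group G" "group G'" using assms by (simp_all add: osc_groups_def discrete_split_oscillator_group_def)
  then show ?thesis using isomorphic_imp_commensurable commensurable_iff_osc_field assms by blast
qed

lemma Q_adjoin_eigenvalue:
  assumes "B \<in> hyperbolic_SL2Z" "real_eigenvalue B \<mu>"
  shows "Q_adjoin \<mu> = trace_field (trace B)"
  using assms eigenvalue_root[of B \<mu>] Q_adjoin_norm_one_root[of "trace B" \<mu>] by (simp add: hyperbolic_SL2Z_def)

lemma osc_field_real_quadratic:
  assumes "G \<in> osc_groups"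
  shows "osc_field G \<in> real_quadratic_fields"
proof -
  obtain r B l where G: "group G" "r \<ge> 1" "B \<in> hyperbolic_SL2Z" "Osc r B l \<cong> G" "osc_field G = trace_field (trace B)"
    using osc_groups_normal_form[OF assms] .
  then show ?thesis using trace_field_real_quadratic[of "trace B"] by (simp add: hyperbolic_SL2Z_def)
qed

lemma osc_iso_classes_eq: "osc_iso_classes = (osc_iso_class :: 'a monoid \<Rightarrow> 'a monoid set) ` osc_groups"
  unfolding osc_iso_classes_def quotient_def UNION_singleton_eq_range
  by (rule image_cong) (auto simp: osc_iso_class_def)

lemma osc_comm_classes_eq: "osc_comm_classes = osc_comm_class ` osc_groups"
  unfolding osc_comm_classes_def quotient_def UNION_singleton_eq_range
  by (rule image_cong) (auto simp: osc_comm_class_def)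

lemma osc_iso_class_cong:
  fixes G' :: "'a monoid"
  assumes "group G" "G \<cong> G'"
  shows "(osc_iso_class G :: 'a monoid set) = osc_iso_class G'"
  using iso_trans[OF group.iso_sym[OF assms]] iso_trans[OF assms(2)] by (auto simp: osc_iso_class_def)

lemma osc_field_some:
  fixes G :: "'a monoid"
  assumes G: "G \<in> osc_groups"
  shows "osc_field (SOME G' :: 'a monoid. G' \<in> osc_iso_class G) = osc_field G"
    and "osc_field (SOME G'. G' \<in> osc_comm_class G) = osc_field G"
proof -
  have "G \<in> (osc_iso_class G :: 'a monoid set)" using G by (simp add: osc_iso_class_def)
  then have "(SOME G' :: 'a monoid. G' \<in> osc_iso_class G) \<in> osc_iso_class G" by (rule someI)
  then show "osc_field (SOME G' :: 'a monoid. G' \<in> osc_iso_class G) = osc_field G"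
    using isomorphic_osc_field[OF G] by (auto simp: osc_iso_class_def)
  have "G \<in> osc_comm_class G" using G commensurable_iff_osc_field by (auto simp: osc_comm_class_def)
  then have "(SOME G'. G' \<in> osc_comm_class G) \<in> osc_comm_class G" by (rule someI)
  then show "osc_field (SOME G'. G' \<in> osc_comm_class G) = osc_field G"
    using commensurable_iff_osc_field[OF G] by (auto simp: osc_comm_class_def)
qed

lemma osc_field_map_value:
  fixes G :: "'a monoid" and F :: "'a monoid set \<Rightarrow> real set"
  assumes F: "is_osc_field_map F" and G: "G \<in> osc_groups"
  shows "F (osc_iso_class G) = osc_field G"
proof -
  obtain r B l where B: "group G" "r \<ge> 1" "B \<in> hyperbolic_SL2Z" "Osc r B l \<cong> G" "osc_field G = trace_field (trace B)"
    using osc_groups_normal_form[OF G] .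
  have ev: "real_eigenvalue B (large_root (trace B))"
    using B(3) by (intro real_eigenvalue_ex) (simp_all add: hyperbolic_SL2Z_def)
  have "F (osc_iso_class (Osc r B l)) = Q_adjoin (large_root (trace B))"
    using F B(2,3) ev unfolding is_osc_field_map_def by blast
  moreover have "(osc_iso_class (Osc r B l) :: 'a monoid set) = osc_iso_class G"
    by (rule osc_iso_class_cong[OF Osc_group[OF B(2,3)] B(4)])
  ultimately show ?thesis using Q_adjoin_eigenvalue[OF B(3) ev] B(5) by simp
qed

lemma osc_field_map_ex:
  assumes inf: "infinite (UNIV :: 'a set)"
  shows "is_osc_field_map (\<lambda>C :: 'a monoid set\<in>osc_iso_classes. osc_field (SOME G. G \<in> C))"
  unfolding is_osc_field_map_def
proof (intro conjI allI impI ballI)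
  show "(\<lambda>C :: 'a monoid set\<in>osc_iso_classes. osc_field (SOME G. G \<in> C)) \<in> osc_iso_classes \<rightarrow>\<^sub>E real_quadratic_fields"
    by (auto simp: osc_iso_classes_eq osc_field_some osc_field_real_quadratic)
  fix r :: nat and B l \<mu> assume r: "1 \<le> r" and B: "B \<in> hyperbolic_SL2Z" and \<mu>: "real_eigenvalue B \<mu>"
  obtain G :: "'a monoid" where G: "discrete_split_oscillator_group G" "Osc r B l \<cong> G"
    by (rule Osc_copy[OF inf r B])
  have G': "G \<in> osc_groups" "group G" using G(1) by (simp_all add: osc_groups_def discrete_split_oscillator_group_def)
  have "(osc_iso_class (Osc r B l) :: 'a monoid set) = osc_iso_class G"
    by (rule osc_iso_class_cong[OF Osc_group[OF r B] G(2)])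
  then show "(\<lambda>C :: 'a monoid set\<in>osc_iso_classes. osc_field (SOME G. G \<in> C)) (osc_iso_class (Osc r B l)) = Q_adjoin \<mu>"
    using G' osc_field_some(1)[OF G'(1)] osc_field_eq[OF G'(2) r B G(2)] Q_adjoin_eigenvalue[OF B \<mu>]
    by (simp add: osc_iso_classes_eq)
qed

lemma osc_comm_classes_bij:
  assumes inf: "infinite (UNIV :: 'a set)"
  shows "bij_betw (\<lambda>C :: 'a monoid set. osc_field (SOME G. G \<in> C)) osc_comm_classes real_quadratic_fields"
  unfolding bij_betw_def
proof
  show "inj_on (\<lambda>C :: 'a monoid set. osc_field (SOME G. G \<in> C)) osc_comm_classes"
    unfolding osc_comm_classes_eq
  proof (rule inj_onI, elim imageE)
    fix C C' :: "'a monoid set" and G G' :: "'a monoid"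
    assume eq: "osc_field (SOME G. G \<in> C) = osc_field (SOME G. G \<in> C')"
      and C: "C = osc_comm_class G" "C' = osc_comm_class G'" and G: "G \<in> osc_groups" "G' \<in> osc_groups"
    have "osc_field G = osc_field G'" using eq by (simp add: C osc_field_some(2) G)
    then have "abstractly_commensurable G K \<longleftrightarrow> abstractly_commensurable G' K" if "K \<in> osc_groups" for K
      using that G by (simp add: commensurable_iff_osc_field)
    then show "C = C'" unfolding C osc_comm_class_def by blast
  qed
  show "(\<lambda>C :: 'a monoid set. osc_field (SOME G. G \<in> C)) ` osc_comm_classes = real_quadratic_fields"
  proof (intro equalityI subsetI)
    fix K assume "K \<in> real_quadratic_fields"
    then obtain t where t: "t > 2" "K = trace_field t" by (rule real_quadratic_field_trace)
    obtain B where B: "B \<in> hyperbolic_SL2Z" "trace B = t" by (rule hyperbolic_SL2Z_trace_ex[OF t(1)])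
    obtain G :: "'a monoid" where G: "discrete_split_oscillator_group G" "Osc 1 B 0 \<cong> G"
      by (rule Osc_copy[OF inf order_refl B(1)])
    have G': "G \<in> osc_groups" "group G" using G(1) by (simp_all add: osc_groups_def discrete_split_oscillator_group_def)
    have "K = osc_field (SOME G'. G' \<in> osc_comm_class G)"
      using osc_field_some(2)[OF G'(1)] osc_field_eq[OF G'(2) order_refl B(1) G(2)] t(2) B(2) by simp
    then show "K \<in> (\<lambda>C :: 'a monoid set. osc_field (SOME G. G \<in> C)) ` osc_comm_classes"
      unfolding osc_comm_classes_eq using G'(1) by blast
  qed (auto simp: osc_comm_classes_eq osc_field_some osc_field_real_quadratic)
qed

theorem theorem9p2:
  assumes "infinite (UNIV :: 'a set)"
  shows "(\<exists>!F :: 'a monoid set \<Rightarrow> real set. is_osc_field_map F) \<and>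
    (\<forall>F :: 'a monoid set \<Rightarrow> real set. is_osc_field_map F \<longrightarrow>
      (\<exists>\<Phi> :: 'a monoid set \<Rightarrow> real set.
         (\<forall>G\<in>(osc_groups :: 'a monoid set). \<Phi> (osc_comm_class G) = F (osc_iso_class G)) \<and>
         bij_betw \<Phi> osc_comm_classes real_quadratic_fields))"
proof (intro conjI allI impI)
  show "\<exists>!F :: 'a monoid set \<Rightarrow> real set. is_osc_field_map F"
  proof (rule ex_ex1I)
    show "\<exists>F :: 'a monoid set \<Rightarrow> real set. is_osc_field_map F"
      using osc_field_map_ex[OF assms] by blast
    fix F F' :: "'a monoid set \<Rightarrow> real set" assume F: "is_osc_field_map F" "is_osc_field_map F'"
    then have PiE: "F \<in> osc_iso_classes \<rightarrow>\<^sub>E real_quadratic_fields" "F' \<in> osc_iso_classes \<rightarrow>\<^sub>E real_quadratic_fields"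
      by (simp_all add: is_osc_field_map_def)
    show "F = F'"
    proof (rule PiE_ext[OF PiE])
      fix C :: "'a monoid set" assume "C \<in> osc_iso_classes"
      then obtain G :: "'a monoid" where "G \<in> osc_groups" "C = osc_iso_class G" unfolding osc_iso_classes_eq by blast
      then show "F C = F' C" by (simp add: osc_field_map_value F)
    qed
  qed
next
  fix F :: "'a monoid set \<Rightarrow> real set" assume F: "is_osc_field_map F"
  have "\<forall>G\<in>(osc_groups :: 'a monoid set). osc_field (SOME G'. G' \<in> osc_comm_class G) = F (osc_iso_class G)"
    by (simp add: osc_field_some osc_field_map_value[OF F])
  then show "\<exists>\<Phi> :: 'a monoid set \<Rightarrow> real set.
      (\<forall>G\<in>(osc_groups :: 'a monoid set). \<Phi> (osc_comm_class G) = F (osc_iso_class G)) \<and>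
      bij_betw \<Phi> osc_comm_classes real_quadratic_fields"
    by (intro exI[of _ "\<lambda>C. osc_field (SOME G'. G' \<in> C)"] conjI osc_comm_classes_bij assms)
qed

end
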